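(* Let $n\ge1$, let $P,Q$ be non-zero polynomials in $n$ variables with coefficients in $\overline{K}_c$, and let $R=P(\Delta_1,\ldots,\Delta_n)+Q(\Delta_1,\ldots,\Delta_n)d\in\mathfrak A_{n+1}$. Let $I=\mathfrak A_{n+1}R$ be the left ideal generated by $R$. Then the left $\mathfrak A_{n+1}$-module $M=\mathfrak A_{n+1}/I$ is quasi-holonomic, i.e. $d(M)=n+1$.
   Context: Let $q$ be a power of a prime $p$, $K=\mathbb F_q((x))$, and $\overline{K}_c$ the completion of an algebraic closure of $K$. Put $[1]=x^q-x$. Consider functions of variables $z,s_1,\ldots,s_n$ (germs of convergent series of the form $\sum c_{m,i_1,\ldots,i_n}s_1^{q^{i_1}}\cdots s_n^{q^{i_n}}z^{q^m}/D_m$, $m\le\min(i_1,\ldots,i_n)$, where $D_0=1$ and $D_m=[m][m-1]^q\cdots[1]^{q^{m-1}}$ with $[k]=x^{q^k}-x$). On them act: $\tau u=u^q$; $\Delta_j u=u(\ldots,xs_j,\ldots)-xu$ (in the variable $s_j$); the Carlitz derivative $d$ in $z$, $(du)(z)=(u(xz)-xu(z))^{1/q}$; and multiplication by scalars $\lambda\in\overline{K}_c$. The Carlitz ring $\mathfrak A_{n+1}$ is the ring of operators generated by $\tau,d,\Delta_1,\ldots,\Delta_n$ and the scalars. They satisfy $\Delta_j\lambda=\lambda\Delta_j$, $\tau\lambda=\lambda^q\tau$, $d\lambda=\lambda^{1/q}d$, the $\Delta_j$ commute with each other, and $d\tau-\tau d=[1]^{1/q}I$, $d\Delta_j-\Delta_jd=[1]^{1/q}d$,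 $\Delta_j\tau-\tau\Delta_j=[1]\tau$. Every element of $\mathfrak A_{n+1}$ is written uniquely as a finite sum $\sum a_{l,\mu,i_1,\ldots,i_n}\tau^ld^\mu\Delta_1^{i_1}\cdots\Delta_n^{i_n}$ with $a_{l,\mu,i_1,\ldots,i_n}\in\overline{K}_c$. Filtration: $\Gamma_\nu$ is the $\overline{K}_c$-span of such sums with $l+\mu+i_1+\cdots+i_n\le\nu$ for all non-zero terms; this makes $\mathfrak A_{n+1}$ a filtered ring. For a left $\mathfrak A_{n+1}$-module $M$, a filtration is an increasing sequence $\mathfrak M_0\subset\mathfrak M_1\subset\cdots$ of finite-dimensional $\overline{K}_c$-subspaces with union $M$ and $\Gamma_\nu\mathfrak M_j\subset\mathfrak M_{\nu+j}$; it is good if the associated graded module is finitely generated. For a good filtration there is a polynomial $\chi\in\mathbb Q[t]$ with $\dim_{\overline{K}_c}\mathfrak M_s=\chi(s)$ for all large $s$; the dimension $d(M)=\deg\chi$ does not depend on the good filtration chosen. A module is quasi-holonomic if $d(M)=n+1$. *)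

theory Defs
  imports
    "HOL-Analysis.Analysis"
    "HOL-Computational_Algebra.Formal_Laurent_Series"
    "HOL-Algebra.Algebraic_Closure_Type"
    "HOL-Algebra.Generated_Rings"
    "HOL-Library.Poly_Mapping"
    "Jordan_Normal_Form.VS_Connect"
begin

section \<open>The completion of an algebraic closure of a Laurent series field\<close>

text \<open>The absolute value of an element \<open>a\<close> is \<open>dist a 0\<close>.\<close>

class nonarchimedean_field = field + metric_space +
  assumes dist_add_right: "dist (a + c) (b + c) = dist a b"
    and dist_mult_zero: "dist (a * b) 0 = dist a 0 * dist b 0"
    and dist_ultrametric: "dist a c \<le> max (dist a b) (dist b c)"
begin

lemma dist_minus_zero: "dist a b = dist (a - b) 0"
  using dist_add_right[of "a - b" b 0] by simp

lemma dist_uminus: "dist (- a) (- b) = dist a b"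
  using dist_add_right[of "- a" "a + b" "- b"]
  by (simp add: dist_commute algebra_simps)

lemma dist_add_le: "dist (a + b) (c + d) \<le> dist a c + dist b d"
proof -
  have "dist (a + b) (c + b) = dist a c"
    by (rule dist_add_right)
  moreover have "dist (c + b) (c + d) = dist b d"
    using dist_add_right[of b c d] by (simp add: add.commute)
  ultimately show ?thesis
    using dist_triangle[of "a + b" "c + d" "c + b"] by simp
qed

subclass topological_ab_group_add
proof
  fix a b :: 'a
  show "((\<lambda>y. fst y + snd y) \<longlongrightarrow> a + b) (nhds a \<times>\<^sub>F nhds b)"
  proof (rule tendstoI)
    fix e :: real
    assume "e > 0"
    then have "\<forall>\<^sub>F y in nhds a. dist y a < e / 2" and "\<forall>\<^sub>F y in nhds b. dist y b < e / 2"
      by (auto simp: eventually_nhds_metric intro!: exI[of _ "e / 2"])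
    moreover have "dist (y + y') (a + b) < e" if "dist y a < e / 2" "dist y' b < e / 2" for y y'
      using that dist_add_le[of y y' a b] by simp
    ultimately show "\<forall>\<^sub>F y in nhds a \<times>\<^sub>F nhds b. dist (fst y + snd y) (a + b) < e"
      unfolding eventually_prod_filter fst_conv snd_conv by blast
  qed
  show "(uminus \<longlongrightarrow> - a) (nhds a)"
    by (rule tendstoI) (auto simp: dist_uminus eventually_nhds_metric)
qed

end

text \<open>
  \<open>\<iota>\<close> exhibits the complete field \<open>'k\<close> as the completion of an algebraic closure of the field of
  Laurent series over the finite field \<open>'f\<close>. The absolute value of the Laurent series field is
  normalised by \<open>\<bar>x\<bar> = 1 / CARD('f)\<close>; its extension to the algebraic closure is unique and hence
  given by \<open>\<lambda>a. dist (\<iota> a) 0\<close>.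
\<close>

locale completed_algebraic_closure =
  field_hom \<iota>
  for \<iota> :: "'f::{field,finite} fls alg_closure \<Rightarrow> 'k::{nonarchimedean_field,complete_space}" +
  assumes dist_to_ac:
      "f \<noteq> 0 \<Longrightarrow> dist (\<iota> (to_ac f)) 0 = real CARD('f) powi (- fls_subdegree f)"
    and dense_range: "closure (range \<iota>) = UNIV"


section \<open>Left modules over a noncommutative ring\<close>

locale left_module = R?: ring R + M?: abelian_group M
  for R :: "('r, 'd) ring_scheme" (structure) and M :: "('r, 'm, 'e) module_scheme" (structure) +
  assumes smult_closed:
      "\<lbrakk>a \<in> carrier R; m \<in> carrier M\<rbrakk> \<Longrightarrow> a \<odot>\<^bsub>M\<^esub> m \<in> carrier M"
    and smult_l_distr:
      "\<lbrakk>a \<in> carrier R; b \<in> carrier R; m \<in> carrier M\<rbrakk> \<Longrightarrow>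
        (a \<oplus>\<^bsub>R\<^esub> b) \<odot>\<^bsub>M\<^esub> m = a \<odot>\<^bsub>M\<^esub> m \<oplus>\<^bsub>M\<^esub> b \<odot>\<^bsub>M\<^esub> m"
    and smult_r_distr:
      "\<lbrakk>a \<in> carrier R; m \<in> carrier M; m' \<in> carrier M\<rbrakk> \<Longrightarrow>
        a \<odot>\<^bsub>M\<^esub> (m \<oplus>\<^bsub>M\<^esub> m') = a \<odot>\<^bsub>M\<^esub> m \<oplus>\<^bsub>M\<^esub> a \<odot>\<^bsub>M\<^esub> m'"
    and smult_assoc:
      "\<lbrakk>a \<in> carrier R; b \<in> carrier R; m \<in> carrier M\<rbrakk> \<Longrightarrow>
        (a \<otimes>\<^bsub>R\<^esub> b) \<odot>\<^bsub>M\<^esub> m = a \<odot>\<^bsub>M\<^esub> (b \<odot>\<^bsub>M\<^esub> m)"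
    and smult_one: "m \<in> carrier M \<Longrightarrow> \<one>\<^bsub>R\<^esub> \<odot>\<^bsub>M\<^esub> m = m"

definition regular_module :: "('r, 'e) ring_scheme \<Rightarrow> ('r, 'r) module" where
  "regular_module R =
    \<lparr>carrier = carrier R, mult = mult R, one = one R, zero = zero R, add = add R,
     smult = mult R\<rparr>"

definition quotient_module :: "('r, 'e) ring_scheme \<Rightarrow> 'r set \<Rightarrow> ('r, 'r set) module" where
  "quotient_module R I =
    \<lparr>carrier = a_rcosets\<^bsub>R\<^esub> I, mult = undefined, one = undefined, zero = I, add = set_add R,
     smult = (\<lambda>a C. \<Union>b\<in>C. I +>\<^bsub>R\<^esub> (a \<otimes>\<^bsub>R\<^esub> b))\<rparr>"

definition restrict_scalars ::
    "('c \<Rightarrow> 'r) \<Rightarrow> ('r, 'm, 'e) module_scheme \<Rightarrow> ('c, 'm) module" where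
  "restrict_scalars h M =
    \<lparr>carrier = carrier M, mult = mult M, one = one M, zero = zero M, add = add M,
     smult = (\<lambda>c m. h c \<odot>\<^bsub>M\<^esub> m)\<rparr>"

definition fg_module :: "('r, 'e) ring_scheme \<Rightarrow> ('r, 'm, 'd) module_scheme \<Rightarrow> bool" where
  "fg_module R M \<longleftrightarrow>
    (\<exists>S. finite S \<and> S \<subseteq> carrier M \<and> \<Inter> {N. Module.submodule N R M \<and> S \<subseteq> N} = carrier M)"


section \<open>Filtrations and dimension\<close>

text \<open>
  For a filtration \<open>F\<close> of \<open>M\<close>, the associated graded module consists of the families
  \<open>g k \<in> F k / F (k - 1)\<close> with almost all \<open>g k\<close> zero, where \<open>F (-1) = 0\<close>. The quotients are groups
  written multiplicatively in \<open>(A_Mod)\<close>.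
\<close>

definition filt_pred :: "('r, 'm, 'e) module_scheme \<Rightarrow> (nat \<Rightarrow> 'm set) \<Rightarrow> nat \<Rightarrow> 'm set" where
  "filt_pred M F k = (case k of 0 \<Rightarrow> {\<zero>\<^bsub>M\<^esub>} | Suc j \<Rightarrow> F j)"

definition gr_piece :: "('r, 'm, 'e) module_scheme \<Rightarrow> (nat \<Rightarrow> 'm set) \<Rightarrow> nat \<Rightarrow> 'm set monoid" where
  "gr_piece M F k = (M\<lparr>carrier := F k\<rparr>) A_Mod (filt_pred M F k)"

definition gr_module ::
    "('r, 'm, 'e) module_scheme \<Rightarrow> (nat \<Rightarrow> 'm set) \<Rightarrow> (nat \<Rightarrow> 'r set, nat \<Rightarrow> 'm set) module" where
  "gr_module M F =
    \<lparr>carrier = {g. (\<forall>k. g k \<in> carrier (gr_piece M F k)) \<and>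
                 finite {k. g k \<noteq> \<one>\<^bsub>gr_piece M F k\<^esub>}},
     mult = undefined, one = undefined,
     zero = (\<lambda>k. \<one>\<^bsub>gr_piece M F k\<^esub>),
     add = (\<lambda>g h k. g k \<otimes>\<^bsub>gr_piece M F k\<^esub> h k),
     smult = (\<lambda>a g k. \<Otimes>\<^bsub>gr_piece M F k\<^esub>i\<in>{..k}.
                \<Union>r\<in>a i. \<Union>m\<in>g (k - i). filt_pred M F k +>\<^bsub>M\<^esub> (r \<odot>\<^bsub>M\<^esub> m))\<rparr>"

definition gr_ring :: "('r, 'e) ring_scheme \<Rightarrow> (nat \<Rightarrow> 'r set) \<Rightarrow> (nat \<Rightarrow> 'r set) ring" where
  "gr_ring R \<Gamma> =
    (let L = regular_module R; G = gr_module L \<Gamma> in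
      \<lparr>carrier = carrier G,
       mult = smult G,
       one = (\<lambda>k. if k = 0 then filt_pred L \<Gamma> 0 +>\<^bsub>R\<^esub> \<one>\<^bsub>R\<^esub> else filt_pred L \<Gamma> k),
       zero = zero G,
       add = add G\<rparr>)"

text \<open>
  In the following, \<open>h\<close> is the embedding of the field of scalars into the ring \<open>R\<close>, and \<open>\<Gamma>\<close> is the
  filtration of \<open>R\<close>.
\<close>

definition filt_vs ::
    "('k \<Rightarrow> 'r) \<Rightarrow> ('r, 'm, 'e) module_scheme \<Rightarrow> (nat \<Rightarrow> 'm set) \<Rightarrow> nat \<Rightarrow> ('k, 'm) module" where
  "filt_vs h M F s = (restrict_scalars h M)\<lparr>carrier := F s\<rparr>"

definition module_filtration ::
    "('k::field \<Rightarrow> 'r) \<Rightarrow> (nat \<Rightarrow> 'r set) \<Rightarrow> ('r, 'm, 'e) module_scheme \<Rightarrow> (nat \<Rightarrow> 'm set) \<Rightarrow> bool"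
  where
  "module_filtration h \<Gamma> M F \<longleftrightarrow>
    (\<forall>s. VectorSpace.subspace class_ring (F s) (restrict_scalars h M) \<and>
         vectorspace.fin_dim class_ring (filt_vs h M F s)) \<and>
    (\<forall>s. F s \<subseteq> F (Suc s)) \<and>
    (\<Union>s. F s) = carrier M \<and>
    (\<forall>\<nu> j. \<forall>a\<in>\<Gamma> \<nu>. \<forall>m\<in>F j. a \<odot>\<^bsub>M\<^esub> m \<in> F (\<nu> + j))"

definition good_filtration ::
    "('k::field \<Rightarrow> 'r) \<Rightarrow> ('r, 'd) ring_scheme \<Rightarrow> (nat \<Rightarrow> 'r set) \<Rightarrow>
      ('r, 'm, 'e) module_scheme \<Rightarrow> (nat \<Rightarrow> 'm set) \<Rightarrow> bool" where
  "good_filtration h R \<Gamma> M F \<longleftrightarrow>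
    module_filtration h \<Gamma> M F \<and> fg_module (gr_ring R \<Gamma>) (gr_module M F)"

text \<open>The degree of the Hilbert polynomial does not depend on the choice of a good filtration.\<close>

definition module_dim ::
    "('k::field \<Rightarrow> 'r) \<Rightarrow> ('r, 'd) ring_scheme \<Rightarrow> (nat \<Rightarrow> 'r set) \<Rightarrow>
      ('r, 'm, 'e) module_scheme \<Rightarrow> nat" where
  "module_dim h R \<Gamma> M =
    (THE d. \<exists>F. \<exists>H :: rat poly. good_filtration h R \<Gamma> M F \<and>
       (\<forall>\<^sub>F s in sequentially.
          rat_of_nat (vectorspace.dim class_ring (filt_vs h M F s)) = poly H (rat_of_nat s)) \<and>
       Polynomial.degree H = d)"


section \<open>The Carlitz ring\<close>

text \<open>
  The functions depend on a pair \<open>(s, z)\<close>, where \<open>s\<close> has one component for each element of the finite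
  type \<open>'n\<close>; hence \<open>n = CARD('n) \<ge> 1\<close>. The parameters \<open>q\<close> and \<open>x\<close> are the cardinality of
  the finite field and the image of the Laurent series variable in \<open>'k\<close>.
\<close>

type_synonym ('n, 'k) fn = "('n \<Rightarrow> 'k) \<times> 'k \<Rightarrow> 'k"
type_synonym ('n, 'k) germ_op = "('n, 'k) fn set \<Rightarrow> ('n, 'k) fn set"

definition germ :: "('n, 'k::{zero,topological_space}) fn \<Rightarrow> ('n, 'k) fn set" where
  "germ u = {w. \<forall>\<^sub>F p in nhds (\<lambda>_. 0, 0). w p = u p}"

definition carlitz_bracket :: "nat \<Rightarrow> 'k::field \<Rightarrow> nat \<Rightarrow> 'k" where
  "carlitz_bracket q x k = x ^ (q ^ k) - x"

definition carlitz_D :: "nat \<Rightarrow> 'k::field \<Rightarrow> nat \<Rightarrow> 'k" where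
  "carlitz_D q x m = (\<Prod>i<m. carlitz_bracket q x (m - i) ^ (q ^ i))"

definition carlitz_germs ::
    "nat \<Rightarrow> 'k::{field,topological_space} \<Rightarrow> ('n::finite, 'k) fn set set" where
  "carlitz_germs q x =
    {germ u | u. \<exists>c :: nat \<Rightarrow> ('n \<Rightarrow> nat) \<Rightarrow> 'k.
       \<forall>\<^sub>F (s, z) in nhds (\<lambda>_. 0, 0).
         ((\<lambda>(m, i). c m i * (\<Prod>j\<in>UNIV. s j ^ (q ^ i j)) * z ^ (q ^ m) / carlitz_D q x m)
            has_sum u (s, z)) {(m, i). \<forall>j. m \<le> i j}}"

definition germ_group ::
    "nat \<Rightarrow> 'k::{field,topological_space} \<Rightarrow> ('n::finite, 'k) fn set monoid" where
  "germ_group q x =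
    \<lparr>carrier = carlitz_germs q x,
     mult = (\<lambda>G H. \<Union>u\<in>G. \<Union>w\<in>H. germ (\<lambda>p. u p + w p)),
     one = germ (\<lambda>_. 0)\<rparr>"

definition endo_ring :: "('a, 'e) monoid_scheme \<Rightarrow> ('a \<Rightarrow> 'a) ring" where
  "endo_ring G =
    \<lparr>carrier = hom G G \<inter> extensional (carrier G),
     mult = compose (carrier G),
     one = (\<lambda>g\<in>carrier G. g),
     zero = (\<lambda>g\<in>carrier G. \<one>\<^bsub>G\<^esub>),
     add = (\<lambda>f h. \<lambda>g\<in>carrier G. f g \<otimes>\<^bsub>G\<^esub> h g)\<rparr>"

definition germ_lift ::
    "nat \<Rightarrow> 'k::{field,topological_space} \<Rightarrow> (('n::finite, 'k) fn \<Rightarrow> ('n, 'k) fn) \<Rightarrow> ('n, 'k) germ_op"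
  where
  "germ_lift q x T = (\<lambda>G\<in>carlitz_germs q x. \<Union>u\<in>G. germ (T u))"

definition qth_root :: "nat \<Rightarrow> 'k::field \<Rightarrow> 'k" where
  "qth_root q a = (THE b. b ^ q = a)"

definition carlitz_tau :: "nat \<Rightarrow> 'k::{field,topological_space} \<Rightarrow> ('n::finite, 'k) germ_op" where
  "carlitz_tau q x = germ_lift q x (\<lambda>u p. u p ^ q)"

definition carlitz_Delta ::
    "nat \<Rightarrow> 'k::{field,topological_space} \<Rightarrow> 'n::finite \<Rightarrow> ('n, 'k) germ_op" where
  "carlitz_Delta q x j = germ_lift q x (\<lambda>u (s, z). u (s(j := x * s j), z) - x * u (s, z))"

definition carlitz_d :: "nat \<Rightarrow> 'k::{field,topological_space} \<Rightarrow> ('n::finite, 'k) germ_op" where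
  "carlitz_d q x = germ_lift q x (\<lambda>u (s, z). qth_root q (u (s, x * z) - x * u (s, z)))"

definition carlitz_scalar ::
    "nat \<Rightarrow> 'k::{field,topological_space} \<Rightarrow> 'k \<Rightarrow> ('n::finite, 'k) germ_op" where
  "carlitz_scalar q x a = germ_lift q x (\<lambda>u p. a * u p)"

definition carlitz_ring ::
    "nat \<Rightarrow> 'k::{field,topological_space} \<Rightarrow> ('n::finite, 'k) germ_op ring" where
  "carlitz_ring q x =
    (endo_ring (germ_group q x))
      \<lparr>carrier := generate_ring (endo_ring (germ_group q x))
         ({carlitz_tau q x, carlitz_d q x} \<union> range (carlitz_Delta q x) \<union>
          range (carlitz_scalar q x))\<rparr>"

text \<open>
  The subring generated by the \<open>\<Delta>\<^sub>j\<close> and the scalars is commutative, unlike the whole ring, so that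
  unordered products of powers of the \<open>\<Delta>\<^sub>j\<close> are taken there.
\<close>

definition carlitz_Delta_ring ::
    "nat \<Rightarrow> 'k::{field,topological_space} \<Rightarrow> ('n::finite, 'k) germ_op ring" where
  "carlitz_Delta_ring q x =
    (carlitz_ring q x)
      \<lparr>carrier := generate_ring (carlitz_ring q x)
         (range (carlitz_Delta q x) \<union> range (carlitz_scalar q x))\<rparr>"

definition Delta_monom ::
    "nat \<Rightarrow> 'k::{field,topological_space} \<Rightarrow> ('n::finite \<Rightarrow>\<^sub>0 nat) \<Rightarrow> ('n, 'k) germ_op" where
  "Delta_monom q x i =
    (\<Otimes>\<^bsub>carlitz_Delta_ring q x\<^esub>j\<in>UNIV.
       carlitz_Delta q x j [^]\<^bsub>carlitz_Delta_ring q x\<^esub> Poly_Mapping.lookup i j)"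

definition Delta_poly ::
    "nat \<Rightarrow> 'k::{field,topological_space} \<Rightarrow> (('n::finite \<Rightarrow>\<^sub>0 nat) \<Rightarrow>\<^sub>0 'k) \<Rightarrow> ('n, 'k) germ_op" where
  "Delta_poly q x P =
    (\<Oplus>\<^bsub>carlitz_Delta_ring q x\<^esub>i\<in>Poly_Mapping.keys P.
       carlitz_scalar q x (Poly_Mapping.lookup P i) \<otimes>\<^bsub>carlitz_Delta_ring q x\<^esub> Delta_monom q x i)"

definition carlitz_filtration ::
    "nat \<Rightarrow> 'k::{field,topological_space} \<Rightarrow> nat \<Rightarrow> ('n::finite, 'k) germ_op set" where
  "carlitz_filtration q x \<nu> =
    LinearCombinations.module.span class_ring
      (restrict_scalars (carlitz_scalar q x) (regular_module (carlitz_ring q x)))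
      {carlitz_tau q x [^]\<^bsub>carlitz_ring q x\<^esub> l
         \<otimes>\<^bsub>carlitz_ring q x\<^esub> carlitz_d q x [^]\<^bsub>carlitz_ring q x\<^esub> \<mu>
         \<otimes>\<^bsub>carlitz_ring q x\<^esub> Delta_monom q x i
       | (l :: nat) (\<mu> :: nat) i. l + \<mu> + (\<Sum>j\<in>UNIV. Poly_Mapping.lookup i j) \<le> \<nu>}"

definition quasi_holonomic ::
    "nat \<Rightarrow> 'k::{field,topological_space} \<Rightarrow> (('n::finite, 'k) germ_op, 'm, 'e) module_scheme \<Rightarrow> bool"
  where
  "quasi_holonomic q x M \<longleftrightarrow>
    left_module (carlitz_ring q x) M \<and>
    module_dim (carlitz_scalar q x) (carlitz_ring q x) (carlitz_filtration q x) M = CARD('n) + 1"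

end

theory Submission
  imports Defs "HOL-Algebra.Sylow"
begin

text \<open>
  Modulo lower degree, the product of two monomials \<open>\<tau>\<^sup>l d\<^sup>\<mu> \<Delta>\<^sup>i\<close> with scalar coefficients is the
  monomial of the sum of the exponents, with non-zero coefficients twisted by a power of the
  Frobenius automorphism, and the monomials are linearly independent as operators on germs. Hence
  leading monomials with respect to a degree-compatible monomial order are multiplicative, and the
  monomials of degree at most \<open>s\<close> that are not multiples of the leading monomial of the generator
  \<open>R\<close> of the left ideal give a basis of the \<open>s\<close>-th step of the filtration of the quotient induced
  by that of the ring. If \<open>R\<close> has degree \<open>r\<close>, the dimension of this step is the difference of the
  numbers of monomials in \<open>n + 2\<close> variables of degree at most \<open>s\<close> and at most \<open>s - r\<close>, a polynomial
  in \<open>s\<close> of degree \<open>n + 1\<close>, because \<open>Q \<noteq> 0\<close> forces \<open>r > 0\<close>. Any two good filtrations contain each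
  other up to a shift, so that their Hilbert polynomials have the same degree.
\<close>

section \<open>Frobenius on the completed algebraic closure\<close>

text \<open>The Carlitz ring is given only as a ring of operators on germs, so the normal form
  itself has to be proved. The commutation rules hold for arbitrary functions, without any
  convergence, and all reordering is done there. Germs and series enter only when operators are
  lifted and when linear independence is shown. After that, \<open>L\<close> identifies the ring
  with finitely supported coefficient families, and the rest is linear algebra on these. The
  operators \<open>\<tau>\<close> and \<open>d\<close> are only semilinear; scalars can be moved
  past them because the \<open>q\<close>-th power map is additive and bijective, and twisted
  coefficients of leading terms stay non-zero. The order has to compare total degrees first, because
  the errors of reordering are controlled only by their degree and because division must respect the
  steps of the filtration. The Hilbert polynomial has degree \<open>n + 1\<close> rather than the
  number \<open>n + 2\<close> of exponents because the top terms of two binomial polynomials cancel.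
  The degree of \<open>R\<close> is positive because a monomial \<open>d \<Delta>^i\<close>, with
  \<open>i\<close> of maximal degree in \<open>Q\<close>, survives the reordering of
  \<open>Q(\<Delta>) d\<close> and cannot be cancelled by \<open>P\<close>.\<close>

context nonarchimedean_field
begin

lemma dist_one_zero: "dist 1 0 = 1"
proof -
  have "dist 1 0 * dist 1 0 = dist (1 * 1) 0"
    by (rule dist_mult_zero[symmetric])
  then show ?thesis
    by simp
qed

lemma dist_power_zero: "dist (a ^ n) 0 = dist a 0 ^ n"
  by (induction n) (simp_all add: dist_one_zero dist_mult_zero)

lemma dist_mult_left: "dist (c * a) (c * b) = dist c 0 * dist a b"
  by (metis dist_minus_zero dist_mult_zero right_diff_distrib)

end

text \<open>For a prime \<open>r\<close> dividing the order, Sylow's theorem with exponent 1 gives a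
  subgroup of order \<open>r\<close> of the additive group. A non-zero element \<open>g\<close> of
  it satisfies \<open>r * g = 0\<close>, which forces \<open>r\<close> to be the
  characteristic.\<close>

lemma finite_field_card_prime_power:
  obtains k where "CARD('f::{field,finite}) = CHAR('f) ^ k" and "Factorial_Ring.prime (CHAR('f))"
proof -
  have p: "Factorial_Ring.prime (CHAR('f))"
    using finite_imp_CHAR_pos[where 'a='f] prime_CHAR_semidom[where 'a='f] by simp
  let ?G = "\<lparr>carrier = UNIV, mult = (+), one = 0\<rparr> :: 'f monoid"
  interpret G: group ?G
  proof (rule groupI)
    fix a :: 'f
    show "\<exists>b\<in>carrier ?G. b \<otimes>\<^bsub>?G\<^esub> a = \<one>\<^bsub>?G\<^esub>"
      using left_minus[of a] by (metis UNIV_I monoid.select_convs(1,2) partial_object.select_convs(1))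
  qed (simp_all add: add.assoc)
  have npow: "g [^]\<^bsub>?G\<^esub> n = of_nat n * g" for g and n :: nat
    by (induction n) (simp_all add: nat_pow_def algebra_simps)
  have "r = CHAR('f)" if r: "Factorial_Ring.prime r" "r dvd CARD('f)" for r
  proof -
    obtain m where "CARD('f) = r ^ 1 * m"
      using r by auto
    then obtain H where H: "subgroup H ?G" "card H = r"
      using sylow_thm[OF r(1) G.is_group, of 1 m] by (auto simp: order_def)
    have "H \<noteq> {0}"
      using H r prime_gt_1_nat[OF r(1)] by auto
    then obtain g where g: "g \<in> H" "g \<noteq> 0"
      using subgroup.one_closed[OF H(1)] by auto
    interpret H: group "?G\<lparr>carrier := H\<rparr>"
      using H(1) by (rule subgroup.subgroup_is_group) (rule G.is_group)
    have "g [^]\<^bsub>?G\<lparr>carrier := H\<rparr>\<^esub> r = 0"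
      using H.pow_order_eq_1[of g] g H(2) by (simp add: order_def)
    then have "of_nat r * g = 0"
      using npow[of g r] by (simp add: nat_pow_def)
    then have "of_nat r = (0 :: 'f)"
      using g by simp
    then show ?thesis
      using p r(1) primes_dvd_imp_eq[of "CHAR('f)" r] by (simp add: of_nat_eq_0_iff_char_dvd)
  qed
  then have "prime_factors CARD('f) \<subseteq> {CHAR('f)}"
    by (auto dest: in_prime_factors_imp_dvd in_prime_factors_imp_prime)
  then have "(\<Prod>r\<in>prime_factors CARD('f). r ^ multiplicity r CARD('f)) =
      (\<Prod>r\<in>{CHAR('f)}. r ^ multiplicity r CARD('f))"
    by (intro prod.mono_neutral_left) (auto simp: prime_factors_multiplicity p)
  then have "CARD('f) = CHAR('f) ^ multiplicity (CHAR('f)) CARD('f)"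
    using prod_prime_factors[of "CARD('f)"] by simp
  then show thesis
    using that p by blast
qed

text \<open>Collects what the Carlitz operators require of the scalars. Algebraic closedness and
  completeness enter only through \<open>frob_surj\<close>.\<close>

locale carlitz_field =
  fixes q :: nat and x :: "'k::nonarchimedean_field"
  assumes q_gt_1: "q > 1"
    and frob_add: "\<And>a b :: 'k. (a + b) ^ q = a ^ q + b ^ q"
    and frob_surj: "\<And>a :: 'k. \<exists>b. b ^ q = a"
    and x_nonzero: "x \<noteq> 0"
    and dist_x_lt_1: "dist x 0 < 1"

lemma (in completed_algebraic_closure) frob_add:
  fixes a b :: 'k
  shows "(a + b) ^ CARD('f) = a ^ CARD('f) + b ^ CARD('f)"
proof -
  obtain k where k: "CARD('f) = CHAR('f) ^ k" and p: "Factorial_Ring.prime (CHAR('f))"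
    by (rule finite_field_card_prime_power)
  have "of_nat (CHAR('f)) = (0 :: 'f fls)"
    by (simp add: fls_of_nat)
  then have "to_ac (of_nat (CHAR('f)) :: 'f fls) = 0"
    by simp
  then have "\<iota> (of_nat (CHAR('f))) = 0"
    by simp
  then have "of_nat (CHAR('f)) = (0 :: 'k)"
    by (simp add: hom_distribs)
  then have "CHAR('k) dvd CHAR('f)"
    by (simp add: of_nat_eq_0_iff_char_dvd)
  moreover have "CHAR('k) \<noteq> 1"
    by simp
  ultimately have "CHAR('k) = CHAR('f)"
    using p by (meson prime_nat_iff)
  then show ?thesis
    using freshmans_dream'[where 'a='k, of "CARD('f)" k] k p by simp
qed

text \<open>Elements of the dense algebraic closure have \<open>q\<close>-th roots there. Since
  \<open>|c^q - d^q| = |c - d|^q\<close>, the roots of the members of a convergent sequence form a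
  Cauchy sequence, and completeness provides its limit.\<close>

lemma (in completed_algebraic_closure) frob_surj:
  fixes a :: 'k
  shows "\<exists>b. b ^ CARD('f) = a"
proof -
  let ?q = "CARD('f)"
  have q: "?q > 0"
    by simp
  have diff: "dist (c ^ ?q) (d ^ ?q) = dist c d ^ ?q" for c d :: 'k
  proof -
    have "c ^ ?q = (c - d) ^ ?q + d ^ ?q"
      using frob_add[of "c - d" d] by simp
    then show ?thesis
      by (metis add_diff_cancel_right' dist_minus_zero dist_power_zero)
  qed
  have "a \<in> closure (range \<iota>)"
    by (simp add: dense_range)
  then obtain f where f: "\<And>n. f n \<in> range \<iota>" "f \<longlonglongrightarrow> a"
    unfolding closure_sequential by blast
  have "\<exists>b. b ^ ?q = f n" for n
  proof -
    obtain c where "f n = \<iota> c"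
      using f(1)[of n] by blast
    moreover obtain b where "b ^ ?q = c"
      using nth_root_exists[OF q] by blast
    ultimately show ?thesis
      by (metis hom_power)
  qed
  then obtain g where g: "\<And>n. g n ^ ?q = f n"
    by metis
  have "Cauchy g"
  proof (rule metric_CauchyI)
    fix e :: real
    assume e: "e > 0"
    then have "e ^ ?q > 0"
      by simp
    then obtain N where "\<And>m n. m \<ge> N \<Longrightarrow> n \<ge> N \<Longrightarrow> dist (f m) (f n) < e ^ ?q"
      using LIMSEQ_imp_Cauchy[OF f(2)] metric_CauchyD by blast
    then have "dist (g m) (g n) < e" if "m \<ge> N" "n \<ge> N" for m n
      using that e diff[of "g m" "g n"] g by (metis less_imp_le power_less_imp_less_base)
    then show "\<exists>M. \<forall>m\<ge>M. \<forall>n\<ge>M. dist (g m) (g n) < e"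
      by blast
  qed
  then obtain b where b: "g \<longlonglongrightarrow> b"
    using Cauchy_convergent convergentD by blast
  have "(\<lambda>n. dist (g n) b ^ ?q) \<longlonglongrightarrow> 0 ^ ?q"
    using b tendsto_dist_iff by (intro tendsto_power) blast
  moreover have "dist (f n) (b ^ ?q) = dist (g n) b ^ ?q" for n
    using diff[of "g n" b] g[of n] by simp
  ultimately have "(\<lambda>n. dist (f n) (b ^ ?q)) \<longlonglongrightarrow> 0"
    using q by (simp only: zero_power)
  then have "f \<longlonglongrightarrow> b ^ ?q"
    by (subst tendsto_dist_iff)
  then show ?thesis
    using f(2) LIMSEQ_unique by blast
qed

lemma (in completed_algebraic_closure) carlitz_field:
  "carlitz_field CARD('f) (\<iota> (to_ac fls_X))"
proof
  show q: "CARD('f) > 1"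
    using card_mono[of UNIV "{0, 1 :: 'f}"] by simp
  show "\<iota> (to_ac fls_X) \<noteq> 0"
    by (simp add: fls_X_nonzero)
  show "dist (\<iota> (to_ac fls_X)) 0 < 1"
    using q by (subst dist_to_ac) (auto simp: fls_X_nonzero power_int_minus field_simps)
qed (rule frob_add frob_surj)+

context carlitz_field
begin

lemma frob_zero: "(0::'k) ^ q = 0"
  using q_gt_1 by simp

lemma frob_diff: "(a - b) ^ q = a ^ q - (b :: 'k) ^ q"
  using frob_add[of "a - b" b] by simp

lemma frob_inj: "a ^ q = b ^ q \<longleftrightarrow> a = (b :: 'k)"
  using frob_diff[of a b] q_gt_1 by auto

lemma root_eqI: "b ^ q = a \<Longrightarrow> qth_root q a = (b :: 'k)"
  unfolding qth_root_def by (rule the_equality) (auto simp: frob_inj)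

lemma frob_root [simp]: "qth_root q (a ^ q) = (a :: 'k)"
  by (rule root_eqI) simp

lemma root_frob [simp]: "qth_root q a ^ q = (a :: 'k)"
proof -
  obtain b where "b ^ q = a"
    using frob_surj by blast
  then show ?thesis
    by auto
qed

lemma root_add: "qth_root q (a + b) = qth_root q a + qth_root q (b :: 'k)"
  by (rule root_eqI) (simp add: frob_add)

lemma root_diff: "qth_root q (a - b) = qth_root q a - qth_root q (b :: 'k)"
  by (rule root_eqI) (simp add: frob_diff)

lemma root_mult: "qth_root q (a * b) = qth_root q a * qth_root q (b :: 'k)"
  by (rule root_eqI) (simp add: power_mult_distrib)

lemma root_zero [simp]: "qth_root q (0 :: 'k) = 0"
  by (rule root_eqI) (simp add: frob_zero)

lemma root_one [simp]: "qth_root q (1 :: 'k) = 1"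
  by (rule root_eqI) simp

lemma root_eq_0_iff [simp]: "qth_root q a = 0 \<longleftrightarrow> a = (0 :: 'k)"
proof
  assume "qth_root q a = 0"
  then show "a = 0"
    using root_frob[of a] by (simp only: frob_zero)
qed simp

lemma dist_frob: "dist (a ^ q) (b ^ q) = dist a (b :: 'k) ^ q"
  by (simp add: dist_minus_zero[of "a ^ q"] dist_minus_zero[of a] dist_power_zero flip: frob_diff)

lemma dist_x_pos: "dist x 0 > 0"
  using x_nonzero by simp

text \<open>Distinct powers of \<open>x\<close> differ already in absolute value. Hence the brackets
  are pairwise distinct, and they later serve as infinitely many eigenvalues of
  \<open>Delta_fn j\<close>.\<close>

lemma power_x_inj: "x ^ m = x ^ n \<longleftrightarrow> m = n"
proof
  assume "x ^ m = x ^ n"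
  then have "dist (x ^ m) 0 = dist (x ^ n) 0"
    by (rule arg_cong)
  then have eq: "dist x 0 ^ m = dist x 0 ^ n"
    unfolding dist_power_zero .
  show "m = n"
    using eq dist_x_pos dist_x_lt_1 power_strict_decreasing[of m n "dist x 0"]
      power_strict_decreasing[of n m "dist x 0"] by (cases m n rule: linorder_cases) auto
qed simp

lemma q_power_inj: "q ^ m = q ^ n \<longleftrightarrow> m = n"
  using q_gt_1 power_inject_exp by auto

lemma carlitz_bracket_inj: "carlitz_bracket q x m = carlitz_bracket q x n \<longleftrightarrow> m = n"
  by (simp add: carlitz_bracket_def power_x_inj q_power_inj)

lemma carlitz_bracket_0 [simp]: "carlitz_bracket q x 0 = 0"
  by (simp add: carlitz_bracket_def)

lemma carlitz_bracket_nonzero: "m > 0 \<Longrightarrow> carlitz_bracket q x m \<noteq> 0"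
  by (metis carlitz_bracket_0 carlitz_bracket_inj less_irrefl)

lemma carlitz_D_0 [simp]: "carlitz_D q x 0 = 1"
  by (simp add: carlitz_D_def)

text \<open>The purpose of the normalisation by \<open>carlitz_D\<close>: passing to the next index
  by a \<open>q\<close>-th power costs exactly one bracket, the same one that the difference in
  \<open>z\<close> produces.\<close>

lemma carlitz_D_Suc: "carlitz_D q x (Suc m) = carlitz_bracket q x (Suc m) * carlitz_D q x m ^ q"
proof -
  have "carlitz_D q x (Suc m) =
      carlitz_bracket q x (Suc m) * (\<Prod>i<m. carlitz_bracket q x (m - i) ^ (q ^ Suc i))"
    by (simp add: carlitz_D_def prod.lessThan_Suc_shift del: prod.lessThan_Suc power_Suc)
  also have "(\<Prod>i<m. carlitz_bracket q x (m - i) ^ (q ^ Suc i)) = carlitz_D q x m ^ q"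
    unfolding carlitz_D_def prod_power_distrib
    by (rule prod.cong) (simp_all flip: power_mult add: mult.commute)
  finally show ?thesis .
qed

end

section \<open>The operators on functions and their normal form\<close>

abbreviation "lookup \<equiv> Poly_Mapping.lookup"
abbreviation "keys \<equiv> Poly_Mapping.keys"

type_synonym 'n expo = "nat \<times> nat \<times> ('n \<Rightarrow>\<^sub>0 nat)"
type_synonym ('n, 'k) fn_op = "('n, 'k) fn \<Rightarrow> ('n, 'k) fn"

definition expo_deg :: "'n::finite expo \<Rightarrow> nat" where
  "expo_deg e = fst e + fst (snd e) + (\<Sum>j\<in>UNIV. lookup (snd (snd e)) j)"

lemma expo_deg_simp: "expo_deg (l, \<mu>, i) = l + \<mu> + (\<Sum>j\<in>UNIV. lookup i j)"
  by (simp add: expo_deg_def)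

lemma expo_deg_add: "expo_deg (e + f) = expo_deg e + expo_deg f"
  by (simp add: expo_deg_def lookup_add sum.distrib)

lemma expo_induct [case_names zero step]:
  fixes i :: "'n::finite \<Rightarrow>\<^sub>0 nat"
  assumes "P 0" and "\<And>i j. P i \<Longrightarrow> P (i + Poly_Mapping.single j 1)"
  shows "P i"
proof (induction "\<Sum>j\<in>UNIV. lookup i j" arbitrary: i)
  case 0
  then have "i = 0"
    by (intro poly_mapping_eqI) simp
  then show ?case
    by (simp add: assms(1))
next
  case (Suc m)
  then have "\<exists>j. lookup i j \<noteq> 0"
    by (metis sum.neutral nat.simps(3))
  then obtain j where j: "lookup i j \<noteq> 0"
    by blast
  define i' where "i' = i - Poly_Mapping.single j 1"
  have i: "i = i' + Poly_Mapping.single j 1"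
    unfolding i'_def using j
    by (intro poly_mapping_eqI) (auto simp: lookup_add lookup_minus lookup_single when_def)
  have "(\<Sum>k\<in>UNIV. lookup i k) = (\<Sum>k\<in>UNIV. lookup i' k) + 1"
    unfolding i by (simp add: lookup_add sum.distrib lookup_single when_def)
  then have "P i'"
    using Suc by simp
  then show ?case
    unfolding i by (rule assms(2))
qed

definition scale :: "'k::field \<Rightarrow> ('a \<Rightarrow>\<^sub>0 'k) \<Rightarrow> ('a \<Rightarrow>\<^sub>0 'k)" where
  "scale a w = Poly_Mapping.map ((*) a) w"

lemma lookup_scale [simp]: "lookup (scale a w) e = a * lookup w e"
  by (simp add: scale_def Poly_Mapping.map.rep_eq when_def)

lemma keys_scale_subset: "keys (scale a w) \<subseteq> keys w"
  by (auto simp: in_keys_iff)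

text \<open>Additivity instead of linearity, because \<open>tau_fn\<close> and \<open>d_fn\<close>
  twist scalars.\<close>

definition additive_op :: "('n, 'k::field) fn_op \<Rightarrow> bool" where
  "additive_op T \<longleftrightarrow> (\<forall>u v. T (\<lambda>p. u p + v p) = (\<lambda>p. T u p + T v p))"

lemma additive_op_add: "additive_op T \<Longrightarrow> T (\<lambda>p. u p + v p) = (\<lambda>p. T u p + T v p)"
  by (simp add: additive_op_def)

lemma additive_op_zero:
  assumes "additive_op T"
  shows "T (\<lambda>p. 0) = (\<lambda>p. 0)"
proof -
  have "T (\<lambda>p. 0) p + T (\<lambda>p. 0) p = T (\<lambda>p. 0) p + 0" for p
    using additive_op_add[OF assms, of "\<lambda>p. 0" "\<lambda>p. 0"] by (metis add_0 add.right_neutral)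
  then show ?thesis
    by (simp only: add_left_cancel fun_eq_iff) simp
qed

lemma additive_op_sum:
  assumes "additive_op T"
  shows "T (\<lambda>p. \<Sum>a\<in>S. f a p) = (\<lambda>p. \<Sum>a\<in>S. T (f a) p)"
  by (induction S rule: infinite_finite_induct)
     (simp_all add: additive_op_zero[OF assms] additive_op_add[OF assms, of "f _"])

lemma additive_op_comp: "additive_op S \<Longrightarrow> additive_op T \<Longrightarrow> additive_op (S \<circ> T)"
  by (simp add: additive_op_def)

lemma additive_op_funpow: "additive_op T \<Longrightarrow> additive_op (T ^^ n)"
  by (induction n) (auto intro!: additive_op_comp simp: additive_op_def[of id])

context carlitz_field
begin

section \<open>The Carlitz operators on arbitrary functions and their commutation rules\<close>

definition tau_fn :: "('n, 'k) fn_op" where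
  "tau_fn u = (\<lambda>p. u p ^ q)"

definition d_fn :: "('n, 'k) fn_op" where
  "d_fn u = (\<lambda>(s, z). qth_root q (u (s, x * z) - x * u (s, z)))"

definition Delta_fn :: "'n \<Rightarrow> ('n, 'k) fn_op" where
  "Delta_fn j u = (\<lambda>(s, z). u (s(j := x * s j), z) - x * u (s, z))"

definition scal_fn :: "'k \<Rightarrow> ('n, 'k) fn_op" where
  "scal_fn a u = (\<lambda>p. a * u p)"

lemma scal_fn_apply: "scal_fn a u p = a * u p"
  by (simp add: scal_fn_def)

lemma additive_tau_fn: "additive_op tau_fn"
  by (simp add: additive_op_def tau_fn_def frob_add)

lemma additive_d_fn: "additive_op d_fn"
  by (auto simp: additive_op_def d_fn_def fun_eq_iff algebra_simps simp flip: root_add)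

lemma additive_Delta_fn: "additive_op (Delta_fn j)"
  by (auto simp: additive_op_def Delta_fn_def fun_eq_iff algebra_simps)

lemma additive_scal_fn: "additive_op (scal_fn a)"
  by (auto simp: additive_op_def scal_fn_def fun_eq_iff algebra_simps)

lemma tau_scal: "tau_fn (scal_fn a u) = scal_fn (a ^ q) (tau_fn u)"
  by (simp add: tau_fn_def scal_fn_def power_mult_distrib)

lemma d_scal: "d_fn (scal_fn a u) = scal_fn (qth_root q a) (d_fn u)"
  by (auto simp: d_fn_def scal_fn_def fun_eq_iff algebra_simps simp flip: root_mult)

lemma Delta_scal: "Delta_fn j (scal_fn a u) = scal_fn a (Delta_fn j u)"
  by (auto simp: Delta_fn_def scal_fn_def fun_eq_iff algebra_simps)

lemma Delta_commute:
  fixes u :: "('n, 'k) fn"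
  shows "Delta_fn j (Delta_fn k u) = Delta_fn k (Delta_fn j u)"
proof (cases "j = k")
  case False
  then have "s(j := x * s j, k := x * s k) = s(k := x * s k, j := x * s j)" for s :: "'n \<Rightarrow> 'k"
    by (auto simp: fun_upd_twist)
  with False show ?thesis
    unfolding Delta_fn_def by (intro ext) (auto simp: algebra_simps)
qed simp

text \<open>The constant \<open>x - qth_root q x\<close> is \<open>[1]^(1/q)\<close>. Likewise
  \<open>x ^ q - x\<close> in \<open>Delta_tau\<close> is \<open>[1]\<close>, and the constant in
  \<open>Delta_d\<close> is \<open>- [1]^(1/q)\<close>, as \<open>Delta_d\<close> solves its
  relation for the other product.\<close>

lemma d_tau: "d_fn (tau_fn u) = (\<lambda>p. tau_fn (d_fn u) p + scal_fn (x - qth_root q x) u p)"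
proof -
  have "d_fn (tau_fn u) (s, z) = u (s, x * z) - qth_root q x * u (s, z)" for s z
    by (simp add: d_fn_def tau_fn_def root_diff root_mult)
  moreover have "tau_fn (d_fn u) (s, z) = u (s, x * z) - x * u (s, z)" for s z
    by (simp add: d_fn_def tau_fn_def)
  ultimately show ?thesis
    by (auto simp: fun_eq_iff scal_fn_def algebra_simps)
qed

lemma Delta_tau:
  "Delta_fn j (tau_fn u) = (\<lambda>p. tau_fn (Delta_fn j u) p + scal_fn (x ^ q - x) (tau_fn u) p)"
  by (auto simp: Delta_fn_def scal_fn_def tau_fn_def fun_eq_iff algebra_simps frob_diff
      power_mult_distrib)

lemma Delta_d:
  "Delta_fn j (d_fn u) = (\<lambda>p. d_fn (Delta_fn j u) p + scal_fn (qth_root q x - x) (d_fn u) p)"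
  by (auto simp: Delta_fn_def scal_fn_def d_fn_def fun_eq_iff algebra_simps root_diff root_mult root_add)

text \<open>The error loses one \<open>tau_fn\<close> and the \<open>d_fn\<close>, hence two
  degrees. The scalar only has to exist, since later just the degree of the error matters. The power
  is \<open>Suc l\<close> because for exponent 0 there is nothing to cross.\<close>

lemma d_tau_funpow:
  "\<exists>c. \<forall>u :: ('n, 'k) fn. d_fn ((tau_fn ^^ Suc l) u) =
    (\<lambda>p. (tau_fn ^^ Suc l) (d_fn u) p + scal_fn c ((tau_fn ^^ l) u) p)"
proof (induction l)
  case 0
  show ?case
    by (auto simp: d_tau)
next
  case (Suc l)
  then obtain c where c: "d_fn ((tau_fn ^^ Suc l) u) =
    (\<lambda>p. (tau_fn ^^ Suc l) (d_fn u) p + scal_fn c ((tau_fn ^^ l) u) p)" for u :: "('n, 'k) fn"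
    by blast
  have "d_fn ((tau_fn ^^ Suc (Suc l)) u) = (\<lambda>p. (tau_fn ^^ Suc (Suc l)) (d_fn u) p +
      scal_fn (c ^ q + x - qth_root q x) ((tau_fn ^^ Suc l) u) p)" for u :: "('n, 'k) fn"
  proof -
    have "d_fn ((tau_fn ^^ Suc (Suc l)) u) = d_fn (tau_fn ((tau_fn ^^ Suc l) u))"
      by simp
    also have "\<dots> = (\<lambda>p. tau_fn (d_fn ((tau_fn ^^ Suc l) u)) p +
        scal_fn (x - qth_root q x) ((tau_fn ^^ Suc l) u) p)"
      by (rule d_tau)
    also have "tau_fn (d_fn ((tau_fn ^^ Suc l) u)) =
        (\<lambda>p. (tau_fn ^^ Suc (Suc l)) (d_fn u) p + scal_fn (c ^ q) ((tau_fn ^^ Suc l) u) p)"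
      unfolding c additive_op_add[OF additive_tau_fn] tau_scal by simp
    finally show ?thesis
      by (simp add: scal_fn_apply algebra_simps)
  qed
  then show ?case
    by blast
qed

lemma Delta_tau_funpow:
  "\<exists>c. \<forall>u :: ('n, 'k) fn. Delta_fn j ((tau_fn ^^ l) u) =
    (\<lambda>p. (tau_fn ^^ l) (Delta_fn j u) p + scal_fn c ((tau_fn ^^ l) u) p)"
proof (induction l)
  case 0
  show ?case
    by (auto simp: scal_fn_def intro: exI[of _ 0])
next
  case (Suc l)
  then obtain c where c: "Delta_fn j ((tau_fn ^^ l) u) =
    (\<lambda>p. (tau_fn ^^ l) (Delta_fn j u) p + scal_fn c ((tau_fn ^^ l) u) p)" for u :: "('n, 'k) fn"
    by blast
  have "Delta_fn j ((tau_fn ^^ Suc l) u) = (\<lambda>p. (tau_fn ^^ Suc l) (Delta_fn j u) p +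
      scal_fn (c ^ q + x ^ q - x) ((tau_fn ^^ Suc l) u) p)" for u :: "('n, 'k) fn"
    by (simp add: Delta_tau c additive_op_add[OF additive_tau_fn] tau_scal)
       (simp add: scal_fn_apply algebra_simps)
  then show ?case
    by blast
qed

lemma Delta_d_funpow:
  "\<exists>c. \<forall>u :: ('n, 'k) fn. Delta_fn j ((d_fn ^^ l) u) =
    (\<lambda>p. (d_fn ^^ l) (Delta_fn j u) p + scal_fn c ((d_fn ^^ l) u) p)"
proof (induction l)
  case 0
  show ?case
    by (auto simp: scal_fn_def intro: exI[of _ 0])
next
  case (Suc l)
  then obtain c where c: "Delta_fn j ((d_fn ^^ l) u) =
    (\<lambda>p. (d_fn ^^ l) (Delta_fn j u) p + scal_fn c ((d_fn ^^ l) u) p)" for u :: "('n, 'k) fn"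
    by blast
  have "Delta_fn j ((d_fn ^^ Suc l) u) = (\<lambda>p. (d_fn ^^ Suc l) (Delta_fn j u) p +
      scal_fn (qth_root q c + qth_root q x - x) ((d_fn ^^ Suc l) u) p)" for u :: "('n, 'k) fn"
    by (simp add: Delta_d c additive_op_add[OF additive_d_fn] d_scal)
       (simp add: scal_fn_apply algebra_simps)
  then show ?case
    by blast
qed

text \<open>The \<open>Delta_fn j\<close> commute, so that the order of the list is immaterial.\<close>

definition Delta_list :: "'n list \<Rightarrow> ('n \<Rightarrow>\<^sub>0 nat) \<Rightarrow> ('n, 'k) fn_op" where
  "Delta_list js i = foldr (\<lambda>j T. (Delta_fn j ^^ lookup i j) \<circ> T) js id"

definition Delta_mon :: "('n::finite \<Rightarrow>\<^sub>0 nat) \<Rightarrow> ('n, 'k) fn_op" where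
  "Delta_mon = Delta_list (SOME js. set js = UNIV \<and> distinct js)"

definition mon :: "'n::finite expo \<Rightarrow> ('n, 'k) fn_op" where
  "mon e = (tau_fn ^^ fst e) \<circ> (d_fn ^^ fst (snd e)) \<circ> Delta_mon (snd (snd e))"

lemma Delta_list_simps [simp]:
  "Delta_list [] i = id"
  "Delta_list (j # js) i = (Delta_fn j ^^ lookup i j) \<circ> Delta_list js i"
  by (simp_all add: Delta_list_def)

lemma Delta_list_cong: "(\<And>j. j \<in> set js \<Longrightarrow> lookup i j = lookup i' j) \<Longrightarrow>
    Delta_list js i = Delta_list js i'"
  by (induction js) simp_all

lemma Delta_funpow_commute:
  "Delta_fn j ((Delta_fn k ^^ m) u) = (Delta_fn k ^^ m) (Delta_fn j u)"
  by (induction m) (simp_all add: Delta_commute[of j k])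

lemma Delta_list_single: "distinct js \<Longrightarrow> j \<in> set js \<Longrightarrow>
    Delta_fn j (Delta_list js i u) = Delta_list js (i + Poly_Mapping.single j 1) u"
proof (induction js)
  case (Cons k js)
  show ?case
  proof (cases "k = j")
    case True
    then have "Delta_list js (i + Poly_Mapping.single j 1) = Delta_list js i"
      using Cons.prems by (intro Delta_list_cong) (auto simp: lookup_add lookup_single when_def)
    with True show ?thesis
      by (simp add: lookup_add)
  next
    case False
    with Cons show ?thesis
      by (simp add: lookup_add lookup_single_not_eq Delta_funpow_commute)
  qed
qed simp

lemma Delta_list_zero: "Delta_list js 0 = id"
  by (induction js) simp_all

lemma additive_Delta_list: "additive_op (Delta_list js i)"
proof (induction js)
  case Nil
  show ?case
    by (simp add: additive_op_def)
next
  case (Cons j js)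
  then show ?case
    unfolding Delta_list_simps by (intro additive_op_comp additive_op_funpow additive_Delta_fn)
qed

lemma Delta_mon_list:
  obtains js :: "'n::finite list" where "set js = UNIV" "distinct js" "Delta_mon = Delta_list js"
proof -
  have "\<exists>js :: 'n list. set js = UNIV \<and> distinct js"
    using finite_distinct_list[of "UNIV :: 'n set"] by simp
  from someI_ex[OF this] show thesis
    using that unfolding Delta_mon_def by blast
qed

lemma Delta_Delta_mon: "Delta_fn j (Delta_mon i u) = Delta_mon (i + Poly_Mapping.single j 1) u"
proof -
  obtain js :: "'a list" where "set js = UNIV" "distinct js" "Delta_mon = Delta_list js"
    by (rule Delta_mon_list)
  then show ?thesis
    by (simp add: Delta_list_single)
qed

lemma Delta_mon_zero: "Delta_mon 0 = id"
  using Delta_mon_list Delta_list_zero by metis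

lemma mon_zero: "mon 0 = id"
  by (simp add: mon_def Delta_mon_zero)

lemma additive_mon: "additive_op (mon e)"
  using Delta_mon_list additive_Delta_list unfolding mon_def
  by (metis additive_op_comp additive_op_funpow additive_tau_fn additive_d_fn)

lemma tau_mon: "tau_fn (mon e u) = mon ((1, 0, 0) + e) u"
  by (cases e) (simp add: mon_def)

section \<open>Normal forms with coefficients and bounds on their degree\<close>

definition ev :: "('n::finite expo \<Rightarrow>\<^sub>0 'k) \<Rightarrow> ('n, 'k) fn_op" where
  "ev w u = (\<lambda>p. \<Sum>e\<in>keys w. lookup w e * mon e u p)"

lemma ev_superset:
  assumes "finite S" "keys w \<subseteq> S"
  shows "ev w u p = (\<Sum>e\<in>S. lookup w e * mon e u p)"
  unfolding ev_def using assms by (intro sum.mono_neutral_left) (auto simp: in_keys_iff)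

lemma ev_zero: "ev 0 u = (\<lambda>p. 0)"
  by (simp add: ev_def)

lemma ev_add: "ev (w + w') u p = ev w u p + ev w' u p"
proof -
  let ?S = "keys w \<union> keys w'"
  have "keys (w + w') \<subseteq> ?S"
    by (rule Poly_Mapping.keys_add)
  then show ?thesis
    by (simp add: ev_superset[of ?S] lookup_add sum.distrib algebra_simps)
qed

lemma ev_scale: "ev (scale a w) u = scal_fn a (ev w u)"
  using ev_superset[of "keys w" "scale a w" u] keys_scale_subset[of a w]
  by (simp add: fun_eq_iff scal_fn_apply ev_def sum_distrib_left mult.assoc)

lemma ev_single: "ev (Poly_Mapping.single e a) u = scal_fn a (mon e u)"
  by (simp add: ev_def scal_fn_def fun_eq_iff)

lemma ev_sum: "ev (sum f S) u p = (\<Sum>a\<in>S. ev (f a) u p)"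
  by (induction S rule: infinite_finite_induct) (simp_all add: ev_zero ev_add)

text \<open>The filtration step \<open>n - 1\<close>, read for operators on functions. With a strict
  bound error terms need no subtraction, and \<open>below 0\<close> leaves just the zero
  operator.\<close>

definition below :: "nat \<Rightarrow> ('n::finite, 'k) fn_op \<Rightarrow> bool" where
  "below n T \<longleftrightarrow> (\<exists>w. (\<forall>e\<in>keys w. expo_deg e < n) \<and> T = ev w)"

lemma below_mono: "below m T \<Longrightarrow> m \<le> n \<Longrightarrow> below n T"
  unfolding below_def by (blast intro: less_le_trans)

lemma below_zero: "below n (\<lambda>u p. 0)"
  unfolding below_def by (rule exI[of _ 0]) (simp add: fun_eq_iff ev_zero)

lemma below_add: "below n S \<Longrightarrow> below n T \<Longrightarrow> below n (\<lambda>u p. S u p + T u p)"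
  unfolding below_def
proof (elim exE conjE)
  fix w w'
  assume "\<forall>e\<in>keys w. expo_deg e < n" "S = ev w" "\<forall>e\<in>keys w'. expo_deg e < n" "T = ev w'"
  then show "\<exists>w. (\<forall>e\<in>keys w. expo_deg e < n) \<and> (\<lambda>u p. S u p + T u p) = ev w"
    using Poly_Mapping.keys_add[of w w']
    by (intro exI[of _ "w + w'"]) (auto simp: fun_eq_iff ev_add)
qed

lemma below_scal: "below n T \<Longrightarrow> below n (\<lambda>u. scal_fn a (T u))"
  unfolding below_def
proof (elim exE conjE)
  fix w
  assume "\<forall>e\<in>keys w. expo_deg e < n" "T = ev w"
  then show "\<exists>w. (\<forall>e\<in>keys w. expo_deg e < n) \<and> (\<lambda>u. scal_fn a (T u)) = ev w"
    using keys_scale_subset[of a w] by (intro exI[of _ "scale a w"]) (auto simp: ev_scale)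
qed

lemma below_sum: "finite S \<Longrightarrow> (\<And>a. a \<in> S \<Longrightarrow> below n (T a)) \<Longrightarrow> below n (\<lambda>u p. \<Sum>a\<in>S. T a u p)"
  by (induction S rule: finite_induct) (simp_all add: below_zero below_add)

lemma below_mon: "expo_deg e < n \<Longrightarrow> below n (mon e)"
  unfolding below_def
  by (rule exI[of _ "Poly_Mapping.single e 1"]) (auto simp: fun_eq_iff ev_single scal_fn_def)

lemma ev_comp_eq_sum:
  assumes "additive_op S"
  shows "S (ev w u) = (\<lambda>p. \<Sum>e\<in>keys w. S (scal_fn (lookup w e) (mon e u)) p)"
  unfolding ev_def using additive_op_sum[OF assms, of "\<lambda>e p. lookup w e * mon e u p"]
  by (simp add: scal_fn_def)

text \<open>Weakly, the bounds are \<open>n - 1\<close> for \<open>T\<close> and a rise by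
  \<open>m - 1\<close> for \<open>S\<close>, which add up to \<open>n + m - 2\<close>. The scalar
  \<open>a\<close> is part of \<open>*\<close> because \<open>S\<close> is merely additive.\<close>

lemma below_comp:
  assumes S: "additive_op S" and T: "below n T"
    and *: "\<And>a e. below (expo_deg e + m) (\<lambda>u. S (scal_fn a (mon e u)))"
  shows "below (n + m - 1) (\<lambda>u. S (T u))"
proof -
  obtain w where w: "\<forall>e\<in>keys w. expo_deg e < n" "T = ev w"
    using T by (auto simp: below_def)
  have "below (n + m - 1) (\<lambda>u. S (scal_fn (lookup w e) (mon e u)))" if "e \<in> keys w" for e
    using w(1) that by (intro below_mono[OF *]) fastforce
  then show ?thesis
    unfolding w(2) ev_comp_eq_sum[OF S] by (intro below_sum) auto
qed

text \<open>An error arises only if a power of \<open>tau_fn\<close> has to be crossed, and then it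
  has degree \<open>expo_deg e - 1\<close>. The weaker bound is the one that suits all generators
  alike.\<close>

lemma d_mon:
  fixes e :: "'n::finite expo"
  shows "\<exists>T. below (expo_deg e + 1) T \<and>
    (\<forall>u. d_fn (scal_fn a (mon e u)) =
      (\<lambda>p. scal_fn (qth_root q a) (mon ((0, 1, 0) + e) u) p + T u p))"
proof (cases e)
  case (fields l \<mu> i)
  show ?thesis
  proof (cases l)
    case 0
    then show ?thesis
      using fields by (intro exI[of _ "\<lambda>u p. 0"]) (simp add: below_zero d_scal mon_def)
  next
    case (Suc l')
    obtain c where c: "d_fn ((tau_fn ^^ Suc l') u) =
        (\<lambda>p. (tau_fn ^^ Suc l') (d_fn u) p + scal_fn c ((tau_fn ^^ l') u) p)" for u :: "('n, 'k) fn"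
      using d_tau_funpow by blast
    have "below (expo_deg e + 1) (\<lambda>u. scal_fn (qth_root q a * c) (mon (l', \<mu>, i) u))"
      by (intro below_scal below_mon) (simp add: fields Suc expo_deg_simp)
    moreover have "d_fn (scal_fn a (mon e u)) = (\<lambda>p. scal_fn (qth_root q a) (mon ((0, 1, 0) + e) u) p +
        scal_fn (qth_root q a * c) (mon (l', \<mu>, i) u) p)" for u
      using c[of "(d_fn ^^ \<mu>) (Delta_mon i u)"]
      by (simp add: fields Suc d_scal mon_def scal_fn_apply fun_eq_iff algebra_simps)
    ultimately show ?thesis
      by blast
  qed
qed

text \<open>Crossing the powers of \<open>tau_fn\<close> and \<open>d_fn\<close> reproduces the same
  monomial up to scalars, so the error is a multiple of \<open>mon e\<close> itself. The scalar
  \<open>c''\<close> is \<open>c'\<close> after being twisted by the power of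
  \<open>tau_fn\<close>.\<close>

lemma Delta_mon_mon:
  fixes e :: "'n::finite expo"
  shows "\<exists>T. below (expo_deg e + 1) T \<and>
    (\<forall>u. Delta_fn j (scal_fn a (mon e u)) =
      (\<lambda>p. scal_fn a (mon ((0, 0, Poly_Mapping.single j 1) + e) u) p + T u p))"
proof (cases e)
  case (fields l \<mu> i)
  obtain c where c: "Delta_fn j ((tau_fn ^^ l) u) =
      (\<lambda>p. (tau_fn ^^ l) (Delta_fn j u) p + scal_fn c ((tau_fn ^^ l) u) p)" for u :: "('n, 'k) fn"
    using Delta_tau_funpow[of j l] by blast
  obtain c' where c': "Delta_fn j ((d_fn ^^ \<mu>) u) =
      (\<lambda>p. (d_fn ^^ \<mu>) (Delta_fn j u) p + scal_fn c' ((d_fn ^^ \<mu>) u) p)" for u :: "('n, 'k) fn"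
    using Delta_d_funpow[of j \<mu>] by blast
  obtain c'' where c'': "(tau_fn ^^ l) (scal_fn c' u) = scal_fn c'' ((tau_fn ^^ l) u)"
    for u :: "('n, 'k) fn"
  proof -
    have "\<exists>c''. \<forall>u :: ('n, 'k) fn. (tau_fn ^^ l) (scal_fn c' u) = scal_fn c'' ((tau_fn ^^ l) u)"
      by (induction l) (auto simp: tau_scal)
    then show thesis
      using that by blast
  qed
  have "below (expo_deg e + 1) (\<lambda>u. scal_fn (a * (c + c'')) (mon e u))"
    by (intro below_scal below_mon) simp
  moreover have "Delta_fn j (scal_fn a (mon e u)) =
      (\<lambda>p. scal_fn a (mon ((0, 0, Poly_Mapping.single j 1) + e) u) p +
        scal_fn (a * (c + c'')) (mon e u) p)" for u
  proof -
    have "Delta_fn j (mon e u) =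
        (\<lambda>p. (tau_fn ^^ l) (Delta_fn j ((d_fn ^^ \<mu>) (Delta_mon i u))) p + scal_fn c (mon e u) p)"
      by (simp add: fields mon_def c)
    also have "(tau_fn ^^ l) (Delta_fn j ((d_fn ^^ \<mu>) (Delta_mon i u))) =
        (\<lambda>p. mon ((0, 0, Poly_Mapping.single j 1) + e) u p + scal_fn c'' (mon e u) p)"
      unfolding c' additive_op_add[OF additive_op_funpow[OF additive_tau_fn]] c''
      by (simp add: fields mon_def Delta_Delta_mon add.commute)
    finally show ?thesis
      by (simp add: Delta_scal scal_fn_apply fun_eq_iff algebra_simps)
  qed
  ultimately show ?thesis
    by blast
qed

text \<open>The power of the Frobenius automorphism, with exponent \<open>l - \<mu>\<close>, that a
  scalar acquires when it moves from the right of a monomial to its left.\<close>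

definition twist :: "'n expo \<Rightarrow> 'k \<Rightarrow> 'k" where
  "twist e b = ((\<lambda>a. a ^ q) ^^ fst e) ((qth_root q ^^ fst (snd e)) b)"

lemma twist_eq_0_iff [simp]: "twist e b = 0 \<longleftrightarrow> b = 0"
proof -
  have "((\<lambda>a. a ^ q) ^^ l) c = 0 \<longleftrightarrow> c = 0" for l and c :: 'k
    using q_gt_1 by (induction l) auto
  moreover have "(qth_root q ^^ l) c = 0 \<longleftrightarrow> c = 0" for l and c :: 'k
    by (induction l) auto
  ultimately show ?thesis
    by (simp add: twist_def)
qed

text \<open>Multiplicativity of leading terms for a fixed left factor \<open>e\<close>. All right
  factors are covered at once because the induction builds up the left one, and the scalar
  \<open>b\<close> is included so that additivity extends the rule to arbitrary right
  factors.\<close>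

definition leads :: "'n::finite expo \<Rightarrow> bool" where
  "leads e \<longleftrightarrow> (\<forall>b e'. \<exists>T. below (expo_deg e + expo_deg e') T \<and>
    (\<forall>u. mon e (scal_fn b (mon e' u)) = (\<lambda>p. scal_fn (twist e b) (mon (e + e') u) p + T u p)))"

text \<open>
  Left multiplication by a generator \<open>g\<close> with exponent \<open>\<gamma>\<close> and twist \<open>\<phi>\<close> moves a monomial up by
  \<open>\<gamma>\<close> modulo lower degree; the normal form of a product of monomials follows by multiplying with
  one generator after the other from the left.
\<close>

lemma leads_step:
  assumes e: "leads e" and g: "additive_op g"
    and mon: "\<And>u. mon (\<gamma> + e) u = g (mon e u)"
    and \<gamma>: "expo_deg \<gamma> = 1" and \<phi>: "\<And>b. twist (\<gamma> + e) b = \<phi> (twist e b)"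
    and *: "\<And>a e'. \<exists>T. below (expo_deg e' + 1) T \<and>
      (\<forall>u. g (scal_fn a (mon e' u)) = (\<lambda>p. scal_fn (\<phi> a) (mon (\<gamma> + e') u) p + T u p))"
  shows "leads (\<gamma> + e)"
  unfolding leads_def
proof (intro allI)
  fix b e'
  obtain T where T: "below (expo_deg e + expo_deg e') T"
    "\<And>u. mon e (scal_fn b (mon e' u)) = (\<lambda>p. scal_fn (twist e b) (mon (e + e') u) p + T u p)"
    using e unfolding leads_def by blast
  obtain T' where T': "below (expo_deg (e + e') + 1) T'"
    "\<And>u. g (scal_fn (twist e b) (mon (e + e') u)) =
      (\<lambda>p. scal_fn (\<phi> (twist e b)) (mon (\<gamma> + (e + e')) u) p + T' u p)"
    using * by blast
  \<comment> \<open>A crude form of \<open>*\<close> that absorbs the leading term as well. If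
    \<open>n\<close> is the bound for \<open>T\<close>, \<open>below_comp\<close> then bounds
    \<open>g (T u)\<close> by \<open>n + 2 - 1\<close>, just what the degree 1 of
    \<open>\<gamma>\<close> allows.\<close>
  have "below (expo_deg f + 2) (\<lambda>u. g (scal_fn a (mon f u)))" for a f
  proof -
    obtain T'' where T'': "below (expo_deg f + 1) T''"
      "\<And>u. g (scal_fn a (mon f u)) = (\<lambda>p. scal_fn (\<phi> a) (mon (\<gamma> + f) u) p + T'' u p)"
      using * by blast
    have "below (expo_deg f + 2) (\<lambda>u. scal_fn (\<phi> a) (mon (\<gamma> + f) u))"
      by (intro below_scal below_mon) (simp add: expo_deg_add \<gamma>)
    then show ?thesis
      unfolding T''(2) by (rule below_add) (rule below_mono[OF T''(1)], simp)
  qed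
  from below_comp[OF g T(1) this] have "below (expo_deg (\<gamma> + e) + expo_deg e') (\<lambda>u. g (T u))"
    by (simp add: expo_deg_add \<gamma>)
  moreover have "below (expo_deg (\<gamma> + e) + expo_deg e') T'"
    using T'(1) by (simp add: expo_deg_add \<gamma>)
  ultimately have "below (expo_deg (\<gamma> + e) + expo_deg e') (\<lambda>u p. T' u p + g (T u) p)"
    by (intro below_add)
  moreover have "mon (\<gamma> + e) (scal_fn b (mon e' u)) =
      (\<lambda>p. scal_fn (twist (\<gamma> + e) b) (mon (\<gamma> + e + e') u) p + (T' u p + g (T u) p))" for u
    unfolding mon T(2) additive_op_add[OF g] T'(2) \<phi> by (simp add: add.assoc)
  ultimately show "\<exists>T. below (expo_deg (\<gamma> + e) + expo_deg e') T \<and>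
      (\<forall>u. mon (\<gamma> + e) (scal_fn b (mon e' u)) =
        (\<lambda>p. scal_fn (twist (\<gamma> + e) b) (mon (\<gamma> + e + e') u) p + T u p))"
    by blast
qed

lemma leads_zero: "leads 0"
  unfolding leads_def
  by (auto simp: mon_zero twist_def below_zero intro!: exI[of _ "\<lambda>u p. 0"])

lemma leads_Delta: "leads (0, 0, i)"
proof (induction i rule: expo_induct)
  case zero
  then show ?case
    using leads_zero by (simp add: zero_prod_def)
next
  case (step i j)
  then have "leads ((0, 0, Poly_Mapping.single j 1) + (0, 0, i))"
  proof (rule leads_step[where g = "Delta_fn j" and \<phi> = "\<lambda>a. a"])
    show "mon ((0, 0, Poly_Mapping.single j 1) + (0, 0, i)) u = Delta_fn j (mon (0, 0, i) u)" for u
      by (simp add: mon_def Delta_Delta_mon add.commute)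
    show "expo_deg (0, 0, Poly_Mapping.single j 1) = 1"
      by (simp add: expo_deg_simp lookup_single when_def)
  qed (use Delta_mon_mon[of _ j] in \<open>simp_all add: additive_Delta_fn twist_def\<close>)
  then show ?case
    by (simp add: add.commute)
qed

text \<open>The left factor is assembled from the inside outwards: the \<open>Delta_fn j\<close>,
  then \<open>d_fn\<close>, then \<open>tau_fn\<close>. In this order prepending a generator gives a
  normal monomial at once, as the hypothesis \<open>mon\<close> of \<open>leads_step\<close>
  requires.\<close>

lemma leads: "leads e"
proof (cases e)
  case (fields l \<mu> i)
  have "leads (0, \<mu>, i)"
  proof (induction \<mu>)
    case (Suc \<mu>)
    then have "leads ((0, 1, 0) + (0, \<mu>, i))"
      by (rule leads_step[where g = d_fn and \<phi> = "qth_root q"])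
         (use d_mon in \<open>simp_all add: mon_def additive_d_fn twist_def expo_deg_simp\<close>)
    then show ?case
      by simp
  qed (rule leads_Delta)
  then have "leads (l, \<mu>, i)"
  proof (induction l)
    case (Suc l)
    then have "leads (l, \<mu>, i)"
      by simp
    then have "leads ((1, 0, 0) + (l, \<mu>, i))"
    proof (rule leads_step[where g = tau_fn and \<phi> = "\<lambda>a. a ^ q"])
      show "\<exists>T. below (expo_deg e' + 1) T \<and> (\<forall>u. tau_fn (scal_fn a (mon e' u)) =
          (\<lambda>p. scal_fn (a ^ q) (mon ((1, 0, 0) + e') u) p + T u p))" for a e'
        by (rule exI[of _ "\<lambda>u p. 0"]) (simp add: below_zero tau_scal tau_mon)
    qed (simp_all add: mon_def additive_tau_fn twist_def expo_deg_simp)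
    then show ?case
      by simp
  qed
  then show ?thesis
    by (simp add: fields)
qed

lemma below_mon_mon: "below (expo_deg e' + Suc (expo_deg e)) (\<lambda>u. mon e (scal_fn b (mon e' u)))"
proof -
  obtain T where T: "below (expo_deg e + expo_deg e') T"
    "\<And>u. mon e (scal_fn b (mon e' u)) = (\<lambda>p. scal_fn (twist e b) (mon (e + e') u) p + T u p)"
    using leads[of e] unfolding leads_def by blast
  have "below (expo_deg e' + Suc (expo_deg e)) (\<lambda>u. scal_fn (twist e b) (mon (e + e') u))"
    by (intro below_scal below_mon) (simp add: expo_deg_add)
  then show ?thesis
    unfolding T(2) by (rule below_add) (rule below_mono[OF T(1)], simp)
qed

text \<open>Multiplicativity of the filtration; \<open>Suc\<close> turns the strict bounds into the
  weak ones \<open>m\<close>, \<open>n\<close> and \<open>m + n\<close>.\<close>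

lemma below_ev_comp:
  assumes "below (Suc m) S" "below (Suc n) T"
  shows "below (Suc (m + n)) (\<lambda>u. S (T u))"
proof -
  obtain w where w: "\<forall>e\<in>keys w. expo_deg e < Suc m" "S = ev w"
    using assms(1) by (auto simp: below_def)
  have "below (Suc (m + n)) (\<lambda>u. scal_fn (lookup w e) (mon e (T u)))" if "e \<in> keys w" for e
  proof -
    have "below (Suc n + Suc (expo_deg e) - 1) (\<lambda>u. mon e (T u))"
      using below_comp[OF additive_mon assms(2) below_mon_mon] .
    moreover have "expo_deg e \<le> m"
      using w(1) that by auto
    ultimately show ?thesis
      by (intro below_scal) (auto elim: below_mono)
  qed
  then have "below (Suc (m + n)) (\<lambda>u p. \<Sum>e\<in>keys w. scal_fn (lookup w e) (mon e (T u)) p)"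
    by (intro below_sum) auto
  then show ?thesis
    by (simp add: w(2) ev_def scal_fn_apply)
qed

end

section \<open>Endomorphisms of the group of germs\<close>

lemma endo_ring_is_ring:
  fixes G (structure)
  assumes "comm_group G"
  shows "ring (endo_ring G)"
proof -
  interpret comm_group G by fact
  let ?E = "endo_ring G"
  have carrier: "f \<in> carrier ?E \<longleftrightarrow> f \<in> hom G G \<and> f \<in> extensional (carrier G)" for f
    by (simp add: endo_ring_def)
  have closed: "f g \<in> carrier G" if "f \<in> carrier ?E" "g \<in> carrier G" for f g
    using that by (auto simp: carrier hom_def)
  have hom: "f (g \<otimes> h) = f g \<otimes> f h"
    if "f \<in> carrier ?E" "g \<in> carrier G" "h \<in> carrier G" for f g h
    using that by (auto simp: carrier hom_def)
  have add: "(f \<oplus>\<^bsub>?E\<^esub> h) g = f g \<otimes> h g" if "g \<in> carrier G" for f h g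
    using that by (simp add: endo_ring_def)
  have mult: "(f \<otimes>\<^bsub>?E\<^esub> h) g = f (h g)" if "g \<in> carrier G" for f h g
    using that by (simp add: endo_ring_def compose_def)
  have one: "\<one>\<^bsub>?E\<^esub> g = g" if "g \<in> carrier G" for g
    using that by (simp add: endo_ring_def)
  have zero: "\<zero>\<^bsub>?E\<^esub> g = \<one>" if "g \<in> carrier G" for g
    using that by (simp add: endo_ring_def)
  have add_closed: "f \<oplus>\<^bsub>?E\<^esub> h \<in> carrier ?E" if "f \<in> carrier ?E" "h \<in> carrier ?E" for f h
  proof -
    have "f \<oplus>\<^bsub>?E\<^esub> h \<in> hom G G"
      using that by (auto intro!: homI simp: add closed hom m_ac)
    then show ?thesis
      by (simp add: carrier) (simp add: endo_ring_def)
  qed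
  have mult_closed: "f \<otimes>\<^bsub>?E\<^esub> h \<in> carrier ?E" if "f \<in> carrier ?E" "h \<in> carrier ?E" for f h
  proof -
    have "f \<otimes>\<^bsub>?E\<^esub> h \<in> hom G G"
      using that by (auto intro!: homI simp: mult closed hom)
    then show ?thesis
      by (simp add: carrier) (simp add: endo_ring_def)
  qed
  have one_closed: "\<one>\<^bsub>?E\<^esub> \<in> carrier ?E"
    by (auto simp: endo_ring_def hom_def)
  have zero_closed: "\<zero>\<^bsub>?E\<^esub> \<in> carrier ?E"
    by (auto simp: endo_ring_def hom_def)
  have eqI: "f = h" if "f \<in> carrier ?E" "h \<in> carrier ?E" "\<And>g. g \<in> carrier G \<Longrightarrow> f g = h g" for f h
    using that by (auto simp: carrier intro: extensionalityI)
  show ?thesis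
  proof (rule ringI)
    show "abelian_group ?E"
    proof (rule abelian_groupI)
      fix f
      assume f: "f \<in> carrier ?E"
      define h where "h = (\<lambda>g\<in>carrier G. inv (f g))"
      have "h \<in> hom G G"
        using f by (auto intro!: homI simp: h_def closed hom inv_mult)
      then have h: "h \<in> carrier ?E"
        by (simp add: carrier h_def)
      moreover have "h \<oplus>\<^bsub>?E\<^esub> f = \<zero>\<^bsub>?E\<^esub>"
        using f h by (intro eqI add_closed zero_closed) (auto simp: add zero closed h_def)
      ultimately show "\<exists>h\<in>carrier ?E. h \<oplus>\<^bsub>?E\<^esub> f = \<zero>\<^bsub>?E\<^esub>"
        by blast
    qed (auto intro!: eqI add_closed zero_closed simp: add zero closed m_ac)
    show "monoid ?E"
      by (rule monoidI) (auto intro!: eqI mult_closed one_closed simp: mult one closed)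
  qed (auto intro!: eqI add_closed mult_closed simp: add mult closed hom)
qed

section \<open>Germs at the origin\<close>

definition near_zero :: "(('n \<Rightarrow> 'k::{zero,topological_space}) \<times> 'k) filter" where
  "near_zero = nhds (\<lambda>_. 0, 0)"

lemma germ_def': "germ u = {w. \<forall>\<^sub>F p in near_zero. w p = u p}"
  by (simp add: germ_def near_zero_def)

lemma germ_self: "u \<in> germ u"
  by (simp add: germ_def')

lemma germ_nonempty: "germ u \<noteq> {}"
  using germ_self[of u] by blast

lemma germ_eq_iff: "germ u = germ v \<longleftrightarrow> (\<forall>\<^sub>F p in near_zero. u p = v p)"
proof
  assume "germ u = germ v"
  then have "u \<in> germ v"
    using germ_self[of u] by simp
  then show "\<forall>\<^sub>F p in near_zero. u p = v p"
    by (simp add: germ_def')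
next
  assume *: "\<forall>\<^sub>F p in near_zero. u p = v p"
  have "(\<forall>\<^sub>F p in near_zero. w p = u p) \<longleftrightarrow> (\<forall>\<^sub>F p in near_zero. w p = v p)" for w
    using eventually_cong[OF *, of "\<lambda>p. w p = u p" "\<lambda>p. w p = v p"] by auto
  then show "germ u = germ v"
    by (simp add: germ_def')
qed

context carlitz_field
begin

definition series_index :: "(nat \<times> ('n \<Rightarrow> nat)) set" where
  "series_index = {(m, i). \<forall>j. m \<le> i j}"

definition series_term ::
    "(nat \<Rightarrow> ('n::finite \<Rightarrow> nat) \<Rightarrow> 'k) \<Rightarrow> ('n \<Rightarrow> 'k) \<times> 'k \<Rightarrow> nat \<times> ('n \<Rightarrow> nat) \<Rightarrow> 'k" where
  "series_term c p mi = c (fst mi) (snd mi) * (\<Prod>j\<in>UNIV. fst p j ^ (q ^ snd mi j)) *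
    snd p ^ (q ^ fst mi) / carlitz_D q x (fst mi)"

definition has_series :: "('n::finite, 'k) fn \<Rightarrow> (nat \<Rightarrow> ('n \<Rightarrow> nat) \<Rightarrow> 'k) \<Rightarrow> bool" where
  "has_series u c \<longleftrightarrow> (\<forall>\<^sub>F p in near_zero. (series_term c p has_sum u p) series_index)"

definition is_series :: "('n::finite, 'k) fn \<Rightarrow> bool" where
  "is_series u \<longleftrightarrow> (\<exists>c. has_series u c)"

lemma carlitz_germs_eq: "carlitz_germs q x = {germ u | u :: ('n::finite, 'k) fn. is_series u}"
proof -
  have "(\<lambda>(m, i). c m i * (\<Prod>j\<in>UNIV. s j ^ q ^ i j) * z ^ q ^ m / carlitz_D q x m) =
      series_term c (s, z)" for c :: "nat \<Rightarrow> ('n \<Rightarrow> nat) \<Rightarrow> 'k" and s z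
    by (auto simp: series_term_def fun_eq_iff)
  then show ?thesis
    by (simp add: carlitz_germs_def is_series_def has_series_def series_index_def near_zero_def
        case_prod_unfold)
qed

lemma continuous_scal: "continuous_on UNIV (\<lambda>b :: 'k. a * b)"
  unfolding continuous_on_iff
proof (intro ballI allI impI)
  fix b :: 'k and e :: real
  assume "e > 0"
  then have "dist (a * b') (a * b) < e" if "dist b' b < e / (dist a 0 + 1)" for b'
  proof -
    have "dist (a * b') (a * b) \<le> (dist a 0 + 1) * dist b' b"
      by (simp add: dist_mult_left mult_right_mono)
    also have "\<dots> < e"
      using that \<open>e > 0\<close> by (simp add: add_nonneg_pos less_divide_eq mult.commute)
    finally show ?thesis .
  qed
  then show "\<exists>d>0. \<forall>b'\<in>UNIV. dist b' b < d \<longrightarrow> dist (a * b') (a * b) < e"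
    using \<open>e > 0\<close> by (intro exI[of _ "e / (dist a 0 + 1)"]) (auto intro!: divide_pos_pos add_nonneg_pos)
qed

lemma continuous_frob: "continuous_on UNIV (\<lambda>b :: 'k. b ^ q)"
  unfolding continuous_on tendsto_dist_iff[of "\<lambda>b. b ^ q"] dist_frob
  using q_gt_1 by (auto intro!: tendsto_eq_intros)

lemma continuous_root: "continuous_on UNIV (qth_root q :: 'k \<Rightarrow> 'k)"
  unfolding continuous_on_iff
proof (intro ballI allI impI)
  fix b :: 'k and e :: real
  assume e: "e > 0"
  have "dist (qth_root q b') (qth_root q b) < e" if "dist b' b < e ^ q" for b'
  proof (rule power_less_imp_less_base)
    show "dist (qth_root q b') (qth_root q b) ^ q < e ^ q"
      using that dist_frob[of "qth_root q b'" "qth_root q b"] by simp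
  qed (use e in simp)
  then show "\<exists>d>0. \<forall>b'\<in>UNIV. dist b' b < d \<longrightarrow> dist (qth_root q b') (qth_root q b) < e"
    using e by (intro exI[of _ "e ^ q"]) auto
qed

text \<open>Continuous additive maps preserve unordered sums; this is why the Frobenius, its inverse
  and multiplication by scalars were shown to be continuous.\<close>

lemma has_sum_frob: "(f has_sum S) A \<Longrightarrow> ((\<lambda>a. f a ^ q) has_sum (S :: 'k) ^ q) A"
  by (erule has_sum_homomorphism[where h = "\<lambda>b. b ^ q"])
     (simp_all add: frob_zero frob_add continuous_frob)

lemma has_sum_root: "(f has_sum S) A \<Longrightarrow> ((\<lambda>a. qth_root q (f a)) has_sum qth_root q (S :: 'k)) A"
  by (erule has_sum_homomorphism) (simp_all add: root_add continuous_root)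

lemma has_sum_scal: "(f has_sum S) A \<Longrightarrow> ((\<lambda>a. b * f a) has_sum b * (S :: 'k)) A"
  by (erule has_sum_homomorphism[where h = "\<lambda>c. b * c"])
     (simp_all add: distrib_left continuous_scal)

lemma has_sum_diff_scal:
  assumes "(f has_sum S) A" "(g has_sum T) A"
  shows "((\<lambda>a. f a - b * g a) has_sum S - b * (T :: 'k)) A"
  using has_sum_add[OF assms(1) has_sum_scal[OF assms(2), of "- b"]] by simp

text \<open>Rescaling a variable is continuous and fixes the origin, so whatever holds near the
  origin may also be used at the rescaled point.\<close>

lemma continuous_on_filterlim_near_zero:
  fixes f :: "('n \<Rightarrow> 'k) \<times> 'k \<Rightarrow> ('n \<Rightarrow> 'k) \<times> 'k"
  assumes "continuous_on UNIV f" "f (\<lambda>_. 0, 0) = (\<lambda>_. 0, 0)"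
  shows "filterlim f near_zero near_zero"
proof -
  have "(f \<longlongrightarrow> f (\<lambda>_. 0, 0)) (at (\<lambda>_. 0, 0))"
    using assms(1) unfolding continuous_on_def by blast
  then have "(f \<longlongrightarrow> f (\<lambda>_. 0, 0)) (nhds (\<lambda>_. 0, 0))"
    by (simp only: tendsto_at_iff_tendsto_nhds)
  then show ?thesis
    unfolding assms(2) near_zero_def .
qed

lemma filterlim_scale_z:
  "filterlim (\<lambda>p. (fst p, x * snd p)) near_zero (near_zero :: (('n \<Rightarrow> 'k) \<times> 'k) filter)"
  by (intro continuous_on_filterlim_near_zero continuous_intros
      continuous_on_compose2[OF continuous_scal]) auto

lemma filterlim_scale_s:
  "filterlim (\<lambda>p. ((fst p)(j := x * fst p j), snd p)) near_zero (near_zero :: (('n \<Rightarrow> 'k) \<times> 'k) filter)"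
proof (rule continuous_on_filterlim_near_zero)
  have coord: "continuous_on UNIV (\<lambda>p :: ('n \<Rightarrow> 'k) \<times> 'k. fst p i)" for i
    by (rule continuous_on_product_then_coordinatewise) (rule continuous_on_fst, rule continuous_on_id)
  have "continuous_on UNIV (\<lambda>p :: ('n \<Rightarrow> 'k) \<times> 'k. ((fst p)(j := x * fst p j)) i)" for i
    using coord continuous_on_compose2[OF continuous_scal coord] by (cases "i = j") auto
  then show "continuous_on UNIV (\<lambda>p :: ('n \<Rightarrow> 'k) \<times> 'k. ((fst p)(j := x * fst p j), snd p))"
    by (intro continuous_on_Pair continuous_on_coordinatewise_then_product continuous_on_snd
        continuous_on_id)
qed auto

section \<open>Series expansions under the Carlitz operators\<close>

lemma has_series_add:
  assumes "has_series u c" "has_series v c'"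
  shows "has_series (\<lambda>p. u p + v p) (\<lambda>m i. c m i + c' m i)"
  using assms unfolding has_series_def
proof eventually_elim
  case (elim p)
  from has_sum_add[OF elim] show ?case
    by (rule iffD1[OF has_sum_cong, rotated]) (simp add: series_term_def algebra_simps add_divide_distrib)
qed

lemma has_series_scal:
  assumes "has_series u c"
  shows "has_series (scal_fn a u) (\<lambda>m i. a * c m i)"
  using assms unfolding has_series_def
proof eventually_elim
  case (elim p)
  from has_sum_scal[OF elim, of a] show ?case
    unfolding scal_fn_apply
    by (rule iffD1[OF has_sum_cong, rotated]) (simp add: series_term_def)
qed

text \<open>Each term of a series is an eigenfunction of \<open>Delta_fn j\<close>, with the bracket
  of its index in \<open>s j\<close> as eigenvalue. The difference in \<open>z\<close> acts in the
  same way through the index \<open>m\<close>.\<close>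

lemma series_term_scale_s:
  "series_term c ((fst p)(j := x * fst p j), snd p) a - x * series_term c p a =
    carlitz_bracket q x (snd a j) * series_term c p a"
proof -
  have "(\<Prod>k\<in>UNIV. ((fst p)(j := x * fst p j)) k ^ q ^ i k) =
      x ^ q ^ i j * (\<Prod>k\<in>UNIV. fst p k ^ q ^ i k)" for i
    by (simp add: prod.remove[of UNIV j] power_mult_distrib)
  then show ?thesis
    by (simp add: series_term_def carlitz_bracket_def algebra_simps diff_divide_distrib)
qed

lemma series_term_scale_z:
  "series_term c (fst p, x * snd p) a - x * series_term c p a =
    carlitz_bracket q x (fst a) * series_term c p a"
  by (simp add: series_term_def carlitz_bracket_def algebra_simps diff_divide_distrib
      power_mult_distrib)

lemma has_series_Delta:
  assumes "has_series u c"
  shows "has_series (Delta_fn j u) (\<lambda>m i. carlitz_bracket q x (i j) * c m i)"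
proof -
  have "\<forall>\<^sub>F p in near_zero. (series_term c ((fst p)(j := x * fst p j), snd p) has_sum
      u ((fst p)(j := x * fst p j), snd p)) series_index"
    using eventually_compose_filterlim[OF _ filterlim_scale_s] assms unfolding has_series_def .
  with assms show ?thesis
    unfolding has_series_def
  proof eventually_elim
    case (elim p)
    have "carlitz_bracket q x (snd a j) * series_term c p a =
        series_term (\<lambda>m i. carlitz_bracket q x (i j) * c m i) p a" for a
      by (simp add: series_term_def)
    then show ?case
      using has_sum_diff_scal[OF elim(2,1), of x]
      by (simp add: series_term_scale_s Delta_fn_def case_prod_unfold)
  qed
qed

text \<open>A \<open>q\<close>-th power acts on all variables together, so \<open>tau_fn\<close>
  raises all indices of a term by one and \<open>d_fn\<close> lowers them by one.\<close>

definition shift_index :: "nat \<times> ('n \<Rightarrow> nat) \<Rightarrow> nat \<times> ('n \<Rightarrow> nat)" where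
  "shift_index mi = (Suc (fst mi), \<lambda>j. Suc (snd mi j))"

lemma inj_shift_index: "inj_on shift_index A"
  by (auto simp: inj_on_def shift_index_def fun_eq_iff)

lemma shift_index_image: "shift_index ` series_index = {mi \<in> series_index. fst mi > 0}"
proof (intro equalityI subsetI)
  fix mi :: "nat \<times> ('a \<Rightarrow> nat)"
  assume "mi \<in> {mi \<in> series_index. fst mi > 0}"
  then have mi: "fst mi > 0" "\<And>j. fst mi \<le> snd mi j"
    by (auto simp: series_index_def)
  then have "snd mi j > 0" for j
    by (meson less_le_trans)
  with mi show "mi \<in> shift_index ` series_index"
    by (intro image_eqI[of _ _ "(fst mi - 1, \<lambda>j. snd mi j - 1)"])
       (auto simp: shift_index_def series_index_def prod_eq_iff diff_le_mono)
qed (auto simp: shift_index_def series_index_def)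

text \<open>By \<open>carlitz_D_Suc\<close> the bracket cancels against the denominator, and what
  remains is the \<open>q\<close>-th power of a term with lowered indices.\<close>

lemma series_term_root:
  "qth_root q (carlitz_bracket q x (Suc (fst a)) * series_term c p (shift_index a)) =
    series_term (\<lambda>m i. qth_root q (c (Suc m) (\<lambda>j. Suc (i j)))) p a"
  using carlitz_bracket_nonzero[of "Suc (fst a)"]
  by (intro root_eqI) (simp add: series_term_def shift_index_def power_mult_distrib power_divide
      carlitz_D_Suc prod_power_distrib mult.commute flip: power_mult)

text \<open>The bracket compensates for the passage from \<open>D_(m-1)^q\<close> to
  \<open>D_m\<close>. The truncated subtraction \<open>i j - 1\<close> is harmless, since on
  \<open>series_index\<close> a positive \<open>m\<close> forces \<open>i j > 0\<close>.\<close>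

lemma has_series_tau:
  assumes "has_series u c"
  shows "has_series (tau_fn u) (\<lambda>m i. if m = 0 then 0
    else carlitz_bracket q x m * c (m - 1) (\<lambda>j. i j - 1) ^ q)" (is "has_series _ ?c")
  using assms unfolding has_series_def
proof eventually_elim
  case (elim p)
  have "series_term c p a ^ q = series_term ?c p (shift_index a)" for a
    using carlitz_bracket_nonzero[of "Suc (fst a)"]
    by (simp add: series_term_def shift_index_def power_mult_distrib power_divide carlitz_D_Suc
        prod_power_distrib mult.commute flip: power_mult)
  then have "((series_term ?c p \<circ> shift_index) has_sum tau_fn u p) series_index"
    using has_sum_frob[OF elim] by (simp add: tau_fn_def o_def)
  then have "(series_term ?c p has_sum tau_fn u p) (shift_index ` series_index)"
    by (simp add: has_sum_reindex[OF inj_shift_index])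
  then show ?case
    by (rule iffD1[OF has_sum_cong_neutral, rotated -1])
       (auto simp: shift_index_image series_term_def)
qed

lemma has_series_d:
  assumes "has_series u c"
  shows "has_series (d_fn u) (\<lambda>m i. qth_root q (c (Suc m) (\<lambda>j. Suc (i j))))"
    (is "has_series _ ?c")
proof -
  have "\<forall>\<^sub>F p in near_zero. (series_term c (fst p, x * snd p) has_sum
      u (fst p, x * snd p)) series_index"
    using eventually_compose_filterlim[OF _ filterlim_scale_z] assms unfolding has_series_def .
  with assms show ?thesis
    unfolding has_series_def
  proof eventually_elim
    case (elim p)
    let ?f = "\<lambda>a. qth_root q (series_term c (fst p, x * snd p) a - x * series_term c p a)"
    have "(?f has_sum d_fn u p) series_index"
      using has_sum_root[OF has_sum_diff_scal[OF elim(2,1), of x]]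
      by (simp add: d_fn_def case_prod_unfold)
    \<comment> \<open>The terms of index \<open>m = 0\<close> vanish because \<open>[0] = 0\<close>,
      and the remaining indices are exactly the shifted ones.\<close>
    then have "(?f has_sum d_fn u p) (shift_index ` series_index)"
      by (rule iffD1[OF has_sum_cong_neutral, rotated -1])
         (auto simp: shift_index_image series_term_scale_z)
    then have "((?f \<circ> shift_index) has_sum d_fn u p) series_index"
      by (simp add: has_sum_reindex[OF inj_shift_index])
    moreover have "?f (shift_index a) = series_term ?c p a" for a
      using series_term_root[of a c p] by (simp add: series_term_scale_z shift_index_def)
    ultimately show ?case
      by (simp add: o_def)
  qed
qed

lemma is_series_zero: "is_series (\<lambda>p. 0)"
  unfolding is_series_def has_series_def
  by (rule exI[of _ "\<lambda>m i. 0"]) (simp add: series_term_def[abs_def])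

text \<open>Exactly what makes \<open>germ_lift\<close> independent of representatives and an
  endomorphism of the group of germs. The conditions are stable under sums and composition, so
  identities between operators on functions carry over.\<close>

definition germ_op :: "('n::finite, 'k) fn_op \<Rightarrow> bool" where
  "germ_op T \<longleftrightarrow> additive_op T \<and> (\<forall>u. is_series u \<longrightarrow> is_series (T u)) \<and>
    (\<forall>u v. (\<forall>\<^sub>F p in near_zero. u p = v p) \<longrightarrow> (\<forall>\<^sub>F p in near_zero. T u p = T v p))"

lemma germ_op_tau: "germ_op tau_fn"
  unfolding germ_op_def
  by (auto simp: additive_tau_fn tau_fn_def is_series_def intro: has_series_tau[unfolded tau_fn_def]
      elim: eventually_mono)

lemma germ_op_scal: "germ_op (scal_fn a)"
  unfolding germ_op_def
  by (auto simp: additive_scal_fn is_series_def scal_fn_apply intro: has_series_scal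
      elim: eventually_mono)

lemma germ_op_Delta: "germ_op (Delta_fn j)"
  unfolding germ_op_def
proof (intro conjI allI impI)
  fix u v :: "('a, 'k) fn"
  assume *: "\<forall>\<^sub>F p in near_zero. u p = v p"
  from eventually_compose_filterlim[OF this filterlim_scale_s[of j]] *
  show "\<forall>\<^sub>F p in near_zero. Delta_fn j u p = Delta_fn j v p"
    by eventually_elim (simp add: Delta_fn_def case_prod_unfold)
qed (auto simp: additive_Delta_fn is_series_def intro: has_series_Delta)

lemma germ_op_d: "germ_op d_fn"
  unfolding germ_op_def
proof (intro conjI allI impI)
  fix u v :: "('a, 'k) fn"
  assume *: "\<forall>\<^sub>F p in near_zero. u p = v p"
  from eventually_compose_filterlim[OF this filterlim_scale_z] *
  show "\<forall>\<^sub>F p in near_zero. d_fn u p = d_fn v p"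
    by eventually_elim (simp add: d_fn_def case_prod_unfold)
qed (auto simp: additive_d_fn is_series_def intro: has_series_d)

lemma germ_op_comp: "germ_op S \<Longrightarrow> germ_op T \<Longrightarrow> germ_op (\<lambda>u. S (T u))"
  unfolding germ_op_def using additive_op_comp[of S T] by (auto simp: o_def)

lemma germ_op_zero: "germ_op (\<lambda>u p. 0)"
  by (simp add: germ_op_def additive_op_def is_series_zero)

lemma germ_op_id: "germ_op (\<lambda>u. u)"
  by (simp add: germ_op_def additive_op_def)

lemma is_series_add: "is_series u \<Longrightarrow> is_series v \<Longrightarrow> is_series (\<lambda>p. u p + v p)"
  unfolding is_series_def using has_series_add by blast

lemma germ_op_add: "germ_op S \<Longrightarrow> germ_op T \<Longrightarrow> germ_op (\<lambda>u p. S u p + T u p)"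
  unfolding germ_op_def
proof (elim conjE, intro conjI allI impI)
  fix u v :: "('a, 'k) fn"
  assume "\<forall>\<^sub>F p in near_zero. u p = v p"
    and "\<forall>u v. (\<forall>\<^sub>F p in near_zero. u p = v p) \<longrightarrow> (\<forall>\<^sub>F p in near_zero. S u p = S v p)"
    and "\<forall>u v. (\<forall>\<^sub>F p in near_zero. u p = v p) \<longrightarrow> (\<forall>\<^sub>F p in near_zero. T u p = T v p)"
  then have "\<forall>\<^sub>F p in near_zero. S u p = S v p" "\<forall>\<^sub>F p in near_zero. T u p = T v p"
    by blast+
  then show "\<forall>\<^sub>F p in near_zero. S u p + T u p = S v p + T v p"
    by eventually_elim simp
qed (simp_all add: additive_op_def is_series_add algebra_simps)

lemma germ_op_sum: "finite A \<Longrightarrow> (\<And>a. a \<in> A \<Longrightarrow> germ_op (T a)) \<Longrightarrow> germ_op (\<lambda>u p. \<Sum>a\<in>A. T a u p)"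
  by (induction A rule: finite_induct) (simp_all add: germ_op_zero germ_op_add)

lemma germ_op_funpow: "germ_op T \<Longrightarrow> germ_op (T ^^ n)"
  by (induction n) (auto simp: o_def id_def germ_op_id intro: germ_op_comp)

lemma germ_op_Delta_list: "germ_op (Delta_list js i)"
proof (induction js)
  case Nil
  show ?case
    using germ_op_id by (simp add: id_def)
next
  case (Cons j js)
  from germ_op_comp[OF germ_op_funpow[OF germ_op_Delta] this] show ?case
    by (simp add: o_def)
qed

lemma germ_op_mon: "germ_op (mon e)"
proof -
  have "germ_op (Delta_mon (snd (snd e)))"
    using Delta_mon_list germ_op_Delta_list by metis
  from germ_op_comp[OF germ_op_funpow[OF germ_op_tau] germ_op_comp[OF germ_op_funpow[OF germ_op_d] this]]
  show ?thesis
    unfolding mon_def o_def .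
qed

lemma germ_op_ev: "germ_op (ev w)"
proof -
  have "germ_op (\<lambda>u p. \<Sum>e\<in>keys w. scal_fn (lookup w e) (mon e u) p)"
    by (rule germ_op_sum) (simp, rule germ_op_comp[OF germ_op_scal germ_op_mon])
  then show ?thesis
    by (simp add: ev_def[abs_def] scal_fn_apply)
qed

section \<open>Lifting operators from functions to germs\<close>

lemma germ_group_mult: "germ u \<otimes>\<^bsub>germ_group q x\<^esub> germ v = germ (\<lambda>p. u p + v p)"
proof -
  have *: "germ (\<lambda>p. u' p + v' p) = germ (\<lambda>p. u p + v p)" if "u' \<in> germ u" "v' \<in> germ v" for u' v'
    using that unfolding germ_eq_iff by (auto simp: germ_def' elim: eventually_elim2)
  have "(\<Union>u'\<in>germ u. \<Union>v'\<in>germ v. germ (\<lambda>p. u' p + v' p)) =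
      (\<Union>u'\<in>germ u. \<Union>v'\<in>germ v. germ (\<lambda>p. u p + v p))"
    by (intro SUP_cong refl *)
  also have "\<dots> = germ (\<lambda>p. u p + v p)"
    using germ_nonempty[of u] germ_nonempty[of v] by simp
  finally show ?thesis
    by (simp add: germ_group_def)
qed

lemma germ_group_carrier: "carrier (germ_group q x) = {germ u | u :: ('n::finite, 'k) fn. is_series u}"
  by (simp add: germ_group_def carlitz_germs_eq)

lemma germ_group_one: "\<one>\<^bsub>germ_group q x\<^esub> = germ (\<lambda>_. 0)"
  by (simp add: germ_group_def)

lemma comm_group_germ_group: "comm_group (germ_group q x :: ('n::finite, 'k) fn set monoid)"
proof (rule comm_groupI)
  fix G :: "('n, 'k) fn set"
  assume "G \<in> carrier (germ_group q x)"
  then obtain u where u: "G = germ u" "is_series u"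
    by (auto simp: germ_group_carrier)
  have "germ (scal_fn (- 1) u) \<otimes>\<^bsub>germ_group q x\<^esub> G = \<one>\<^bsub>germ_group q x\<^esub>"
    by (simp add: u germ_group_mult germ_group_one scal_fn_apply)
  moreover have "germ (scal_fn (- 1) u) \<in> carrier (germ_group q x)"
    using u germ_op_scal[of "- 1"] by (auto simp: germ_group_carrier germ_op_def)
  ultimately show "\<exists>H\<in>carrier (germ_group q x). H \<otimes>\<^bsub>germ_group q x\<^esub> G = \<one>\<^bsub>germ_group q x\<^esub>"
    by blast
next
  fix G H :: "('n, 'k) fn set"
  assume "G \<in> carrier (germ_group q x)" "H \<in> carrier (germ_group q x)"
  then obtain u v where u: "G = germ u" "is_series u" "H = germ v" "is_series v"
    by (auto simp: germ_group_carrier)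
  then have "is_series (\<lambda>p. u p + v p)"
    by (intro is_series_add)
  then show "G \<otimes>\<^bsub>germ_group q x\<^esub> H \<in> carrier (germ_group q x)"
    unfolding u(1,3) germ_group_mult germ_group_carrier by blast
  show "G \<otimes>\<^bsub>germ_group q x\<^esub> H = H \<otimes>\<^bsub>germ_group q x\<^esub> G"
    unfolding u(1,3) germ_group_mult by (simp add: add.commute)
next
  show "\<one>\<^bsub>germ_group q x\<^esub> \<in> carrier (germ_group q x :: ('n, 'k) fn set monoid)"
    unfolding germ_group_one germ_group_carrier using is_series_zero by blast
qed (auto simp: germ_group_carrier germ_group_mult germ_group_one add.assoc)

abbreviation endo :: "('n::finite, 'k) germ_op ring" where
  "endo \<equiv> endo_ring (germ_group q x)"

lemma ring_endo: "ring endo"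
  using endo_ring_is_ring[OF comm_group_germ_group] .

lemma germ_lift_apply:
  assumes "germ_op T" "is_series u"
  shows "germ_lift q x T (germ u) = germ (T u)"
proof -
  have "germ (T v) = germ (T u)" if "v \<in> germ u" for v
    using that assms(1) unfolding germ_eq_iff by (auto simp: germ_op_def germ_def')
  then have "(\<Union>v\<in>germ u. germ (T v)) = (\<Union>v\<in>germ u. germ (T u))"
    by (intro SUP_cong refl)
  then have "(\<Union>v\<in>germ u. germ (T v)) = germ (T u)"
    using germ_nonempty[of u] by simp
  then show ?thesis
    using assms(2) by (auto simp: germ_lift_def carlitz_germs_eq)
qed

lemma germ_lift_extensional: "germ_lift q x T \<in> extensional (carrier (germ_group q x))"
  by (simp add: germ_lift_def germ_group_def)

lemma germ_lift_closed:
  fixes T :: "('n::finite, 'k) fn_op"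
  assumes T: "germ_op T"
  shows "germ_lift q x T \<in> carrier endo"
proof -
  have "germ_lift q x T \<in> hom (germ_group q x) (germ_group q x)"
  proof (rule homI)
    fix G H :: "('n, 'k) fn set"
    assume "G \<in> carrier (germ_group q x)" "H \<in> carrier (germ_group q x)"
    then obtain u v where u: "G = germ u" "is_series u" "H = germ v" "is_series v"
      by (auto simp: germ_group_carrier)
    then show "germ_lift q x T (G \<otimes>\<^bsub>germ_group q x\<^esub> H) =
        germ_lift q x T G \<otimes>\<^bsub>germ_group q x\<^esub> germ_lift q x T H"
      using T by (simp add: germ_group_mult germ_lift_apply is_series_add germ_op_def
          additive_op_add[of T])
  qed (use T in \<open>auto simp: germ_group_carrier germ_lift_apply germ_op_def\<close>)
  then show ?thesis
    using germ_lift_extensional by (simp add: endo_ring_def)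
qed

lemma germ_op_extensionalityI:
  assumes "f \<in> extensional (carrier (germ_group q x))" "g \<in> extensional (carrier (germ_group q x))"
    and "\<And>u :: ('n::finite, 'k) fn. is_series u \<Longrightarrow> f (germ u) = g (germ u)"
  shows "f = g"
  using assms by (intro extensionalityI[of f "carrier (germ_group q x)"]) (auto simp: germ_group_carrier)

lemma germ_lift_eq_iff:
  assumes "germ_op S" "germ_op T"
  shows "germ_lift q x S = germ_lift q x T \<longleftrightarrow>
    (\<forall>u. is_series u \<longrightarrow> (\<forall>\<^sub>F p in near_zero. S u p = T u p))"
proof
  assume *: "germ_lift q x S = germ_lift q x T"
  show "\<forall>u. is_series u \<longrightarrow> (\<forall>\<^sub>F p in near_zero. S u p = T u p)"
    using germ_lift_apply[OF assms(1)] germ_lift_apply[OF assms(2)] *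
    by (simp flip: germ_eq_iff)
next
  assume "\<forall>u. is_series u \<longrightarrow> (\<forall>\<^sub>F p in near_zero. S u p = T u p)"
  then show "germ_lift q x S = germ_lift q x T"
    by (intro germ_op_extensionalityI germ_lift_extensional)
       (simp add: germ_lift_apply assms germ_eq_iff)
qed

lemma germ_lift_comp:
  fixes S T :: "('n::finite, 'k) fn_op"
  assumes "germ_op S" "germ_op T"
  shows "germ_lift q x S \<otimes>\<^bsub>endo\<^esub> germ_lift q x T = germ_lift q x (\<lambda>u. S (T u))"
proof (rule germ_op_extensionalityI)
  fix u :: "('n, 'k) fn"
  assume u: "is_series u"
  then have "is_series (T u)"
    using assms(2) by (simp add: germ_op_def)
  then show "(germ_lift q x S \<otimes>\<^bsub>endo\<^esub> germ_lift q x T) (germ u) =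
      germ_lift q x (\<lambda>u. S (T u)) (germ u)"
    using u assms germ_op_comp[OF assms]
    by (auto simp: endo_ring_def compose_def germ_lift_apply germ_group_carrier)
qed (simp_all add: germ_lift_extensional, simp add: endo_ring_def)

lemma germ_lift_add:
  fixes S T :: "('n::finite, 'k) fn_op"
  assumes "germ_op S" "germ_op T"
  shows "germ_lift q x S \<oplus>\<^bsub>endo\<^esub> germ_lift q x T = germ_lift q x (\<lambda>u p. S u p + T u p)"
proof (rule germ_op_extensionalityI)
  fix u :: "('n, 'k) fn"
  assume u: "is_series u"
  then show "(germ_lift q x S \<oplus>\<^bsub>endo\<^esub> germ_lift q x T) (germ u) =
      germ_lift q x (\<lambda>u p. S u p + T u p) (germ u)"
    using assms germ_op_add[OF assms]
    by (auto simp: endo_ring_def germ_lift_apply germ_group_carrier germ_group_mult)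
qed (simp_all add: germ_lift_extensional, simp add: endo_ring_def)

lemma germ_lift_one: "\<one>\<^bsub>endo\<^esub> = germ_lift q x (\<lambda>u. u)"
  by (rule germ_op_extensionalityI)
     (auto simp: germ_lift_extensional[unfolded germ_group_carrier] germ_lift_apply[OF germ_op_id]
        endo_ring_def germ_group_carrier)

lemma germ_lift_zero: "\<zero>\<^bsub>endo\<^esub> = germ_lift q x (\<lambda>u p. 0)"
  by (rule germ_op_extensionalityI)
     (auto simp: germ_lift_extensional[unfolded germ_group_carrier] germ_lift_apply[OF germ_op_zero]
        endo_ring_def germ_group_carrier germ_group_one)

end

section \<open>Linear independence of the monomials\<close>

text \<open>A polynomial with infinitely many roots is zero. Several \<open>a\<close> may share an
  exponent, hence the sum over a fibre of \<open>f\<close>.\<close>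

lemma poly_sum_monom_infinite_roots:
  fixes c :: "'a \<Rightarrow> 'k::field"
  assumes "finite S" "infinite Y" "\<And>t. t \<in> Y \<Longrightarrow> (\<Sum>a\<in>S. c a * t ^ f a) = 0"
  shows "(\<Sum>a | a \<in> S \<and> f a = n. c a) = 0"
proof -
  define p where "p = (\<Sum>a\<in>S. Polynomial.monom (c a) (f a))"
  have "Y \<subseteq> {t. poly p t = 0}"
    using assms(3) by (auto simp: p_def poly_sum poly_monom)
  then have "p = 0"
    using assms(2) poly_roots_finite finite_subset by blast
  then have "Polynomial.coeff p n = 0"
    by simp
  moreover have "Polynomial.coeff p n = (\<Sum>a\<in>S. if f a = n then c a else 0)"
    by (simp add: p_def coeff_sum)
  ultimately show ?thesis
    using assms(1) by (simp add: sum.If_cases Int_def conj_commute)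
qed

text \<open>Induction on the set of variables. With the others fixed, the sum is a polynomial in
  \<open>y j\<close>; its coefficient at the exponent of \<open>a\<close> is again such a sum, over
  indices that the remaining variables already separate.\<close>

lemma polynomial_vanishing_on_grid:
  fixes c :: "'a \<Rightarrow> 'k::field" and f :: "'a \<Rightarrow> 'n \<Rightarrow> nat"
  assumes "finite J" "infinite Y" "finite S"
    and "\<And>a b. a \<in> S \<Longrightarrow> b \<in> S \<Longrightarrow> (\<And>j. j \<in> J \<Longrightarrow> f a j = f b j) \<Longrightarrow> a = b"
    and "\<And>y. range y \<subseteq> Y \<Longrightarrow> (\<Sum>a\<in>S. c a * (\<Prod>j\<in>J. y j ^ f a j)) = 0"
    and "a \<in> S"
  shows "c a = 0"
  using assms
proof (induction J arbitrary: S a rule: finite_induct)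
  case empty
  then have "S = {a}"
    by blast
  moreover obtain t where "t \<in> Y"
    using infinite_imp_nonempty[OF \<open>infinite Y\<close>] by blast
  ultimately show ?case
    using empty.prems(4)[of "\<lambda>_. t"] by auto
next
  case (insert j J)
  let ?S = "{b \<in> S. f b j = f a j}"
  show ?case
  proof (rule insert.IH[of ?S])
    fix b b'
    assume "b \<in> ?S" "b' \<in> ?S" "\<And>i. i \<in> J \<Longrightarrow> f b i = f b' i"
    then show "b = b'"
      by (intro insert.prems(3)) auto
  next
    fix y :: "'n \<Rightarrow> 'k"
    assume y: "range y \<subseteq> Y"
    have "(\<Sum>b\<in>S. c b * (\<Prod>i\<in>J. y i ^ f b i) * t ^ f b j) = 0" if "t \<in> Y" for t
    proof -
      have "range (y(j := t)) \<subseteq> Y"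
        using y that by auto
      moreover have "(\<Prod>i\<in>J. (y(j := t)) i ^ f b i) = (\<Prod>i\<in>J. y i ^ f b i)" for b
        using insert.hyps by (intro prod.cong) auto
      ultimately show ?thesis
        using insert.prems(4)[of "y(j := t)"] insert.hyps
        by (simp only: prod.insert[OF insert.hyps] fun_upd_same mult_ac)
    qed
    from poly_sum_monom_infinite_roots[OF insert.prems(2) \<open>infinite Y\<close> this, where n = "f a j"]
    show "(\<Sum>b\<in>?S. c b * (\<Prod>i\<in>J. y i ^ f b i)) = 0" .
  qed (use insert.prems in auto)
qed

context carlitz_field
begin

text \<open>A single term of a series. Such functions are common eigenfunctions of all
  \<open>Delta_fn j\<close>, and \<open>d_fn\<close> lowers their indices until
  \<open>m = 0\<close>, where it kills them; this is how they tell monomials apart.\<close>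

definition test_fn :: "nat \<Rightarrow> ('n::finite \<Rightarrow> nat) \<Rightarrow> ('n, 'k) fn" where
  "test_fn m i p = series_term (\<lambda>_ _. 1) p (m, i)"

lemma is_series_test_fn:
  assumes "\<And>j. m \<le> i j"
  shows "is_series (test_fn m i)"
proof -
  let ?c = "\<lambda>m' i'. if (m', i') = (m, i) then 1 else 0 :: 'k"
  have "(series_term ?c p has_sum test_fn m i p) series_index" for p
  proof -
    have "(series_term ?c p has_sum test_fn m i p) {(m, i)}"
      using has_sum_finite[of "{(m, i)}" "series_term ?c p"] by (simp add: test_fn_def series_term_def)
    then show ?thesis
      using assms by (subst has_sum_cong_neutral[of "{(m, i)}" _ _ "series_term ?c p"])
        (auto simp: series_term_def series_index_def)
  qed
  then show ?thesis
    unfolding is_series_def has_series_def by (intro exI[of _ ?c]) simp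
qed

lemma Delta_test_fn: "Delta_fn j (test_fn m i) = scal_fn (carlitz_bracket q x (i j)) (test_fn m i)"
  using series_term_scale_s[of "\<lambda>_ _. 1" _ j "(m, i)"]
  by (auto simp: fun_eq_iff Delta_fn_def test_fn_def scal_fn_def)

lemma d_test_fn_0: "d_fn (test_fn 0 i) = (\<lambda>p. 0)"
  using series_term_scale_z[of "\<lambda>_ _. 1" _ "(0, i)"]
  by (auto simp: fun_eq_iff d_fn_def test_fn_def)

lemma d_test_fn_Suc: "d_fn (test_fn (Suc m) (\<lambda>j. Suc (i j))) = test_fn m i"
  using series_term_scale_z[of "\<lambda>_ _. 1" _ "(Suc m, \<lambda>j. Suc (i j))"]
    series_term_root[of "(m, i)" "\<lambda>_ _. 1"]
  by (auto simp: fun_eq_iff d_fn_def test_fn_def shift_index_def)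

text \<open>Indices of the form \<open>i j + m\<close> satisfy the constraint of
  \<open>series_index\<close> automatically and leave \<open>i\<close> arbitrary.\<close>

lemma d_funpow_test_fn: "(d_fn ^^ m) (test_fn m (\<lambda>j. i j + m)) = test_fn 0 i"
  by (induction m) (simp_all add: funpow_Suc_right d_test_fn_Suc del: funpow.simps(2))

lemma d_funpow_scal: "(d_fn ^^ m) (scal_fn a u) = scal_fn ((qth_root q ^^ m) a) ((d_fn ^^ m) u)"
  by (induction m) (simp_all add: d_scal)

lemma tau_funpow_scal: "(tau_fn ^^ l) (scal_fn a u) = scal_fn (((\<lambda>a. a ^ q) ^^ l) a) ((tau_fn ^^ l) u)"
  by (induction l) (simp_all add: tau_scal)

lemma tau_funpow: "(tau_fn ^^ l) u p = u p ^ (q ^ l)"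
  by (induction l) (simp_all add: tau_fn_def mult.commute flip: power_mult)

lemma Delta_mon_test_fn:
  "Delta_mon a (test_fn m i) =
    scal_fn (\<Prod>j\<in>UNIV. carlitz_bracket q x (i j) ^ lookup a j) (test_fn m i)"
proof (induction a rule: expo_induct)
  case zero
  show ?case
    by (simp add: Delta_mon_zero scal_fn_def)
next
  case (step a j)
  have "(\<Prod>k\<in>UNIV. carlitz_bracket q x (i k) ^ lookup (a + Poly_Mapping.single j 1) k) =
      carlitz_bracket q x (i j) * (\<Prod>k\<in>UNIV. carlitz_bracket q x (i k) ^ lookup a k)"
    by (simp add: prod.remove[of UNIV j] lookup_add lookup_single when_def)
  then show ?case
    unfolding Delta_Delta_mon[symmetric] step Delta_scal Delta_test_fn
    by (simp add: scal_fn_def fun_eq_iff mult_ac)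
qed

lemma mon_test_fn:
  "mon (l, m, a) (test_fn m (\<lambda>j. i j + m)) =
    (\<lambda>p. twist (l, m, a) (\<Prod>j\<in>UNIV. carlitz_bracket q x (i j + m) ^ lookup a j) *
      test_fn 0 i p ^ (q ^ l))"
  by (simp add: mon_def Delta_mon_test_fn d_funpow_scal d_funpow_test_fn tau_funpow_scal twist_def
      scal_fn_apply tau_funpow fun_eq_iff)

lemma mon_test_fn_eq_0:
  assumes "\<mu> > m"
  shows "mon (l, \<mu>, a) (test_fn m (\<lambda>j. i j + m)) = (\<lambda>p. 0)"
proof -
  obtain k where k: "\<mu> = k + Suc m"
    using assms less_imp_Suc_add by (metis add.commute add_Suc_right)
  have "(d_fn ^^ \<mu>) (test_fn m (\<lambda>j. i j + m)) = (\<lambda>p. 0)"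
    unfolding k funpow_add by (simp add: d_funpow_test_fn d_test_fn_0
        additive_op_zero[OF additive_op_funpow[OF additive_d_fn]])
  then have "(d_fn ^^ \<mu>) (Delta_mon a (test_fn m (\<lambda>j. i j + m))) = (\<lambda>p. 0)"
    by (simp add: Delta_mon_test_fn d_funpow_scal scal_fn_apply fun_eq_iff)
  then show ?thesis
    by (simp add: mon_def additive_op_zero[OF additive_op_funpow[OF additive_tau_fn]])
qed

lemma twist_mult: "twist e (a * b) = twist e a * twist e b"
proof -
  have "((\<lambda>a. a ^ q) ^^ l) (a * b) = ((\<lambda>a. a ^ q) ^^ l) a * ((\<lambda>a. a ^ q) ^^ l) b" for l and a b :: 'k
    by (induction l) (simp_all add: power_mult_distrib)
  moreover have "(qth_root q ^^ l) (a * b) = (qth_root q ^^ l) a * (qth_root q ^^ l) b" for l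
    by (induction l) (simp_all add: root_mult)
  ultimately show ?thesis
    by (simp add: twist_def)
qed

lemma twist_one: "twist e 1 = 1"
proof -
  have "((\<lambda>a. a ^ q) ^^ l) (1::'k) = 1" for l
    by (induction l) simp_all
  moreover have "(qth_root q ^^ l) (1::'k) = 1" for l
    by (induction l) simp_all
  ultimately show ?thesis
    by (simp add: twist_def)
qed

lemma twist_power: "twist e (a ^ n) = twist e a ^ n"
  by (induction n) (simp_all add: twist_one twist_mult)

lemma twist_prod: "twist e (\<Prod>j\<in>J. f j) = (\<Prod>j\<in>J. twist e (f j))"
  by (induction J rule: infinite_finite_induct) (simp_all add: twist_one twist_mult)

lemma inj_twist: "inj (twist e)"
proof -
  have "inj (\<lambda>a :: 'k. a ^ q)" "inj (qth_root q :: 'k \<Rightarrow> 'k)"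
    using frob_inj by (auto simp: inj_on_def intro: frob_inj[THEN iffD1]) (metis root_frob)
  then have "inj (((\<lambda>a :: 'k. a ^ q) ^^ fst e) \<circ> (qth_root q ^^ fst (snd e)))"
    by (intro inj_compose inj_fn)
  then show ?thesis
    by (simp add: inj_def twist_def)
qed

text \<open>These diagonal points approach the origin, so an identity of germs can be evaluated at
  infinitely many of them, as an identity in one variable.\<close>

lemma filterlim_power_x:
  "filterlim (\<lambda>k. ((\<lambda>_. x ^ k) :: 'n \<Rightarrow> 'k, x ^ k)) near_zero sequentially"
proof -
  have "(\<lambda>k. dist x 0 ^ k) \<longlonglongrightarrow> 0"
    using dist_x_lt_1 by (intro LIMSEQ_power_zero) simp
  then have lim: "(\<lambda>k. x ^ k) \<longlonglongrightarrow> 0"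
    by (simp add: tendsto_dist_iff[of "\<lambda>k. x ^ k"] dist_power_zero)
  have "continuous_on UNIV (\<lambda>t :: 'k. ((\<lambda>_. t) :: 'n \<Rightarrow> 'k, t))"
    by (intro continuous_on_Pair continuous_on_coordinatewise_then_product continuous_on_id)
  then have "((\<lambda>t :: 'k. ((\<lambda>_. t) :: 'n \<Rightarrow> 'k, t)) \<longlongrightarrow> (\<lambda>_. 0, 0)) (at 0)"
    unfolding continuous_on_def by blast
  then have "((\<lambda>t :: 'k. ((\<lambda>_. t) :: 'n \<Rightarrow> 'k, t)) \<longlongrightarrow> (\<lambda>_. 0, 0)) (nhds 0)"
    using tendsto_at_iff_tendsto_nhds[of "\<lambda>t :: 'k. ((\<lambda>_. t) :: 'n \<Rightarrow> 'k, t)" 0] by simp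
  from filterlim_compose[OF this lim] show ?thesis
    by (simp add: near_zero_def)
qed

text \<open>
  Applied to \<open>test_fn m (\<lambda>j. i j + m)\<close> for the least exponent \<open>m\<close> of \<open>d\<close> that occurs, all terms
  with a larger exponent of \<open>d\<close> vanish, the exponent of \<open>\<tau>\<close> can be read off the growth along the
  diagonal, and the exponents of the \<open>\<Delta>\<^sub>j\<close> off the dependence on \<open>i\<close>.
\<close>

lemma ev_eventually_zero_imp_zero:
  fixes w :: "'n::finite expo \<Rightarrow>\<^sub>0 'k"
  assumes "\<And>u. is_series u \<Longrightarrow> \<forall>\<^sub>F p in near_zero. ev w u p = 0"
  shows "w = 0"
proof (rule ccontr)
  assume "w \<noteq> 0"
  then have ne: "keys w \<noteq> {}"
    by simp
  define m where "m = Min ((\<lambda>e. fst (snd e)) ` keys w)"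
  have m_le: "m \<le> fst (snd e)" if "e \<in> keys w" for e
    using that by (simp add: m_def)
  have "m \<in> (\<lambda>e. fst (snd e)) ` keys w"
    unfolding m_def using ne by (intro Min_in) auto
  then obtain l a where e: "(l, m, a) \<in> keys w"
    by force
  define S where "S = {b. (l, m, b) \<in> keys w}"
  have "(\<lambda>b. (l, m, b)) ` S \<subseteq> keys w"
    by (auto simp: S_def)
  then have fin: "finite S"
    by (rule inj_on_finite[rotated]) (auto simp: inj_on_def)
  let ?B = "\<lambda>i b. \<Prod>j\<in>UNIV. carlitz_bracket q x (i j + m) ^ lookup b j"
  have vanish: "(\<Sum>b\<in>S. lookup w (l, m, b) * twist (l, m, b) (?B i b)) = 0" for i
  proof -
    let ?u = "test_fn m (\<lambda>j. i j + m)"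
    \<comment> \<open>The degree of \<open>test_fn 0 i\<close> on the diagonal. The summand 1 comes
      from \<open>z\<close> and keeps \<open>N\<close> positive, so that \<open>N * q ^ l\<close>
      determines \<open>l\<close>.\<close>
    define N where "N = (\<Sum>j\<in>UNIV. q ^ i j) + 1"
    define K where "K = {f \<in> keys w. fst (snd f) = m}"
    let ?c = "\<lambda>f. lookup w f * twist f (?B i (snd (snd f)))"
    have finK: "finite K"
      by (simp add: K_def)
    have test: "test_fn 0 i (\<lambda>_. t, t) = t ^ N" for t :: 'k
      by (simp add: test_fn_def series_term_def N_def power_add power_sum)
    have ev: "ev w ?u (\<lambda>_. t, t) = (\<Sum>f\<in>K. ?c f * t ^ (N * q ^ fst f))" for t
    proof -
      have "ev w ?u (\<lambda>_. t, t) = (\<Sum>f\<in>K. lookup w f * mon f ?u (\<lambda>_. t, t))"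
        unfolding ev_def K_def
      proof (rule sum.mono_neutral_right)
        show "\<forall>f\<in>keys w - {f \<in> keys w. fst (snd f) = m}. lookup w f * mon f ?u (\<lambda>_. t, t) = 0"
        proof
          fix f
          assume f: "f \<in> keys w - {f \<in> keys w. fst (snd f) = m}"
          obtain l' \<mu> b where "f = (l', \<mu>, b)"
            by (rule prod_cases3)
          moreover from this have "m < \<mu>"
            using f m_le[of f] by auto
          ultimately show "lookup w f * mon f ?u (\<lambda>_. t, t) = 0"
            by (simp add: mon_test_fn_eq_0)
        qed
      qed auto
      also have "\<dots> = (\<Sum>f\<in>K. ?c f * t ^ (N * q ^ fst f))"
      proof (rule sum.cong)
        fix f
        assume f: "f \<in> K"
        obtain l' \<mu> b where "f = (l', \<mu>, b)"
          by (rule prod_cases3)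
        then show "lookup w f * mon f ?u (\<lambda>_. t, t) = ?c f * t ^ (N * q ^ fst f)"
          using f by (simp add: K_def mon_test_fn test power_mult)
      qed simp
      finally show ?thesis .
    qed
    have "\<forall>\<^sub>F p in near_zero. ev w ?u p = 0"
      by (intro assms is_series_test_fn) simp
    from eventually_compose_filterlim[OF this filterlim_power_x]
    obtain k0 where k0: "\<And>k. k \<ge> k0 \<Longrightarrow> ev w ?u (\<lambda>_. x ^ k, x ^ k) = 0"
      by (auto simp: eventually_sequentially)
    have "infinite ((\<lambda>k. x ^ k) ` {k0..})"
      using power_x_inj by (simp add: finite_image_iff inj_on_def infinite_Ici)
    then have "(\<Sum>f | f \<in> K \<and> N * q ^ fst f = N * q ^ l. ?c f) = 0"
      by (rule poly_sum_monom_infinite_roots[OF finK]) (use k0 ev in force)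
    also have "{f. f \<in> K \<and> N * q ^ fst f = N * q ^ l} = (\<lambda>b. (l, m, b)) ` S"
    proof -
      have "N > 0"
        by (simp add: N_def)
      then show ?thesis
        by (auto simp: K_def S_def q_power_inj)
    qed
    finally show ?thesis
      by (subst (asm) sum.reindex) (auto simp: inj_on_def)
  qed
  have "lookup w (l, m, a) = 0"
  \<comment> \<open>Since \<open>twist (l, m, b)\<close> does not depend on \<open>b\<close>, a
    single automorphism acts on all terms, and \<open>vanish\<close> says that one polynomial
    vanishes at all tuples of twisted brackets. There are infinitely many of these because
    \<open>twist\<close> is injective.\<close>
  proof (rule polynomial_vanishing_on_grid[of UNIV "twist (l, m, a) ` range (\<lambda>k. carlitz_bracket q x (k + m))" S
        lookup "\<lambda>b. lookup w (l, m, b)" a])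
    have "infinite (range (\<lambda>k. carlitz_bracket q x (k + m)))"
      by (intro range_inj_infinite) (simp add: inj_def carlitz_bracket_inj)
    then show "infinite (twist (l, m, a) ` range (\<lambda>k. carlitz_bracket q x (k + m)))"
      using inj_twist finite_imageD inj_on_subset by blast
    fix y :: "'n \<Rightarrow> 'k"
    assume "range y \<subseteq> twist (l, m, a) ` range (\<lambda>k. carlitz_bracket q x (k + m))"
    then have "\<forall>j. \<exists>k. y j = twist (l, m, a) (carlitz_bracket q x (k + m))"
      by blast
    then obtain i where "\<And>j. y j = twist (l, m, a) (carlitz_bracket q x (i j + m))"
      by metis
    then show "(\<Sum>b\<in>S. lookup w (l, m, b) * (\<Prod>j\<in>UNIV. y j ^ lookup b j)) = 0"
      using vanish[of i] by (simp add: twist_prod twist_power) (simp add: twist_def)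
  qed (use fin e in \<open>auto simp: S_def intro: poly_mapping_eqI\<close>)
  with e show False
    by (simp add: in_keys_iff)
qed

section \<open>The Carlitz ring\<close>

abbreviation A :: "('n::finite, 'k) germ_op ring" where
  "A \<equiv> carlitz_ring q x"

definition L :: "('n::finite expo \<Rightarrow>\<^sub>0 'k) \<Rightarrow> ('n, 'k) germ_op" where
  "L w = germ_lift q x (ev w)"

lemma carlitz_tau_eq: "carlitz_tau q x = germ_lift q x tau_fn"
  by (simp add: carlitz_tau_def tau_fn_def[abs_def])

lemma carlitz_d_eq: "carlitz_d q x = germ_lift q x d_fn"
  by (simp add: carlitz_d_def d_fn_def[abs_def])

lemma carlitz_Delta_eq: "carlitz_Delta q x j = germ_lift q x (Delta_fn j)"
  by (simp add: carlitz_Delta_def Delta_fn_def[abs_def])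

lemma carlitz_scalar_eq: "carlitz_scalar q x a = germ_lift q x (scal_fn a)"
  by (simp add: carlitz_scalar_def scal_fn_def[abs_def])

lemmas carlitz_generator_eqs = carlitz_tau_eq carlitz_d_eq carlitz_Delta_eq carlitz_scalar_eq

text \<open>Uniqueness of the normal form, by applying linear independence to the difference of the
  two coefficient families.\<close>

lemma L_inj: "L w = L w' \<longleftrightarrow> w = w'"
proof
  assume "L w = L w'"
  then have *: "\<forall>\<^sub>F p in near_zero. ev w u p = ev w' u p" if "is_series u" for u
    using that germ_lift_eq_iff[OF germ_op_ev germ_op_ev] by (auto simp: L_def)
  have "w + scale (- 1) w' = 0"
    by (rule ev_eventually_zero_imp_zero)
       (use * in \<open>auto simp: ev_add ev_scale scal_fn_apply elim: eventually_mono\<close>)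
  then have "lookup w e - lookup w' e = 0" for e
    by (metis lookup_add lookup_scale lookup_zero mult_minus1 diff_conv_add_uminus)
  then show "w = w'"
    by (intro poly_mapping_eqI) simp
qed simp

lemma L_endo_add: "L w \<oplus>\<^bsub>endo\<^esub> L w' = L (w + w')"
  by (simp add: L_def germ_lift_add germ_op_ev) (simp add: ev_add[symmetric])

lemma L_endo_zero: "\<zero>\<^bsub>endo\<^esub> = L 0"
  unfolding germ_lift_zero L_def by (rule arg_cong[of _ _ "germ_lift q x"]) (simp add: fun_eq_iff ev_zero)

lemma L_endo_one: "\<one>\<^bsub>endo\<^esub> = L (Poly_Mapping.single 0 1)"
  unfolding germ_lift_one L_def
  by (rule arg_cong[of _ _ "germ_lift q x"])
     (simp add: fun_eq_iff ev_single scal_fn_def mon_zero del: single_one)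

lemma L_eqI: "(\<And>u. T u = ev w u) \<Longrightarrow> germ_lift q x T = L w"
  unfolding L_def by (rule arg_cong[of _ _ "germ_lift q x"]) auto

definition deg_le :: "nat \<Rightarrow> ('n::finite expo \<Rightarrow>\<^sub>0 'k) set" where
  "deg_le n = {w. \<forall>e\<in>keys w. expo_deg e \<le> n}"

lemma deg_le_ex: "\<exists>n. w \<in> deg_le n"
proof
  show "w \<in> deg_le (Max (expo_deg ` keys w))"
    by (auto simp: deg_le_def)
qed

lemma L_endo_mult:
  assumes "w \<in> deg_le m" "w' \<in> deg_le n"
  shows "\<exists>w''\<in>deg_le (m + n). L w \<otimes>\<^bsub>endo\<^esub> L w' = L w''"
proof -
  have "below (Suc m) (ev w)" "below (Suc n) (ev w')"
    using assms unfolding below_def deg_le_def by (auto simp: less_Suc_eq_le)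
  from below_ev_comp[OF this] obtain w'' where
    "\<forall>e\<in>keys w''. expo_deg e < Suc (m + n)" "(\<lambda>u. ev w (ev w' u)) = ev w''"
    by (auto simp: below_def)
  then show ?thesis
    by (intro bexI[of _ w'']) (auto simp: L_def germ_lift_comp germ_op_ev deg_le_def less_Suc_eq_le)
qed

lemma L_endo_uminus: "\<ominus>\<^bsub>endo\<^esub> L w = L (scale (- 1) w)"
proof -
  interpret E: ring endo
    by (rule ring_endo)
  have "scale (- 1) w + w = 0"
    by (intro poly_mapping_eqI) (simp add: lookup_add)
  then have "L (scale (- 1) w) \<oplus>\<^bsub>endo\<^esub> L w = \<zero>\<^bsub>endo\<^esub>"
    by (simp add: L_endo_add L_endo_zero)
  then show ?thesis
    by (intro E.minus_equality) (simp_all add: L_def germ_lift_closed germ_op_ev)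
qed

lemma generators_closed:
  "{carlitz_tau q x, carlitz_d q x} \<union> range (carlitz_Delta q x) \<union> range (carlitz_scalar q x) \<subseteq>
    carrier (endo :: ('n::finite, 'k) germ_op ring)"
  unfolding carlitz_generator_eqs
  by (auto intro!: germ_lift_closed germ_op_tau germ_op_d germ_op_Delta germ_op_scal)

lemma tau_in_L: "carlitz_tau q x = L (Poly_Mapping.single (1, 0, 0) 1)"
  unfolding carlitz_tau_eq
  by (rule L_eqI) (simp add: ev_single scal_fn_def mon_def Delta_mon_zero)

lemma d_in_L: "carlitz_d q x = L (Poly_Mapping.single (0, 1, 0) 1)"
  unfolding carlitz_d_eq
  by (rule L_eqI) (simp add: ev_single scal_fn_def mon_def Delta_mon_zero)

lemma Delta_in_L: "carlitz_Delta q x j = L (Poly_Mapping.single (0, 0, Poly_Mapping.single j 1) 1)"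
  unfolding carlitz_Delta_eq
proof (rule L_eqI)
  fix u
  show "Delta_fn j u = ev (Poly_Mapping.single (0, 0, Poly_Mapping.single j 1) 1) u"
    using Delta_Delta_mon[of j 0 u] by (simp add: ev_single scal_fn_def mon_def Delta_mon_zero)
qed

lemma scalar_in_L: "carlitz_scalar q x a = L (Poly_Mapping.single 0 a)"
  unfolding carlitz_scalar_eq by (rule L_eqI) (simp add: ev_single mon_zero)

lemma subring_range_L: "subring (range L) (endo :: ('n::finite, 'k) germ_op ring)"
proof -
  interpret E: ring "endo :: ('n, 'k) germ_op ring"
    by (rule ring_endo)
  show ?thesis
  proof (rule E.subringI)
    show "range L \<subseteq> carrier (endo :: ('n, 'k) germ_op ring)"
      by (auto simp: L_def germ_lift_closed germ_op_ev)
    fix h1 h2 :: "('n, 'k) germ_op"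
    assume "h1 \<in> range L" "h2 \<in> range L"
    then obtain w w' where h: "h1 = L w" "h2 = L w'"
      by blast
    obtain m n where "w \<in> deg_le m" "w' \<in> deg_le n"
      using deg_le_ex by metis
    from L_endo_mult[OF this] show "h1 \<otimes>\<^bsub>endo\<^esub> h2 \<in> range L"
      unfolding h by blast
    show "h1 \<oplus>\<^bsub>endo\<^esub> h2 \<in> range L"
      unfolding h L_endo_add by blast
  next
    fix h :: "('n, 'k) germ_op"
    assume "h \<in> range L"
    then show "\<ominus>\<^bsub>endo\<^esub> h \<in> range L"
      by (auto simp: L_endo_uminus)
  qed (simp add: L_endo_one)
qed

lemma ring_A: "ring (A :: ('n::finite, 'k) germ_op ring)"
  unfolding carlitz_ring_def
  by (rule ring.generate_ring_is_ring[OF ring_endo generators_closed])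

lemma A_simps:
  "add A = add endo" "mult A = mult endo" "one A = one endo" "zero A = zero endo"
  by (simp_all add: carlitz_ring_def)

lemma germ_lift_A_comp:
  assumes "germ_op S" "germ_op T" "germ_lift q x S \<in> carrier A" "germ_lift q x T \<in> carrier A"
  shows "germ_lift q x (\<lambda>u. S (T u)) \<in> carrier A"
  using ring.ring_simprules(5)[OF ring_A assms(3,4)]
  unfolding A_simps germ_lift_comp[OF assms(1,2)] .

lemma germ_lift_A_funpow:
  assumes "germ_op T" "germ_lift q x T \<in> carrier A"
  shows "germ_lift q x (T ^^ n) \<in> carrier A"
proof (induction n)
  case 0
  show ?case
    using ring.ring_simprules(6)[OF ring_A] unfolding A_simps germ_lift_one by (simp add: id_def)
next
  case (Suc n)
  from germ_lift_A_comp[OF assms(1) germ_op_funpow[OF assms(1)] assms(2) this] show ?case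
    by (simp add: o_def)
qed

lemma generators_A:
  "germ_lift q x tau_fn \<in> carrier A" "germ_lift q x d_fn \<in> carrier A"
  "germ_lift q x (Delta_fn j) \<in> carrier A" "germ_lift q x (scal_fn a) \<in> carrier A"
  unfolding carlitz_ring_def carlitz_generator_eqs by (auto intro: generate_ring.incl)

lemma germ_lift_mon_A:
  fixes e :: "'n::finite expo"
  shows "germ_lift q x (mon e) \<in> carrier A"
proof -
  have "germ_lift q x (Delta_list js i) \<in> carrier A" for js :: "'n list" and i
  proof (induction js)
    case Nil
    have "germ_lift q x ((tau_fn :: ('n, 'k) fn_op) ^^ 0) \<in> carrier A"
      by (rule germ_lift_A_funpow[OF germ_op_tau generators_A(1)])
    then show ?case
      by (simp add: id_def)
  next
    case (Cons j js)
    from germ_lift_A_comp[OF germ_op_funpow[OF germ_op_Delta] germ_op_Delta_list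
        germ_lift_A_funpow[OF germ_op_Delta generators_A(3)] this]
    show ?case
      by (simp add: o_def)
  qed
  then have *: "germ_op (Delta_mon (snd (snd e)))" "germ_lift q x (Delta_mon (snd (snd e))) \<in> carrier A"
    using Delta_mon_list germ_op_Delta_list by metis+
  have d: "germ_op (d_fn ^^ fst (snd e))" "germ_lift q x (d_fn ^^ fst (snd e)) \<in> carrier A"
    by (rule germ_op_funpow[OF germ_op_d]) (rule germ_lift_A_funpow[OF germ_op_d generators_A(2)])
  from germ_lift_A_comp[OF germ_op_funpow[OF germ_op_tau] germ_op_comp[OF d(1) *(1)]
      germ_lift_A_funpow[OF germ_op_tau generators_A(1)] germ_lift_A_comp[OF d(1) *(1) d(2) *(2)]]
  show ?thesis
    by (simp add: mon_def o_def)
qed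

lemma L_single_A: "L (Poly_Mapping.single e a) \<in> carrier A"
  using germ_lift_A_comp[OF germ_op_scal germ_op_mon generators_A(4) germ_lift_mon_A, of a e]
  by (simp add: L_def ev_single[abs_def])

lemma poly_mapping_eq_sum_single: "w = (\<Sum>e\<in>keys w. Poly_Mapping.single e (lookup w e))"
  by (rule poly_mapping_eqI)
     (simp add: lookup_sum lookup_single when_def in_keys_iff)

lemma L_A: "L w \<in> carrier A"
proof -
  interpret A: ring A
    by (rule ring_A)
  have "L (\<Sum>e\<in>S. Poly_Mapping.single e (lookup w e)) \<in> carrier A" if "finite S" for S
    using that
  proof (induction S rule: finite_induct)
    case empty
    show ?case
      using A.zero_closed by (simp add: A_simps L_endo_zero)
  next
    case (insert e S)
    then show ?case
      using A.add.m_closed[OF L_single_A insert.IH] by (simp add: A_simps L_endo_add)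
  qed
  from this[of "keys w"] show ?thesis
    by (simp flip: poly_mapping_eq_sum_single)
qed

text \<open>Existence of the normal form: products can be reordered, so \<open>range L\<close> is a
  subring, and it contains the generators. With \<open>L_inj\<close>, ring elements and coefficient
  families become interchangeable.\<close>

lemma carrier_A: "carrier A = range L"
proof
  show "carrier A \<subseteq> range L"
    unfolding carlitz_ring_def
    using ring.generate_ring_min_subring1[OF ring_endo generators_closed subring_range_L]
    by (auto simp: tau_in_L d_in_L Delta_in_L scalar_in_L)
qed (use L_A in auto)

lemma L_add: "L w \<oplus>\<^bsub>A\<^esub> L w' = L (w + w')"
  and L_zero: "\<zero>\<^bsub>A\<^esub> = L 0"
  and L_one: "\<one>\<^bsub>A\<^esub> = L (Poly_Mapping.single 0 1)"
  by (simp_all add: A_simps L_endo_add L_endo_zero L_endo_one)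

lemma L_mult:
  "w \<in> deg_le m \<Longrightarrow> w' \<in> deg_le n \<Longrightarrow> \<exists>w''\<in>deg_le (m + n). L w \<otimes>\<^bsub>A\<^esub> L w' = L w''"
  unfolding A_simps by (rule L_endo_mult)

lemma L_scale: "carlitz_scalar q x a \<otimes>\<^bsub>A\<^esub> L w = L (scale a w)"
  unfolding A_simps carlitz_scalar_eq L_def germ_lift_comp[OF germ_op_scal germ_op_ev]
  by (rule arg_cong[of _ _ "germ_lift q x"]) (simp add: fun_eq_iff ev_scale)

lemma L_uminus: "\<ominus>\<^bsub>A\<^esub> L w = L (scale (- 1) w)"
proof -
  interpret A: ring A
    by (rule ring_A)
  have "scale (- 1) w + w = 0"
    by (intro poly_mapping_eqI) (simp add: lookup_add)
  then show ?thesis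
    by (intro A.minus_equality) (simp_all add: L_add L_zero L_A)
qed

end

section \<open>Filtered modules and their graded modules\<close>

text \<open>Scalars are left out: generation of the graded module and the comparison of filtrations
  involve only additive subgroups and the action of \<open>\<Gamma>\<close>.\<close>

locale filtered_left_module = left_module R M
  for R :: "('r, 'd) ring_scheme" (structure) and M :: "('r, 'm, 'e) module_scheme" (structure) +
  fixes \<Gamma> :: "nat \<Rightarrow> 'r set" and F :: "nat \<Rightarrow> 'm set"
  assumes \<Gamma>_subgroup: "\<And>i. subgroup (\<Gamma> i) (add_monoid R)"
    and \<Gamma>_mono: "\<And>i. \<Gamma> i \<subseteq> \<Gamma> (Suc i)"
    and F_subgroup: "\<And>k. subgroup (F k) (add_monoid M)"
    and F_mono: "\<And>k. F k \<subseteq> F (Suc k)"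
    and F_union: "(\<Union>k. F k) = carrier M"
    and F_smult: "\<And>i j a m. a \<in> \<Gamma> i \<Longrightarrow> m \<in> F j \<Longrightarrow> a \<odot>\<^bsub>M\<^esub> m \<in> F (i + j)"

lemma regular_module_simps:
  "carrier (regular_module R) = carrier R" "zero (regular_module R) = zero R"
  "add (regular_module R) = add R" "module.smult (regular_module R) = mult R"
  by (simp_all add: regular_module_def)

text \<open>Separated so that the graded pieces of the module and those of the ring, viewed as its
  own regular module, are treated by the same lemmas.\<close>

locale filtered_group = abelian_group M
  for M :: "('r, 'm, 'e) module_scheme" (structure) +
  fixes F :: "nat \<Rightarrow> 'm set"
  assumes F_subgroup: "\<And>k. subgroup (F k) (add_monoid M)"
    and F_mono: "\<And>k. F k \<subseteq> F (Suc k)"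
begin

abbreviation "P \<equiv> filt_pred M F"

lemma F_carrier: "m \<in> F k \<Longrightarrow> m \<in> carrier M"
  using subgroup.subset[OF F_subgroup] by auto

lemma F_zero: "\<zero> \<in> F k"
  using subgroup.one_closed[OF F_subgroup] by simp

lemma F_add: "a \<in> F k \<Longrightarrow> b \<in> F k \<Longrightarrow> a \<oplus> b \<in> F k"
  using subgroup.m_closed[OF F_subgroup] by simp

lemma F_minus: "a \<in> F k \<Longrightarrow> \<ominus> a \<in> F k"
  using subgroup.m_inv_closed[OF F_subgroup] by (simp add: a_inv_def)

lemma F_le: "i \<le> k \<Longrightarrow> F i \<subseteq> F k"
  using lift_Suc_mono_le[of F, OF F_mono] .

lemma P_subgroup: "subgroup (P k) (add_monoid M)"
proof (cases k)
  case 0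
  then show ?thesis
    using add.triv_subgroup by (simp add: filt_pred_def)
qed (simp add: filt_pred_def F_subgroup)

lemma P_zero: "\<zero> \<in> P k"
  using subgroup.one_closed[OF P_subgroup] by simp

lemma P_subset: "P k \<subseteq> F k"
  using F_mono F_zero by (cases k) (auto simp: filt_pred_def)

definition coset :: "nat \<Rightarrow> 'm \<Rightarrow> 'm set" where
  "coset k m = P k +> m"

lemma coset_self: "m \<in> carrier M \<Longrightarrow> m \<in> coset k m"
  unfolding coset_def a_r_coset_def using add.rcos_self[OF _ P_subgroup] by simp

lemma coset_memD: "m' \<in> coset k m \<Longrightarrow> \<exists>p\<in>P k. m' = p \<oplus> m"
  by (auto simp: coset_def a_r_coset_def r_coset_def)

lemma coset_memI: "p \<in> P k \<Longrightarrow> p \<oplus> m \<in> coset k m"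
  by (auto simp: coset_def a_r_coset_def r_coset_def)

lemma coset_eqI: "m \<in> carrier M \<Longrightarrow> m' \<in> coset k m \<Longrightarrow> coset k m' = coset k m"
  unfolding coset_def a_r_coset_def using add.repr_independence[OF _ _ P_subgroup] by fastforce

lemma coset_zero: "coset k \<zero> = P k"
  unfolding coset_def using add.coset_mult_one[of "P k"] subgroup.subset[OF P_subgroup, of k] by simp

lemma coset_add: "a \<in> carrier M \<Longrightarrow> b \<in> carrier M \<Longrightarrow>
    set_mult (add_monoid M) (coset k a) (coset k b) = coset k (a \<oplus> b)"
  using normal.rcos_sum[of "P k" "add_monoid M" a b]
    comm_group.normal_iff_subgroup[OF a_comm_group, of "P k"] P_subgroup
  by (simp add: coset_def a_r_coset_def)

lemma gr_piece_carrier: "carrier (gr_piece M F k) = coset k ` F k"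
  by (auto simp: gr_piece_def A_FactGroup_def FactGroup_def RCOSETS_def coset_def a_r_coset_def r_coset_def)

lemma gr_piece_one: "\<one>\<^bsub>gr_piece M F k\<^esub> = coset k \<zero>"
  by (simp add: gr_piece_def A_FactGroup_def FactGroup_def coset_zero)

lemma gr_piece_mult: "a \<in> carrier M \<Longrightarrow> b \<in> carrier M \<Longrightarrow>
    coset k a \<otimes>\<^bsub>gr_piece M F k\<^esub> coset k b = coset k (a \<oplus> b)"
  using coset_add[of a b k]
  by (simp add: gr_piece_def A_FactGroup_def FactGroup_def set_mult_def)

lemma comm_monoid_gr_piece: "comm_monoid (gr_piece M F k)"
proof (rule comm_monoidI)
  fix g h
  assume "g \<in> carrier (gr_piece M F k)" "h \<in> carrier (gr_piece M F k)"
  then obtain a b where "a \<in> F k" "g = coset k a" "b \<in> F k" "h = coset k b"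
    by (auto simp: gr_piece_carrier)
  then show "g \<otimes>\<^bsub>gr_piece M F k\<^esub> h = h \<otimes>\<^bsub>gr_piece M F k\<^esub> g"
    using a_comm[of a b] by (simp add: gr_piece_mult F_carrier[of _ k])
qed (auto simp: gr_piece_carrier gr_piece_one gr_piece_mult F_carrier[of _ k] F_zero F_add a_assoc)

text \<open>The action in \<open>gr_module\<close> is defined by products in factor groups; they
  become classes of sums of representatives here.\<close>

lemma gr_piece_finprod:
  assumes "finite S" "\<And>i. i \<in> S \<Longrightarrow> v i \<in> F k"
  shows "finprod (gr_piece M F k) (\<lambda>i. coset k (v i)) S = coset k (finsum M v S) \<and> finsum M v S \<in> F k"
  using assms
proof (induction S rule: finite_induct)
  case empty
  then show ?case
    using comm_monoid.finprod_empty[OF comm_monoid_gr_piece, of k] by (simp add: gr_piece_one F_zero)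
next
  case (insert i S)
  then have v: "v i \<in> F k" "v \<in> S \<rightarrow> carrier M" "finsum M v S \<in> F k"
    by (auto intro: F_carrier)
  have "finprod (gr_piece M F k) (\<lambda>i. coset k (v i)) (insert i S) =
      coset k (v i) \<otimes>\<^bsub>gr_piece M F k\<^esub> finprod (gr_piece M F k) (\<lambda>i. coset k (v i)) S"
    using insert by (intro comm_monoid.finprod_insert[OF comm_monoid_gr_piece])
      (auto simp: gr_piece_carrier)
  also have "\<dots> = coset k (v i \<oplus> finsum M v S)"
    using insert v by (simp add: gr_piece_mult F_carrier[of _ k])
  finally show ?case
    using insert v by (simp add: F_carrier[of _ k] F_add)
qed

definition seqs :: "(nat \<Rightarrow> 'm) set" where
  "seqs = {m. (\<forall>k. m k \<in> F k) \<and> finite {k. m k \<noteq> \<zero>}}"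

lemma seqs_F: "m \<in> seqs \<Longrightarrow> m k \<in> F k"
  by (simp add: seqs_def)

lemma seqs_carrier: "m \<in> seqs \<Longrightarrow> m k \<in> carrier M"
  by (rule F_carrier[OF seqs_F])

definition cls :: "(nat \<Rightarrow> 'm) \<Rightarrow> nat \<Rightarrow> 'm set" where
  "cls m = (\<lambda>k. coset k (m k))"

lemma gr_carrier: "carrier (gr_module M F) = cls ` seqs"
proof (intro equalityI subsetI)
  fix g
  assume "g \<in> carrier (gr_module M F)"
  then have g: "\<And>k. g k \<in> coset k ` F k" "finite {k. g k \<noteq> coset k \<zero>}"
    by (auto simp: gr_module_def gr_piece_carrier gr_piece_one)
  \<comment> \<open>The representative is chosen zero wherever the class is trivial; otherwise the
    family could have infinite support.\<close>
  have "\<exists>m. m \<in> F k \<and> g k = coset k m \<and> (g k = coset k \<zero> \<longrightarrow> m = \<zero>)" for k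
    using g(1)[of k] F_zero by (cases "g k = coset k \<zero>") auto
  then obtain m where m: "\<And>k. m k \<in> F k" "\<And>k. g k = coset k (m k)" "\<And>k. g k = coset k \<zero> \<longrightarrow> m k = \<zero>"
    by metis
  have "{k. m k \<noteq> \<zero>} \<subseteq> {k. g k \<noteq> coset k \<zero>}"
    using m(3) by auto
  then have "m \<in> seqs"
    using m(1) finite_subset[OF _ g(2)] by (auto simp: seqs_def)
  then show "g \<in> cls ` seqs"
    using m(2) by (intro image_eqI[of _ _ m]) (auto simp: cls_def)
next
  fix g
  assume "g \<in> cls ` seqs"
  then obtain m where m: "g = cls m" "\<And>k. m k \<in> F k" "finite {k. m k \<noteq> \<zero>}"
    by (auto simp: seqs_def)
  have "{k. g k \<noteq> coset k \<zero>} \<subseteq> {k. m k \<noteq> \<zero>}"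
    by (auto simp: m(1) cls_def)
  then show "g \<in> carrier (gr_module M F)"
    using m(2) finite_subset[OF _ m(3)]
    by (auto simp: gr_module_def gr_piece_carrier gr_piece_one m(1) cls_def)
qed

lemma gr_add: "m \<in> seqs \<Longrightarrow> m' \<in> seqs \<Longrightarrow> cls m \<oplus>\<^bsub>gr_module M F\<^esub> cls m' = cls (\<lambda>k. m k \<oplus> m' k)"
  by (simp add: gr_module_def cls_def fun_eq_iff seqs_carrier gr_piece_mult)

lemma gr_zero: "\<zero>\<^bsub>gr_module M F\<^esub> = cls (\<lambda>k. \<zero>)"
  by (auto simp: gr_module_def cls_def gr_piece_one)

lemma seqs_zero: "(\<lambda>k. \<zero>) \<in> seqs"
  by (simp add: seqs_def F_zero)

lemma seqs_add: "m \<in> seqs \<Longrightarrow> m' \<in> seqs \<Longrightarrow> (\<lambda>k. m k \<oplus> m' k) \<in> seqs"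
proof -
  assume m: "m \<in> seqs" "m' \<in> seqs"
  have "{k. m k \<oplus> m' k \<noteq> \<zero>} \<subseteq> {k. m k \<noteq> \<zero>} \<union> {k. m' k \<noteq> \<zero>}"
    by auto
  with m show ?thesis
    using finite_subset by (fastforce simp: seqs_def F_add)
qed

lemma seqs_minus: "m \<in> seqs \<Longrightarrow> (\<lambda>k. \<ominus> m k) \<in> seqs"
proof -
  assume m: "m \<in> seqs"
  have "{k. \<ominus> m k \<noteq> \<zero>} \<subseteq> {k. m k \<noteq> \<zero>}"
    by auto
  with m show ?thesis
    using finite_subset by (fastforce simp: seqs_def F_minus)
qed

lemma gr_abelian_group: "abelian_group (gr_module M F)"
proof (rule abelian_groupI)
  fix g
  assume "g \<in> carrier (gr_module M F)"
  then obtain m where m: "m \<in> seqs" "g = cls m"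
    by (auto simp: gr_carrier)
  then have "(\<lambda>k. \<ominus> m k \<oplus> m k) = (\<lambda>k. \<zero>)"
    by (simp add: fun_eq_iff seqs_carrier l_neg)
  then have "cls (\<lambda>k. \<ominus> m k) \<oplus>\<^bsub>gr_module M F\<^esub> g = \<zero>\<^bsub>gr_module M F\<^esub>"
    using m by (simp add: gr_add seqs_minus gr_zero)
  then show "\<exists>h\<in>carrier (gr_module M F). h \<oplus>\<^bsub>gr_module M F\<^esub> g = \<zero>\<^bsub>gr_module M F\<^esub>"
    using m seqs_minus by (auto simp: gr_carrier)
next
  fix g h l
  assume "g \<in> carrier (gr_module M F)" "h \<in> carrier (gr_module M F)" "l \<in> carrier (gr_module M F)"
  then obtain m m' m'' where m: "m \<in> seqs" "g = cls m" "m' \<in> seqs" "h = cls m'" "m'' \<in> seqs" "l = cls m''"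
    by (auto simp: gr_carrier)
  then have "(\<lambda>k. m k \<oplus> m' k \<oplus> m'' k) = (\<lambda>k. m k \<oplus> (m' k \<oplus> m'' k))"
    by (auto simp: fun_eq_iff seqs_carrier a_assoc)
  then show "g \<oplus>\<^bsub>gr_module M F\<^esub> h \<oplus>\<^bsub>gr_module M F\<^esub> l =
      g \<oplus>\<^bsub>gr_module M F\<^esub> (h \<oplus>\<^bsub>gr_module M F\<^esub> l)"
    using m by (simp add: gr_add seqs_add)
next
  fix g h
  assume "g \<in> carrier (gr_module M F)" "h \<in> carrier (gr_module M F)"
  then obtain m m' where m: "m \<in> seqs" "g = cls m" "m' \<in> seqs" "h = cls m'"
    by (auto simp: gr_carrier)
  then show "g \<oplus>\<^bsub>gr_module M F\<^esub> h \<in> carrier (gr_module M F)"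
    by (simp add: gr_add seqs_add gr_carrier)
  have "(\<lambda>k. m k \<oplus> m' k) = (\<lambda>k. m' k \<oplus> m k)"
    using m by (auto simp: fun_eq_iff seqs_carrier a_comm)
  then show "g \<oplus>\<^bsub>gr_module M F\<^esub> h = h \<oplus>\<^bsub>gr_module M F\<^esub> g"
    using m by (simp add: gr_add)
next
  fix g
  assume "g \<in> carrier (gr_module M F)"
  then obtain m where m: "m \<in> seqs" "g = cls m"
    by (auto simp: gr_carrier)
  then have "(\<lambda>k. \<zero> \<oplus> m k) = m"
    by (auto simp: fun_eq_iff seqs_carrier)
  then show "\<zero>\<^bsub>gr_module M F\<^esub> \<oplus>\<^bsub>gr_module M F\<^esub> g = g"
    using m by (simp add: gr_add gr_zero seqs_zero)
qed (simp add: gr_zero gr_carrier seqs_zero)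

lemma gr_uminus:
  assumes "m \<in> seqs"
  shows "\<ominus>\<^bsub>gr_module M F\<^esub> cls m = cls (\<lambda>k. \<ominus> m k)"
proof -
  interpret G: abelian_group "gr_module M F"
    by (rule gr_abelian_group)
  have "(\<lambda>k. \<ominus> m k \<oplus> m k) = (\<lambda>k. \<zero>)"
    using assms by (simp add: fun_eq_iff seqs_carrier l_neg)
  then show ?thesis
    using assms by (intro G.minus_equality) (auto simp: gr_add seqs_minus gr_zero gr_carrier)
qed

end

context filtered_left_module
begin

sublocale MF: filtered_group M F
  by (intro filtered_group.intro filtered_group_axioms.intro F_subgroup F_mono M.abelian_group_axioms)

sublocale R\<Gamma>: filtered_group "regular_module R" \<Gamma>
proof -
  have "abelian_group (regular_module R)"
    by (rule abelian_groupI) (use R.add.l_inv_ex in \<open>auto simp: regular_module_def R.a_ac\<close>)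
  moreover have "subgroup (\<Gamma> i) (add_monoid (regular_module R))" for i
    using \<Gamma>_subgroup[of i] by (simp add: subgroup_def m_inv_def regular_module_def)
  ultimately show "filtered_group (regular_module R) \<Gamma>"
    by (intro filtered_group.intro filtered_group_axioms.intro \<Gamma>_mono)
qed

lemma \<Gamma>_carrier: "r \<in> \<Gamma> i \<Longrightarrow> r \<in> carrier R"
  using subgroup.subset[OF \<Gamma>_subgroup] by auto

lemma smult_zero_left: "m \<in> carrier M \<Longrightarrow> \<zero>\<^bsub>R\<^esub> \<odot>\<^bsub>M\<^esub> m = \<zero>\<^bsub>M\<^esub>"
  using smult_l_distr[of "\<zero>\<^bsub>R\<^esub>" "\<zero>\<^bsub>R\<^esub>" m] smult_closed[of "\<zero>\<^bsub>R\<^esub>" m]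
  by (metis M.add.l_cancel_one' R.l_zero R.zero_closed)

lemma smult_zero_right: "a \<in> carrier R \<Longrightarrow> a \<odot>\<^bsub>M\<^esub> \<zero>\<^bsub>M\<^esub> = \<zero>\<^bsub>M\<^esub>"
  using smult_r_distr[of a "\<zero>\<^bsub>M\<^esub>" "\<zero>\<^bsub>M\<^esub>"] smult_closed[of a "\<zero>\<^bsub>M\<^esub>"]
  by (metis M.add.l_cancel_one' M.l_zero M.zero_closed)

lemma P_smult_left: "p \<in> R\<Gamma>.P i \<Longrightarrow> m \<in> F j \<Longrightarrow> p \<odot>\<^bsub>M\<^esub> m \<in> MF.P (i + j)"
  using F_smult[of p "i - 1" m j] MF.P_zero
  by (cases i) (auto simp: filt_pred_def regular_module_simps smult_zero_left MF.F_carrier split: nat.splits)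

lemma P_smult_right: "r \<in> \<Gamma> i \<Longrightarrow> p \<in> MF.P j \<Longrightarrow> r \<odot>\<^bsub>M\<^esub> p \<in> MF.P (i + j)"
  using F_smult[of r i p "j - 1"] MF.P_zero[of i]
  by (cases j) (auto simp: filt_pred_def smult_zero_right \<Gamma>_carrier)

text \<open>Independence of representatives: for \<open>r' = p + r\<close> and
  \<open>m' = p' + m\<close> the product differs from \<open>r m\<close> by
  \<open>r' p' + p m\<close>, and both summands lie in the preceding step of the filtration.\<close>

lemma coset_smult:
  assumes "r \<in> \<Gamma> i" "m \<in> F j"
  shows "(\<Union>r'\<in>R\<Gamma>.coset i r. \<Union>m'\<in>MF.coset j m. MF.P (i + j) +>\<^bsub>M\<^esub> (r' \<odot>\<^bsub>M\<^esub> m')) =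
    MF.coset (i + j) (r \<odot>\<^bsub>M\<^esub> m)"
proof -
  have "MF.P (i + j) +>\<^bsub>M\<^esub> (r' \<odot>\<^bsub>M\<^esub> m') = MF.coset (i + j) (r \<odot>\<^bsub>M\<^esub> m)"
    if r': "r' \<in> R\<Gamma>.coset i r" and m': "m' \<in> MF.coset j m" for r' m'
  proof -
    obtain p where p: "p \<in> R\<Gamma>.P i" "r' = p \<oplus>\<^bsub>R\<^esub> r"
      using R\<Gamma>.coset_memD[OF r'] by (auto simp: regular_module_simps)
    obtain p' where p': "p' \<in> MF.P j" "m' = p' \<oplus>\<^bsub>M\<^esub> m"
      using MF.coset_memD[OF m'] by auto
    have c: "p \<in> carrier R" "r \<in> carrier R" "r' \<in> carrier R" "p' \<in> carrier M" "m \<in> carrier M" "m' \<in> F j"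
      "r' \<in> \<Gamma> i"
      using assms p p' R\<Gamma>.P_subset[of i] MF.P_subset[of j] \<Gamma>_carrier MF.F_carrier
        R\<Gamma>.F_add[of p i r] MF.F_add[of p' j m]
      by (auto simp: regular_module_simps)
    have "r' \<odot>\<^bsub>M\<^esub> m' = r' \<odot>\<^bsub>M\<^esub> p' \<oplus>\<^bsub>M\<^esub> (p \<odot>\<^bsub>M\<^esub> m \<oplus>\<^bsub>M\<^esub> r \<odot>\<^bsub>M\<^esub> m)"
      using c by (simp add: p'(2) smult_r_distr) (simp add: p(2) smult_l_distr)
    also have "\<dots> = (r' \<odot>\<^bsub>M\<^esub> p' \<oplus>\<^bsub>M\<^esub> p \<odot>\<^bsub>M\<^esub> m) \<oplus>\<^bsub>M\<^esub> r \<odot>\<^bsub>M\<^esub> m"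
      using c by (simp add: M.a_assoc smult_closed)
    finally have "r' \<odot>\<^bsub>M\<^esub> m' \<in> MF.coset (i + j) (r \<odot>\<^bsub>M\<^esub> m)"
      using MF.coset_memI[OF subgroup.m_closed[OF MF.P_subgroup P_smult_right[OF c(7) p'(1)]
          P_smult_left[OF p(1) assms(2)]], of "r \<odot>\<^bsub>M\<^esub> m"]
      by simp
    from MF.coset_eqI[OF _ this] show ?thesis
      using c by (simp add: MF.coset_def smult_closed)
  qed
  then have "(\<Union>r'\<in>R\<Gamma>.coset i r. \<Union>m'\<in>MF.coset j m. MF.P (i + j) +>\<^bsub>M\<^esub> (r' \<odot>\<^bsub>M\<^esub> m')) =
      (\<Union>r'\<in>R\<Gamma>.coset i r. \<Union>m'\<in>MF.coset j m. MF.coset (i + j) (r \<odot>\<^bsub>M\<^esub> m))"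
    by (intro SUP_cong refl)
  also have "\<dots> = MF.coset (i + j) (r \<odot>\<^bsub>M\<^esub> m)"
  proof -
    have "r \<in> R\<Gamma>.coset i r" "m \<in> MF.coset j m"
      using assms \<Gamma>_carrier MF.F_carrier
      by (auto intro!: R\<Gamma>.coset_self MF.coset_self simp: regular_module_simps)
    then have "R\<Gamma>.coset i r \<noteq> {}" "MF.coset j m \<noteq> {}"
      by auto
    then show ?thesis
      by simp
  qed
  finally show ?thesis .
qed

definition conv :: "(nat \<Rightarrow> 'r) \<Rightarrow> (nat \<Rightarrow> 'm) \<Rightarrow> nat \<Rightarrow> 'm" where
  "conv r m k = (\<Oplus>\<^bsub>M\<^esub>i\<in>{..k}. r i \<odot>\<^bsub>M\<^esub> m (k - i))"

lemma gr_smult: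
  assumes r: "r \<in> R\<Gamma>.seqs" and m: "m \<in> MF.seqs"
  shows "R\<Gamma>.cls r \<odot>\<^bsub>gr_module M F\<^esub> MF.cls m = MF.cls (conv r m)" and "conv r m \<in> MF.seqs"
proof -
  have r': "r i \<in> \<Gamma> i" and m': "m k \<in> F k" for i k
    using r m by (auto simp: R\<Gamma>.seqs_def MF.seqs_def)
  have trm: "r i \<odot>\<^bsub>M\<^esub> m (k - i) \<in> F k" if "i \<le> k" for i k
    using F_smult[OF r'[of i] m'[of "k - i"]] that by simp
  have "(R\<Gamma>.cls r \<odot>\<^bsub>gr_module M F\<^esub> MF.cls m) k = MF.cls (conv r m) k" for k
  proof -
    have "(\<Union>r'\<in>R\<Gamma>.cls r i. \<Union>m'\<in>MF.cls m (k - i). MF.P k +>\<^bsub>M\<^esub> (r' \<odot>\<^bsub>M\<^esub> m')) =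
        MF.coset k (r i \<odot>\<^bsub>M\<^esub> m (k - i))" if "i \<le> k" for i
      using coset_smult[OF r'[of i] m'[of "k - i"]] that by (simp add: R\<Gamma>.cls_def MF.cls_def)
    then have "(R\<Gamma>.cls r \<odot>\<^bsub>gr_module M F\<^esub> MF.cls m) k =
        finprod (gr_piece M F k) (\<lambda>i. MF.coset k (r i \<odot>\<^bsub>M\<^esub> m (k - i))) {..k}"
      using trm by (simp add: gr_module_def)
        (intro comm_monoid.finprod_cong'[OF MF.comm_monoid_gr_piece], auto simp: MF.gr_piece_carrier)
    then show ?thesis
      using MF.gr_piece_finprod[of "{..k}" "\<lambda>i. r i \<odot>\<^bsub>M\<^esub> m (k - i)" k] trm
      by (simp add: MF.cls_def conv_def)
  qed
  then show "R\<Gamma>.cls r \<odot>\<^bsub>gr_module M F\<^esub> MF.cls m = MF.cls (conv r m)"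
    by auto
  have "conv r m k \<in> F k" for k
    using MF.gr_piece_finprod[of "{..k}" "\<lambda>i. r i \<odot>\<^bsub>M\<^esub> m (k - i)" k] trm by (simp add: conv_def)
  moreover have "finite {k. conv r m k \<noteq> \<zero>\<^bsub>M\<^esub>}"
  proof -
    have "finite {i. r i \<noteq> \<zero>\<^bsub>R\<^esub>}" "finite {k. m k \<noteq> \<zero>\<^bsub>M\<^esub>}"
      using r m by (auto simp: R\<Gamma>.seqs_def MF.seqs_def regular_module_simps)
    then obtain a b where "\<forall>i\<in>{i. r i \<noteq> \<zero>\<^bsub>R\<^esub>}. i \<le> a" "\<forall>k\<in>{k. m k \<noteq> \<zero>\<^bsub>M\<^esub>}. k \<le> b"
      unfolding finite_nat_set_iff_bounded_le by blast
    then have ab: "\<And>i. r i \<noteq> \<zero>\<^bsub>R\<^esub> \<Longrightarrow> i \<le> a" "\<And>k. m k \<noteq> \<zero>\<^bsub>M\<^esub> \<Longrightarrow> k \<le> b"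
      by auto
    have "conv r m k = \<zero>\<^bsub>M\<^esub>" if "k > a + b" for k
    proof -
      have "r i \<odot>\<^bsub>M\<^esub> m (k - i) = \<zero>\<^bsub>M\<^esub>" if "i \<le> k" for i
      proof (cases "r i = \<zero>\<^bsub>R\<^esub>")
        case True
        then show ?thesis
          using MF.seqs_carrier[OF m] by (simp add: smult_zero_left)
      next
        case False
        then have "k - i > b"
          using ab(1)[of i] \<open>k > a + b\<close> by linarith
        then have "m (k - i) = \<zero>\<^bsub>M\<^esub>"
          using ab(2)[of "k - i"] by auto
        then show ?thesis
          using \<Gamma>_carrier[OF r'] by (simp add: smult_zero_right)
      qed
      then have "conv r m k = (\<Oplus>\<^bsub>M\<^esub>i\<in>{..k}. \<zero>\<^bsub>M\<^esub>)"
        unfolding conv_def by (intro M.finsum_cong') auto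
      then show ?thesis
        by simp
    qed
    then have "{k. conv r m k \<noteq> \<zero>\<^bsub>M\<^esub>} \<subseteq> {..a + b}"
      by (auto simp: not_less[symmetric])
    then show ?thesis
      by (rule finite_subset) simp
  qed
  ultimately show "conv r m \<in> MF.seqs"
    by (simp add: MF.seqs_def)
qed

section \<open>Submodules and generators of the graded module\<close>

lemma gr_ring_carrier: "carrier (gr_ring R \<Gamma>) = R\<Gamma>.cls ` R\<Gamma>.seqs"
  by (simp add: gr_ring_def Let_def R\<Gamma>.gr_carrier)

text \<open>The \<open>V k\<close> need not be contained in the \<open>F k\<close>; this freedom
  allows a shifted second filtration in the role of \<open>V\<close>.\<close>

lemma gr_submoduleI:
  assumes V: "\<And>k. subgroup (V k) (add_monoid M)"
    and smult: "\<And>i j a m. a \<in> \<Gamma> i \<Longrightarrow> m \<in> V j \<Longrightarrow> a \<odot>\<^bsub>M\<^esub> m \<in> V (i + j)"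
  shows "Module.submodule (MF.cls ` {m \<in> MF.seqs. \<forall>k. m k \<in> V k}) (gr_ring R \<Gamma>) (gr_module M F)"
    (is "Module.submodule ?N _ _")
proof (intro Module.submodule.intro subgroup.intro submodule_axioms.intro)
  have V_add: "a \<oplus>\<^bsub>M\<^esub> b \<in> V k" if "a \<in> V k" "b \<in> V k" for a b k
    using subgroup.m_closed[OF V that] by simp
  have V_zero: "\<zero>\<^bsub>M\<^esub> \<in> V k" for k
    using subgroup.one_closed[OF V] by simp
  have V_minus: "\<ominus>\<^bsub>M\<^esub> a \<in> V k" if "a \<in> V k" for a k
    using subgroup.m_inv_closed[OF V that] by (simp add: a_inv_def)
  show "?N \<subseteq> carrier (add_monoid (gr_module M F))"
    by (auto simp: MF.gr_carrier)
  show "g \<otimes>\<^bsub>add_monoid (gr_module M F)\<^esub> h \<in> ?N" if "g \<in> ?N" "h \<in> ?N" for g h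
    using that by (auto simp: MF.gr_add MF.seqs_add V_add)
  show "\<one>\<^bsub>add_monoid (gr_module M F)\<^esub> \<in> ?N"
    using MF.seqs_zero V_zero by (auto simp: MF.gr_zero)
  show "inv\<^bsub>add_monoid (gr_module M F)\<^esub> g \<in> ?N" if "g \<in> ?N" for g
    using that MF.gr_uminus by (auto simp: a_inv_def[symmetric] MF.seqs_minus V_minus)
  show "a \<odot>\<^bsub>gr_module M F\<^esub> g \<in> ?N" if a: "a \<in> carrier (gr_ring R \<Gamma>)" and g: "g \<in> ?N" for a g
  proof -
    obtain r m where r: "r \<in> R\<Gamma>.seqs" "a = R\<Gamma>.cls r" and m: "m \<in> MF.seqs" "g = MF.cls m" "\<And>k. m k \<in> V k"
      using a g by (auto simp: gr_ring_carrier)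
    have trm: "r i \<odot>\<^bsub>M\<^esub> m (k - i) \<in> V k" if "i \<le> k" for i k
      using smult[of "r i" i "m (k - i)" "k - i"] r(1) m(3) that by (simp add: R\<Gamma>.seqs_def)
    have "(\<Oplus>\<^bsub>M\<^esub>i\<in>S. r i \<odot>\<^bsub>M\<^esub> m (k - i)) \<in> V k" if "finite S" "S \<subseteq> {..k}" for S k
      using that
    proof (induction S rule: finite_induct)
      case empty
      then show ?case
        by (simp add: V_zero)
    next
      case (insert i S)
      then show ?case
        using trm subgroup.subset[OF V[of k]] by (subst M.finsum_insert) (auto intro!: V_add)
    qed
    then have "\<forall>k. conv r m k \<in> V k"
      by (simp add: conv_def)
    then show ?thesis
      using gr_smult[OF r(1) m(1)] r m by auto
  qed
qed

lemma gr_carrier_submodule: "Module.submodule (carrier (gr_module M F)) (gr_ring R \<Gamma>) (gr_module M F)"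
proof -
  have "{m \<in> MF.seqs. \<forall>k. m k \<in> F k} = MF.seqs"
    by (auto simp: MF.seqs_def)
  then show ?thesis
    using gr_submoduleI[of F, OF F_subgroup F_smult] by (simp add: MF.gr_carrier)
qed

text \<open>The class of \<open>m0\<close> in degree 0 generates, because the component of degree
  \<open>k\<close> of any element is a multiple of \<open>m0\<close> by an element of the step
  \<open>k\<close> of the ring.\<close>

lemma gr_fg_if_cyclic:
  assumes m0: "m0 \<in> F 0" and cyclic: "\<And>k. F k = (\<lambda>r. r \<odot>\<^bsub>M\<^esub> m0) ` \<Gamma> k"
  shows "fg_module (gr_ring R \<Gamma>) (gr_module M F)"
  unfolding fg_module_def
proof (intro exI conjI)
  define d where "d = (\<lambda>k. if k = (0::nat) then m0 else \<zero>\<^bsub>M\<^esub>)"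
  have d: "d \<in> MF.seqs"
    using m0 MF.F_zero by (auto simp: MF.seqs_def d_def)
  show "{MF.cls d} \<subseteq> carrier (gr_module M F)"
    using d by (simp add: MF.gr_carrier)
  have "carrier (gr_module M F) \<subseteq> N"
    if N: "Module.submodule N (gr_ring R \<Gamma>) (gr_module M F)" "{MF.cls d} \<subseteq> N" for N
  proof
    fix g
    assume "g \<in> carrier (gr_module M F)"
    then obtain m where m: "m \<in> MF.seqs" "g = MF.cls m"
      by (auto simp: MF.gr_carrier)
    have "\<exists>r. r \<in> \<Gamma> k \<and> m k = r \<odot>\<^bsub>M\<^esub> m0 \<and> (m k = \<zero>\<^bsub>M\<^esub> \<longrightarrow> r = \<zero>\<^bsub>R\<^esub>)" for k
    proof (cases "m k = \<zero>\<^bsub>M\<^esub>")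
      case True
      then show ?thesis
        using R\<Gamma>.F_zero[of k] m0 by (auto simp: regular_module_simps smult_zero_left MF.F_carrier)
    next
      case False
      then show ?thesis
        using m(1) cyclic by (auto simp: MF.seqs_def)
    qed
    then obtain r where r: "\<And>k. r k \<in> \<Gamma> k" "\<And>k. m k = r k \<odot>\<^bsub>M\<^esub> m0"
        "\<And>k. m k = \<zero>\<^bsub>M\<^esub> \<Longrightarrow> r k = \<zero>\<^bsub>R\<^esub>"
      by metis
    have "finite {k. r k \<noteq> \<zero>\<^bsub>R\<^esub>}"
      using m(1) r(3) by (auto simp: MF.seqs_def elim: rev_finite_subset)
    then have rs: "r \<in> R\<Gamma>.seqs"
      using r(1) by (simp add: R\<Gamma>.seqs_def regular_module_simps)
    have "conv r d k = m k" for k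
    proof -
      have "conv r d k = (\<Oplus>\<^bsub>M\<^esub>i\<in>{..k}. if i = k then m k else \<zero>\<^bsub>M\<^esub>)"
        unfolding conv_def d_def using \<Gamma>_carrier[OF r(1)] r(2)[symmetric] MF.seqs_carrier[OF m(1)]
        by (intro M.finsum_cong') (auto simp: smult_zero_right)
      also have "\<dots> = m k"
        using M.add.finprod_singleton_swap[of k "{..k}" "\<lambda>_. m k"] MF.seqs_carrier[OF m(1)] by simp
      finally show ?thesis .
    qed
    then have "R\<Gamma>.cls r \<odot>\<^bsub>gr_module M F\<^esub> MF.cls d = g"
      using gr_smult(1)[OF rs d] m(2) by (simp add: fun_eq_iff MF.cls_def)
    moreover have "R\<Gamma>.cls r \<in> carrier (gr_ring R \<Gamma>)"
      using rs by (simp add: gr_ring_carrier)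
    ultimately show "g \<in> N"
      using Module.submodule.smult_closed[OF N(1)] N(2) by blast
  qed
  then show "\<Inter> {N. Module.submodule N (gr_ring R \<Gamma>) (gr_module M F) \<and> {MF.cls d} \<subseteq> N} =
      carrier (gr_module M F)"
    using gr_carrier_submodule \<open>{MF.cls d} \<subseteq> carrier (gr_module M F)\<close> by blast
qed simp

text \<open>
  The elements of the graded module with representatives in \<open>F' (k + c)\<close> in every degree \<open>k\<close>
  form a submodule, which for large \<open>c\<close> contains a given finite set of generators.
\<close>

lemma good_filtration_le_shift:
  assumes fg: "fg_module (gr_ring R \<Gamma>) (gr_module M F)"
    and F': "filtered_left_module R M \<Gamma> F'"
  shows "\<exists>c. \<forall>k. F k \<subseteq> F' (k + c)"
proof -
  interpret F': filtered_left_module R M \<Gamma> F'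
    by (rule F')
  obtain S where S: "finite S" "S \<subseteq> carrier (gr_module M F)"
    "\<Inter> {N. Module.submodule N (gr_ring R \<Gamma>) (gr_module M F) \<and> S \<subseteq> N} = carrier (gr_module M F)"
    using fg unfolding fg_module_def by blast
  have "\<forall>g\<in>S. \<exists>m. m \<in> MF.seqs \<and> g = MF.cls m"
    using S(2) by (auto simp: MF.gr_carrier)
  then obtain m where m: "\<And>g. g \<in> S \<Longrightarrow> m g \<in> MF.seqs" "\<And>g. g \<in> S \<Longrightarrow> g = MF.cls (m g)"
    by metis
  \<comment> \<open>The non-zero components of the generators. They are finitely many and
    \<open>F'\<close> exhausts the module, so one step \<open>c\<close> contains them all.\<close>
  define Z where "Z = (\<Union>g\<in>S. m g ` {k. m g k \<noteq> \<zero>\<^bsub>M\<^esub>})"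
  have "finite Z"
    using S(1) m(1) by (auto simp: Z_def MF.seqs_def)
  moreover have "\<forall>z\<in>Z. \<exists>c. z \<in> F' c"
  proof
    fix z
    assume "z \<in> Z"
    then have "z \<in> carrier M"
      using m(1) MF.F_carrier by (auto simp: Z_def MF.seqs_def)
    then show "\<exists>c. z \<in> F' c"
      using F'.F_union by auto
  qed
  ultimately have "\<exists>c. Z \<subseteq> F' c"
  proof (induction Z rule: finite_induct)
    case (insert z Z)
    then obtain c c' where "Z \<subseteq> F' c" "z \<in> F' c'"
      by auto
    then have "insert z Z \<subseteq> F' (max c c')"
      using F'.MF.F_le[of c "max c c'"] F'.MF.F_le[of c' "max c c'"] by auto
    then show ?case
      by blast
  qed simp
  then obtain c where c: "Z \<subseteq> F' c"
    by blast
  let ?N = "MF.cls ` {m \<in> MF.seqs. \<forall>k. m k \<in> F' (k + c)}"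
  have "Module.submodule ?N (gr_ring R \<Gamma>) (gr_module M F)"
    using F'.F_smult by (intro gr_submoduleI F'.F_subgroup) (simp add: add.assoc)
  moreover have "S \<subseteq> ?N"
  proof
    fix g
    assume g: "g \<in> S"
    have "m g k \<in> F' (k + c)" for k
    proof (cases "m g k = \<zero>\<^bsub>M\<^esub>")
      case False
      then have "m g k \<in> F' c"
        using c g by (auto simp: Z_def)
      then show ?thesis
        using F'.MF.F_le[of c "k + c"] by auto
    qed (simp add: F'.MF.F_zero)
    then show "g \<in> ?N"
      using m[OF g] by auto
  qed
  ultimately have N: "carrier (gr_module M F) \<subseteq> ?N"
    using S(3) by blast
  \<comment> \<open>Placed in degree \<open>k\<close>, the element \<open>v\<close> has a class in
    the submodule, so it agrees with an element of \<open>F' (k + c)\<close> up to the preceding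
    step of \<open>F\<close>. Induction on \<open>k\<close> then absorbs that remainder.\<close>
  have rep: "\<exists>p\<in>MF.P k. \<exists>m'\<in>F' (k + c). v = p \<oplus>\<^bsub>M\<^esub> m'" if v: "v \<in> F k" for k v
  proof -
    define d where "d = (\<lambda>j. if j = k then v else \<zero>\<^bsub>M\<^esub>)"
    have "d \<in> MF.seqs"
      using v MF.F_zero by (auto simp: MF.seqs_def d_def)
    then have "MF.cls d \<in> ?N"
      using N by (auto simp: MF.gr_carrier)
    then obtain m' where m': "m' k \<in> F' (k + c)" "MF.cls d = MF.cls m'"
      by auto
    have "MF.coset k v = MF.coset k (m' k)"
      using m'(2) by (metis MF.cls_def d_def)
    then have "v \<in> MF.coset k (m' k)"
      using MF.coset_self[of v k] MF.F_carrier[OF v] by simp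
    then show ?thesis
      using MF.coset_memD m'(1) by blast
  qed
  have "F k \<subseteq> F' (k + c)" for k
  proof (induction k)
    case 0
    show ?case
    proof
      fix v
      assume "v \<in> F 0"
      then obtain m' where "m' \<in> F' (0 + c)" "v = \<zero>\<^bsub>M\<^esub> \<oplus>\<^bsub>M\<^esub> m'"
        using rep[of v 0] by (auto simp: filt_pred_def)
      then show "v \<in> F' (0 + c)"
        using F'.MF.F_carrier by auto
    qed
  next
    case (Suc k)
    show ?case
    proof
      fix v
      assume "v \<in> F (Suc k)"
      then obtain p m' where p: "p \<in> F k" "m' \<in> F' (Suc k + c)" "v = p \<oplus>\<^bsub>M\<^esub> m'"
        using rep[of v "Suc k"] by (auto simp: filt_pred_def)
      then have "p \<in> F' (Suc k + c)"
        using Suc F'.MF.F_le[of "k + c" "Suc k + c"] by auto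
      then show "v \<in> F' (Suc k + c)"
        using p F'.MF.F_add by simp
    qed
  qed
  then show ?thesis
    by blast
qed

end

section \<open>The dimension of a filtered module\<close>

lemma (in left_module) restrict_scalars_vectorspace:
  fixes h :: "'k::field \<Rightarrow> 'r"
  assumes h: "\<And>a. h a \<in> carrier R" "\<And>a b. h (a + b) = h a \<oplus>\<^bsub>R\<^esub> h b"
    "\<And>a b. h (a * b) = h a \<otimes>\<^bsub>R\<^esub> h b" "h 1 = \<one>\<^bsub>R\<^esub>"
  shows "vectorspace class_ring (restrict_scalars h M)"
proof (rule vs_criteria)
  show "field (class_ring :: 'k ring)"
    by (rule class_field)
  show "\<forall>v\<in>carrier (restrict_scalars h M). \<exists>w\<in>carrier (restrict_scalars h M).
      v \<oplus>\<^bsub>restrict_scalars h M\<^esub> w = \<zero>\<^bsub>restrict_scalars h M\<^esub>"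
    using M.r_neg by (auto simp: restrict_scalars_def)
qed (auto simp: restrict_scalars_def M.a_ac smult_closed smult_l_distr smult_r_distr smult_assoc
    smult_one h)

lemma subspace_imp_subgroup:
  fixes M :: "('r, 'm, 'e) module_scheme" and h :: "'k::field \<Rightarrow> 'r"
  assumes M: "abelian_group M" and W: "VectorSpace.subspace class_ring W (restrict_scalars h M)"
  shows "subgroup W (add_monoid M)"
proof -
  interpret V: vectorspace class_ring "restrict_scalars h M"
    using W by (rule VectorSpace.subspace.vs)
  interpret M: abelian_group M
    by (rule M)
  have sub: "LinearCombinations.submodule class_ring W (restrict_scalars h M)"
    using W by (rule VectorSpace.subspace.submod)
  note W_props = LinearCombinations.submodule.subset[OF sub]
    LinearCombinations.submodule.m_closed[OF sub] LinearCombinations.submodule.zero_closed[OF sub]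
    LinearCombinations.submodule.smult_closed[OF sub]
  show ?thesis
  proof (rule M.add.subgroupI)
    show "W \<subseteq> carrier M" "W \<noteq> {}"
      using W_props(1,3) by (auto simp: restrict_scalars_def)
    fix a
    assume a: "a \<in> W"
    have carrier: "carrier (restrict_scalars h M) = carrier M"
      by (simp add: restrict_scalars_def)
    have one: "(1 :: 'k) \<odot>\<^bsub>restrict_scalars h M\<^esub> a = a"
      using V.smult_one[of a] a W_props(1) by auto
    have "((- 1) + 1 :: 'k) \<odot>\<^bsub>restrict_scalars h M\<^esub> a = \<zero>\<^bsub>restrict_scalars h M\<^esub>"
      using V.smult_l_null[of a] a W_props(1) by auto
    moreover have "((- 1) + 1 :: 'k) \<odot>\<^bsub>restrict_scalars h M\<^esub> a =
        (- 1) \<odot>\<^bsub>restrict_scalars h M\<^esub> a \<oplus>\<^bsub>restrict_scalars h M\<^esub> 1 \<odot>\<^bsub>restrict_scalars h M\<^esub> a"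
      using V.smult_l_distr[of "- 1" 1 a] a W_props(1) by auto
    ultimately have "((- 1) \<odot>\<^bsub>restrict_scalars h M\<^esub> a) \<oplus>\<^bsub>M\<^esub> a = \<zero>\<^bsub>M\<^esub>"
      unfolding one by (simp add: restrict_scalars_def)
    moreover have "(- 1) \<odot>\<^bsub>restrict_scalars h M\<^esub> a \<in> W"
      using W_props(4)[of "- 1" a] a by simp
    ultimately show "\<ominus>\<^bsub>M\<^esub> a \<in> W"
      using M.minus_equality[of "(- 1) \<odot>\<^bsub>restrict_scalars h M\<^esub> a" a] a W_props(1)
      by (simp add: carrier subset_iff)
  next
    fix a b
    assume "a \<in> W" "b \<in> W"
    then show "a \<oplus>\<^bsub>M\<^esub> b \<in> W"
      using W_props(2)[of a b] by (simp add: restrict_scalars_def)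
  qed
qed

lemma module_filtration_imp_filtered:
  assumes M: "left_module R M"
    and \<Gamma>: "\<And>i. subgroup (\<Gamma> i) (add_monoid R)" "\<And>i. \<Gamma> i \<subseteq> \<Gamma> (Suc i)"
    and F: "module_filtration h \<Gamma> M F"
  shows "filtered_left_module R M \<Gamma> F"
proof (intro filtered_left_module.intro filtered_left_module_axioms.intro M \<Gamma>)
  have "abelian_group M"
    using M by (rule left_module.axioms(2))
  then show "subgroup (F k) (add_monoid M)" for k
    using F unfolding module_filtration_def by (intro subspace_imp_subgroup) auto
qed (use F in \<open>auto simp: module_filtration_def\<close>)

lemma filt_vs_dim_mono:
  assumes W: "VectorSpace.subspace class_ring (F s) (restrict_scalars h M)"
      "vectorspace.fin_dim class_ring (filt_vs h M F s)"
    and W': "VectorSpace.subspace class_ring (F' t) (restrict_scalars h M)"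
      "vectorspace.fin_dim class_ring (filt_vs h M F' t)"
    and "F s \<subseteq> F' t"
  shows "vectorspace.dim class_ring (filt_vs h M F s) \<le> vectorspace.dim class_ring (filt_vs h M F' t)"
proof -
  interpret V: vectorspace class_ring "restrict_scalars h M"
    using W(1) by (rule VectorSpace.subspace.vs)
  interpret W: vectorspace class_ring "filt_vs h M F s"
    using V.subspace_is_vs[OF W(1)] by (simp add: filt_vs_def)
  interpret W': vectorspace class_ring "filt_vs h M F' t"
    using V.subspace_is_vs[OF W'(1)] by (simp add: filt_vs_def)
  obtain B where B: "finite B" "W.basis B"
    using W.finite_basis_exists[OF W(2)] by blast
  have sub: "B \<subseteq> F s"
    using B(2) unfolding W.basis_def by (simp add: filt_vs_def)
  have "\<not> W.lin_dep B"
    using B by (simp add: W.basis_def)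
  then have "\<not> V.lin_dep B"
    using V.span_li_not_depend(2)[OF sub VectorSpace.subspace.submod[OF W(1)]] by (simp add: filt_vs_def)
  then have "\<not> W'.lin_dep B"
    using V.span_li_not_depend(2)[OF _ VectorSpace.subspace.submod[OF W'(1)], of B] sub assms(5)
    by (simp add: filt_vs_def)
  then have "card B \<le> W'.dim"
    using W'.li_le_dim(2)[OF W'(2)] sub assms(5) by (auto simp: filt_vs_def)
  then show ?thesis
    using W.dim_basis[OF B] by simp
qed

lemma poly_map_poly_of_rat:
  "poly (map_poly real_of_rat p) (real n) = real_of_rat (poly p (rat_of_nat n))"
  by (induction p) (simp_all add: map_poly_pCons of_rat_add of_rat_mult)

text \<open>If the degree of \<open>p\<close> were larger, subtracting the shifted \<open>r\<close>
  would not change the leading coefficient. It is positive as the values of \<open>p\<close> are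
  non-negative, yet the difference is eventually non-positive. The argument is carried out over the
  reals, where a positive leading coefficient bounds the values from below.\<close>

lemma degree_le_if_eventually_le:
  fixes p r :: "rat poly"
  assumes "\<forall>\<^sub>F s in sequentially. 0 \<le> poly p (rat_of_nat s)"
    and "\<forall>\<^sub>F s in sequentially. poly p (rat_of_nat s) \<le> poly r (rat_of_nat (s + c))"
  shows "Polynomial.degree p \<le> Polynomial.degree r"
proof (rule ccontr)
  assume *: "\<not> ?thesis"
  define p' where "p' = map_poly real_of_rat p"
  define r' where "r' = map_poly real_of_rat (pcompose r [:of_nat c, 1:])"
  have deg: "Polynomial.degree p' = Polynomial.degree p" "Polynomial.degree r' = Polynomial.degree r"
    by (simp_all add: p'_def r'_def degree_map_poly degree_pcompose)
  have ev: "\<forall>\<^sub>F s in sequentially. 0 \<le> poly p' (real s) \<and> poly p' (real s) \<le> poly r' (real s)"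
    using assms
  proof eventually_elim
    case (elim s)
    then show ?case
      unfolding p'_def r'_def poly_map_poly_of_rat
      by (simp add: poly_pcompose add.commute of_rat_less_eq)
  qed
  have bound: "Polynomial.lead_coeff f \<le> 0"
    if f: "\<forall>\<^sub>F s in sequentially. poly f (real s) \<le> 0" for f :: "real poly"
  proof (rule ccontr)
    assume lc: "\<not> Polynomial.lead_coeff f \<le> 0"
    then obtain b where b: "\<And>t. t \<ge> b \<Longrightarrow> poly f t \<ge> Polynomial.lead_coeff f"
      using poly_pinfty_gt_lc[of f] by auto
    have "\<forall>\<^sub>F s in sequentially. real s \<ge> b"
      using filterlim_real_sequentially by (simp add: filterlim_at_top)
    with f have "\<forall>\<^sub>F s :: nat in sequentially. False"
      by eventually_elim (use b lc in fastforce)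
    then show False
      by simp
  qed
  have "Polynomial.lead_coeff (- p') \<le> 0"
    by (rule bound) (use ev in \<open>auto elim: eventually_mono\<close>)
  moreover have "p' \<noteq> 0"
    using * deg by auto
  ultimately have "Polynomial.lead_coeff p' > 0"
    by (simp add: less_le)
  moreover have "Polynomial.lead_coeff (p' - r') \<le> 0"
    by (rule bound) (use ev in \<open>auto elim: eventually_mono\<close>)
  moreover have "Polynomial.lead_coeff (p' - r') = Polynomial.lead_coeff p'"
    using * deg by (metis degree_add_eq_left diff_conv_add_uminus degree_minus coeff_diff coeff_eq_0
        diff_zero not_le)
  ultimately show False
    by simp
qed

text \<open>Evaluates the definite description in \<open>module_dim\<close> from a single good
  filtration: shifted inclusions in both directions bound the degrees of any two Hilbert polynomials
  against each other.\<close>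

lemma module_dim_eqI:
  fixes h :: "'k::field \<Rightarrow> 'r" and H :: "rat poly"
  assumes M: "left_module R M"
    and \<Gamma>: "\<And>i. subgroup (\<Gamma> i) (add_monoid R)" "\<And>i. \<Gamma> i \<subseteq> \<Gamma> (Suc i)"
    and good: "good_filtration h R \<Gamma> M F"
    and H: "\<forall>\<^sub>F s in sequentially.
      rat_of_nat (vectorspace.dim class_ring (filt_vs h M F s)) = poly H (rat_of_nat s)"
  shows "module_dim h R \<Gamma> M = Polynomial.degree H"
  unfolding module_dim_def
proof (rule the_equality)
  show "\<exists>F. \<exists>H' :: rat poly. good_filtration h R \<Gamma> M F \<and> (\<forall>\<^sub>F s in sequentially.
      rat_of_nat (vectorspace.dim class_ring (filt_vs h M F s)) = poly H' (rat_of_nat s)) \<and>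
      Polynomial.degree H' = Polynomial.degree H"
    using good H by blast
next
  have le: "Polynomial.degree H1 \<le> Polynomial.degree H2"
    if good: "good_filtration h R \<Gamma> M F1" "good_filtration h R \<Gamma> M F2"
      and H: "\<forall>\<^sub>F s in sequentially.
        rat_of_nat (vectorspace.dim class_ring (filt_vs h M F1 s)) = poly H1 (rat_of_nat s)"
        "\<forall>\<^sub>F s in sequentially.
        rat_of_nat (vectorspace.dim class_ring (filt_vs h M F2 s)) = poly H2 (rat_of_nat s)"
    for F1 F2 and H1 H2 :: "rat poly"
  proof -
    have F: "module_filtration h \<Gamma> M F1" "module_filtration h \<Gamma> M F2"
      and fg: "fg_module (gr_ring R \<Gamma>) (gr_module M F1)"
      using good by (auto simp: good_filtration_def)
    obtain c where c: "\<And>k. F1 k \<subseteq> F2 (k + c)"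
      using filtered_left_module.good_filtration_le_shift[OF
          module_filtration_imp_filtered[OF M \<Gamma> F(1)] fg module_filtration_imp_filtered[OF M \<Gamma> F(2)]]
      by blast
    have dim: "vectorspace.dim class_ring (filt_vs h M F1 s) \<le>
        vectorspace.dim class_ring (filt_vs h M F2 (s + c))" for s
      using F c by (intro filt_vs_dim_mono) (auto simp: module_filtration_def)
    have "\<forall>\<^sub>F s in sequentially. rat_of_nat (vectorspace.dim class_ring (filt_vs h M F2 (s + c))) =
        poly H2 (rat_of_nat (s + c))"
      by (rule eventually_compose_filterlim[OF H(2) filterlim_add_const_nat_at_top])
    with H(1) have "\<forall>\<^sub>F s in sequentially. poly H1 (rat_of_nat s) \<le> poly H2 (rat_of_nat (s + c))"
    proof eventually_elim
      case (elim s)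
      then show ?case
        using dim[of s] by (metis of_nat_le_iff)
    qed
    moreover have "\<forall>\<^sub>F s in sequentially. 0 \<le> poly H1 (rat_of_nat s)"
      using H(1) by eventually_elim (metis of_nat_0_le_iff)
    ultimately show ?thesis
      by (intro degree_le_if_eventually_le)
  qed
  fix d
  assume "\<exists>F. \<exists>H :: rat poly. good_filtration h R \<Gamma> M F \<and> (\<forall>\<^sub>F s in sequentially.
      rat_of_nat (vectorspace.dim class_ring (filt_vs h M F s)) = poly H (rat_of_nat s)) \<and>
      Polynomial.degree H = d"
  then obtain F' and H' :: "rat poly" where good': "good_filtration h R \<Gamma> M F'"
    and H': "\<forall>\<^sub>F s in sequentially.
      rat_of_nat (vectorspace.dim class_ring (filt_vs h M F' s)) = poly H' (rat_of_nat s)"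
    and d: "Polynomial.degree H' = d"
    by blast
  from le[OF good good' H H'] le[OF good' good H' H] d show "d = Polynomial.degree H"
    by simp
qed

lemma (in vectorspace) dim_eq_card_if_basis_family:
  assumes J: "finite J" and b: "\<And>j. j \<in> J \<Longrightarrow> b j \<in> carrier V"
    and gen: "\<And>v. v \<in> carrier V \<Longrightarrow> \<exists>c. (\<forall>j. c j \<in> carrier K) \<and> v = (\<Oplus>\<^bsub>V\<^esub>j\<in>J. c j \<odot>\<^bsub>V\<^esub> b j)"
    and indep: "\<And>c j. (\<And>j. c j \<in> carrier K) \<Longrightarrow> (\<Oplus>\<^bsub>V\<^esub>j\<in>J. c j \<odot>\<^bsub>V\<^esub> b j) = \<zero>\<^bsub>V\<^esub> \<Longrightarrow>
      j \<in> J \<Longrightarrow> c j = \<zero>\<^bsub>K\<^esub>"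
  shows "fin_dim" and "dim = card J"
proof -
  have b': "b \<in> J \<rightarrow> carrier V"
    using b by auto
  have inj: "inj_on b J"
  proof (rule inj_onI, rule ccontr)
    fix i j
    assume ij: "i \<in> J" "j \<in> J" "b i = b j" "i \<noteq> j"
    \<comment> \<open>Coefficients \<open>1\<close> and \<open>-1\<close> at two equal members of
      the family would form a non-trivial relation.\<close>
    define c where "c = (\<lambda>k. if k = i then \<one>\<^bsub>K\<^esub> else if k = j then \<ominus>\<^bsub>K\<^esub> \<one>\<^bsub>K\<^esub> else \<zero>\<^bsub>K\<^esub>)"
    have c: "c k \<in> carrier K" for k
      by (simp add: c_def)
    have "(\<Oplus>\<^bsub>V\<^esub>k\<in>J. c k \<odot>\<^bsub>V\<^esub> b k) = (\<Oplus>\<^bsub>V\<^esub>k\<in>{i, j}. c k \<odot>\<^bsub>V\<^esub> b k)"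
      using J ij b c by (intro M.add.finprod_mono_neutral_cong_right)
        (auto simp: c_def smult_l_null)
    also have "\<dots> = b j \<oplus>\<^bsub>V\<^esub> (\<ominus>\<^bsub>K\<^esub> \<one>\<^bsub>K\<^esub>) \<odot>\<^bsub>V\<^esub> b j"
      using ij b c by (simp add: c_def)
    also have "\<dots> = \<zero>\<^bsub>V\<^esub>"
      using b[OF ij(2)] by (simp add: smult_l_minus M.r_neg)
    finally have "c i = \<zero>\<^bsub>K\<^esub>"
      using indep[of c i] c ij by blast
    then show False
      by (simp add: c_def)
  qed
  have lincomb: "lincomb a (b ` J) = (\<Oplus>\<^bsub>V\<^esub>j\<in>J. a (b j) \<odot>\<^bsub>V\<^esub> b j)" if "a \<in> b ` J \<rightarrow> carrier K" for a
    unfolding lincomb_def using inj b that by (intro M.finsum_reindex) auto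
  have li: "lin_indpt (b ` J)"
  proof (rule finite_lin_indpt2)
    fix a
    assume a: "a \<in> b ` J \<rightarrow> carrier K" "lincomb a (b ` J) = \<zero>\<^bsub>V\<^esub>"
    define c where "c = (\<lambda>j. if j \<in> J then a (b j) else \<zero>\<^bsub>K\<^esub>)"
    have c: "c j \<in> carrier K" for j
      using a by (auto simp: c_def)
    have "(\<Oplus>\<^bsub>V\<^esub>j\<in>J. c j \<odot>\<^bsub>V\<^esub> b j) = (\<Oplus>\<^bsub>V\<^esub>j\<in>J. a (b j) \<odot>\<^bsub>V\<^esub> b j)"
      using a(1) b by (intro M.finsum_cong') (auto simp: c_def)
    then have "c j = \<zero>\<^bsub>K\<^esub>" if "j \<in> J" for j
      using indep[of c j] c that a lincomb[OF a(1)] by simp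
    then show "\<forall>v\<in>b ` J. a v = \<zero>\<^bsub>K\<^esub>"
      by (auto simp: c_def)
  qed (use J b in auto)
  have "carrier V \<subseteq> span (b ` J)"
  proof
    fix v
    assume "v \<in> carrier V"
    then obtain c where c: "\<And>j. c j \<in> carrier K" "v = (\<Oplus>\<^bsub>V\<^esub>j\<in>J. c j \<odot>\<^bsub>V\<^esub> b j)"
      using gen by blast
    define a where "a = (\<lambda>w. c (the_inv_into J b w))"
    have "lincomb a (b ` J) = (\<Oplus>\<^bsub>V\<^esub>j\<in>J. a (b j) \<odot>\<^bsub>V\<^esub> b j)"
      using c by (intro lincomb) (auto simp: a_def)
    also have "\<dots> = v"
      unfolding c(2) using c b by (intro M.finsum_cong') (auto simp: a_def the_inv_into_f_f[OF inj])
    finally have "v = lincomb a (b ` J)" ..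
    moreover have "a \<in> b ` J \<rightarrow> carrier K"
      using c by (simp add: a_def)
    ultimately show "v \<in> span (b ` J)"
      using J unfolding span_def by blast
  qed
  moreover have "span (b ` J) \<subseteq> carrier V"
    using b by (intro span_is_subset2) auto
  ultimately have "gen_set (b ` J)"
    by blast
  then have basis: "basis (b ` J)"
    using li b by (auto simp: basis_def)
  then show "fin_dim"
    unfolding fin_dim_def using J by (intro exI[of _ "b ` J"]) (simp add: basis_def)
  show "dim = card J"
    using dim_basis[OF _ basis] J card_image[OF inj] by simp
qed

section \<open>Quotients by left ideals\<close>

locale left_ideal = ring R for R (structure) +
  fixes I
  assumes I_subgroup: "subgroup I (add_monoid R)"
    and I_l_closed: "\<And>a b. a \<in> carrier R \<Longrightarrow> b \<in> I \<Longrightarrow> a \<otimes> b \<in> I"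
begin

lemma quot_carrier: "carrier (quotient_module R I) = (\<lambda>a. I +> a) ` carrier R"
  by (auto simp: quotient_module_def A_RCOSETS_def RCOSETS_def a_r_coset_def)

lemma quot_zero: "\<zero>\<^bsub>quotient_module R I\<^esub> = I +> \<zero>"
  using add.coset_mult_one[of I] subgroup.subset[OF I_subgroup]
  by (simp add: quotient_module_def a_r_coset_def)

lemma quot_add: "a \<in> carrier R \<Longrightarrow> b \<in> carrier R \<Longrightarrow>
    (I +> a) \<oplus>\<^bsub>quotient_module R I\<^esub> (I +> b) = I +> (a \<oplus> b)"
  using normal.rcos_sum[of I "add_monoid R" a b]
    comm_group.normal_iff_subgroup[OF a_comm_group, of I] I_subgroup
  by (simp add: quotient_module_def a_r_coset_def set_add_def)

lemma quot_eq_iff: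
  assumes "a \<in> carrier R" "b \<in> carrier R"
  shows "I +> a = I +> b \<longleftrightarrow> a \<ominus> b \<in> I"
proof
  assume "I +> a = I +> b"
  then have "a \<in> I +> b"
    using add.rcos_self[OF _ I_subgroup, of a] assms by (simp add: a_r_coset_def)
  then obtain i where "i \<in> I" "a = i \<oplus> b"
    by (auto simp: a_r_coset_def r_coset_def)
  then show "a \<ominus> b \<in> I"
    using assms subgroup.subset[OF I_subgroup] by (auto simp: a_minus_def a_assoc r_neg subset_iff)
next
  assume "a \<ominus> b \<in> I"
  moreover have "a = (a \<ominus> b) \<oplus> b"
    using assms by (simp add: a_minus_def a_assoc l_neg)
  ultimately have "a \<in> I +> b"
    unfolding a_r_coset_def r_coset_def by auto
  then show "I +> a = I +> b"
    using add.repr_independence[OF _ _ I_subgroup, of a b] assms by (simp add: a_r_coset_def)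
qed

lemma quot_smult:
  assumes "a \<in> carrier R" "b \<in> carrier R"
  shows "a \<odot>\<^bsub>quotient_module R I\<^esub> (I +> b) = I +> (a \<otimes> b)"
proof -
  have "I +> (a \<otimes> b') = I +> (a \<otimes> b)" if b': "b' \<in> I +> b" for b'
  proof -
    obtain i where i: "i \<in> I" "b' = i \<oplus> b"
      using b' by (auto simp: a_r_coset_def r_coset_def)
    then have "i \<in> carrier R"
      using subgroup.subset[OF I_subgroup] by auto
    then have "a \<otimes> b' \<ominus> a \<otimes> b = a \<otimes> i"
      using assms i by (simp add: r_distr a_minus_def a_assoc r_neg)
    then show ?thesis
      using assms i \<open>i \<in> carrier R\<close> I_l_closed by (subst quot_eq_iff) auto
  qed
  moreover have "b \<in> I +> b"
    using add.rcos_self[OF _ I_subgroup, of b] assms by (simp add: a_r_coset_def)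
  ultimately have "(\<Union>b'\<in>I +> b. I +> (a \<otimes> b')) = I +> (a \<otimes> b)"
    by blast
  then show ?thesis
    by (simp add: quotient_module_def)
qed

lemma quot_left_module: "left_module R (quotient_module R I)"
proof (intro left_module.intro left_module_axioms.intro)
  show "ring R"
    by (rule ring_axioms)
  show "abelian_group (quotient_module R I)"
  proof (rule abelian_groupI)
    fix C
    assume "C \<in> carrier (quotient_module R I)"
    then obtain a where a: "a \<in> carrier R" "C = I +> a"
      by (auto simp: quot_carrier)
    then have "(I +> \<ominus> a) \<oplus>\<^bsub>quotient_module R I\<^esub> C = \<zero>\<^bsub>quotient_module R I\<^esub>"
      by (simp add: quot_add quot_zero l_neg)
    then show "\<exists>D\<in>carrier (quotient_module R I). D \<oplus>\<^bsub>quotient_module R I\<^esub> C = \<zero>\<^bsub>quotient_module R I\<^esub>"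
      using a by (auto simp: quot_carrier)
  next
    fix C D
    assume "C \<in> carrier (quotient_module R I)" "D \<in> carrier (quotient_module R I)"
    then show "C \<oplus>\<^bsub>quotient_module R I\<^esub> D = D \<oplus>\<^bsub>quotient_module R I\<^esub> C"
      using a_comm by (auto simp: quot_carrier quot_add)
  qed (auto simp: quot_carrier quot_add quot_zero a_assoc)
qed (auto simp: quot_carrier quot_add quot_smult l_distr r_distr m_assoc)

end

text \<open>\<open>PIdl r\<close> consists of the products with \<open>r\<close> as the right
  factor, which without commutativity is the left ideal generated by \<open>r\<close>.\<close>

lemma (in ring) principal_left_ideal:
  assumes "r \<in> carrier R"
  shows "left_ideal R (PIdl r)"
proof (intro left_ideal.intro left_ideal_axioms.intro ring_axioms)
  show "subgroup (PIdl r) (add_monoid R)"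
  proof (rule add.subgroupI)
    show "PIdl r \<noteq> {}"
      using one_closed by (auto simp: cgenideal_def)
    fix a
    assume "a \<in> PIdl r"
    then obtain b where "b \<in> carrier R" "a = b \<otimes> r"
      by (auto simp: cgenideal_def)
    then have "\<ominus> a = (\<ominus> b) \<otimes> r"
      using assms by (simp add: l_minus)
    then show "\<ominus> a \<in> PIdl r"
      using \<open>b \<in> carrier R\<close> by (auto simp: cgenideal_def)
  next
    fix a b
    assume "a \<in> PIdl r" "b \<in> PIdl r"
    then obtain a' b' where "a' \<in> carrier R" "a = a' \<otimes> r" "b' \<in> carrier R" "b = b' \<otimes> r"
      by (auto simp: cgenideal_def)
    then have "a \<oplus> b = (a' \<oplus> b') \<otimes> r" "a' \<oplus> b' \<in> carrier R"
      using assms by (simp_all add: l_distr)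
    then show "a \<oplus> b \<in> PIdl r"
      by (auto simp: cgenideal_def)
  qed (use assms in \<open>auto simp: cgenideal_def\<close>)
  fix a b
  assume "a \<in> carrier R" "b \<in> PIdl r"
  then obtain b' where "b' \<in> carrier R" "b = b' \<otimes> r"
    by (auto simp: cgenideal_def)
  then show "a \<otimes> b \<in> PIdl r"
    using assms \<open>a \<in> carrier R\<close> unfolding cgenideal_def
    by (intro CollectI exI[of _ "a \<otimes> b'"]) (simp add: m_assoc)
qed

section \<open>Counting exponents\<close>

text \<open>Stars and bars. The slack \<open>s - expo_deg e\<close> is recorded as a further entry,
  which turns the bound into an equation: lists of \<open>CARD('n) + 3\<close> natural numbers with
  sum \<open>s\<close>.\<close>

lemma card_expo_deg_le:
  "finite {e :: 'n::finite expo. expo_deg e \<le> s}" (is "finite ?E")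
  "card {e :: 'n expo. expo_deg e \<le> s} = (s + CARD('n) + 2) choose (CARD('n) + 2)"
proof -
  obtain js :: "'n list" where js: "set js = UNIV" "distinct js"
    using finite_distinct_list[of "UNIV :: 'n set"] by auto
  have len: "length js = CARD('n)"
    using distinct_card[OF js(2)] js(1) by simp
  have sum: "sum_list (map (lookup i) js) = (\<Sum>j\<in>UNIV. lookup i j)" for i :: "'n \<Rightarrow>\<^sub>0 nat"
    using sum.distinct_set_conv_list[OF js(2), of "lookup i"] js(1) by simp
  let ?X = "{xs :: nat list. length xs = CARD('n) + 3 \<and> sum_list xs = s}"
  define \<Phi> :: "'n expo \<Rightarrow> nat list" where
    "\<Phi> = (\<lambda>(l, \<mu>, i). (s - expo_deg (l, \<mu>, i)) # l # \<mu> # map (lookup i) js)"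
  have bij: "bij_betw \<Phi> ?E ?X"
  proof (rule bij_betw_imageI)
    show "inj_on \<Phi> ?E"
    proof (rule inj_onI)
      fix e f :: "'n expo"
      assume eq: "\<Phi> e = \<Phi> f"
      obtain l \<mu> i l' \<mu>' i' where e: "e = (l, \<mu>, i)" "f = (l', \<mu>', i')"
        by (metis prod_cases3)
      have "lookup i j = lookup i' j" for j
        using eq js(1) by (auto simp: e \<Phi>_def)
      then show "e = f"
        using eq by (auto simp: e \<Phi>_def intro: poly_mapping_eqI)
    qed
    show "\<Phi> ` ?E = ?X"
    proof (intro equalityI subsetI)
      fix xs
      assume "xs \<in> \<Phi> ` ?E"
      then show "xs \<in> ?X"
        by (auto simp: \<Phi>_def len sum expo_deg_simp)
    next
      fix xs
      assume xs: "xs \<in> ?X"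
      then obtain a xs1 where "xs = a # xs1" "length xs1 = CARD('n) + 2"
        by (cases xs) auto
      moreover then obtain l xs2 where "xs1 = l # xs2" "length xs2 = CARD('n) + 1"
        by (cases xs1) auto
      moreover then obtain \<mu> ys where "xs2 = \<mu> # ys" "length ys = CARD('n)"
        by (cases xs2) auto
      ultimately have ys: "xs = a # l # \<mu> # ys" "length ys = length js"
        by (simp_all add: len)
      define i where "i = Abs_poly_mapping (\<lambda>j. the (map_of (zip js ys) j))"
      have look: "lookup i j = the (map_of (zip js ys) j)" for j
        by (simp add: i_def)
      have map: "map (lookup i) js = ys"
        using ys(2) js(2) by (intro nth_equalityI) (simp_all add: look map_of_zip_nth)
      have deg: "expo_deg (l, \<mu>, i) = l + \<mu> + sum_list ys"
        using sum[of i] by (simp add: expo_deg_simp map)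
      moreover have "s = a + (l + \<mu> + sum_list ys)"
        using xs by (simp add: ys(1))
      ultimately have "\<Phi> (l, \<mu>, i) = xs" "expo_deg (l, \<mu>, i) \<le> s"
        by (simp_all add: \<Phi>_def map ys(1))
      then show "xs \<in> \<Phi> ` ?E"
        by force
    qed
  qed
  have card: "card ?X = (s + CARD('n) + 2) choose s"
    using card_length_sum_list[of "CARD('n) + 3" s] by simp
  moreover have "(s + CARD('n) + 2) choose s > 0"
    by (simp add: zero_less_binomial_iff)
  ultimately have "finite ?X"
    by (metis card_gt_0_iff)
  then show "finite ?E"
    using bij_betw_finite[OF bij] by simp
  show "card ?E = (s + CARD('n) + 2) choose (CARD('n) + 2)"
    using bij_betw_same_card[OF bij] card binomial_symmetric[of s "s + CARD('n) + 2"] by simp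
qed

lemma binomial_polynomial:
  fixes t d :: nat
  defines "p \<equiv> Polynomial.smult (1 / fact d) (\<Prod>i<d. [:rat_of_nat d - rat_of_nat i - rat_of_nat t, 1:])"
  shows "Polynomial.degree p = d" "Polynomial.coeff p d = 1 / fact d"
    "s \<ge> t \<Longrightarrow> poly p (rat_of_nat s) = rat_of_nat ((s - t + d) choose d)"
proof -
  let ?p = "\<Prod>i<d. [:rat_of_nat d - rat_of_nat i - rat_of_nat t, 1:]"
  have deg: "Polynomial.degree ?p = d"
    by (subst degree_prod_eq_sum_degree) auto
  moreover have "Polynomial.lead_coeff ?p = 1"
    by (simp add: lead_coeff_prod)
  ultimately show "Polynomial.degree p = d" "Polynomial.coeff p d = 1 / fact d"
    by (simp_all add: p_def)
  assume "s \<ge> t"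
  then have "rat_of_nat (s - t + d) = rat_of_nat s - rat_of_nat t + rat_of_nat d"
    by (simp add: of_nat_diff)
  then have "rat_of_nat ((s - t + d) choose d) = (rat_of_nat s - rat_of_nat t + rat_of_nat d) gchoose d"
    by (simp only: binomial_gbinomial)
  also have "\<dots> = (\<Prod>i<d. rat_of_nat s - rat_of_nat t + rat_of_nat d - rat_of_nat i) / fact d"
    by (simp add: gbinomial_prod_rev atLeast0LessThan)
  also have "\<dots> = poly p (rat_of_nat s)"
    by (simp add: p_def poly_prod algebra_simps)
  finally show "poly p (rat_of_nat s) = rat_of_nat ((s - t + d) choose d)" ..
qed

text \<open>By Pascal's rule the difference telescopes into the \<open>r\<close> binomial
  coefficients \<open>(s - t + d) choose d\<close> with \<open>t < r\<close>. Each is a polynomial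
  in \<open>s\<close> of degree \<open>d\<close> with leading coefficient \<open>1 / fact d\<close>,
  so the sum has coefficient \<open>r / fact d\<close> there, which is non-zero for
  \<open>r > 0\<close>.\<close>

lemma binomial_difference_polynomial:
  assumes "r > 0"
  obtains H :: "rat poly" where "Polynomial.degree H = d"
    and "\<And>s. s \<ge> r \<Longrightarrow> poly H (rat_of_nat s) =
      rat_of_nat ((s + Suc d) choose Suc d) - rat_of_nat ((s - r + Suc d) choose Suc d)"
proof
  define B where "B = (\<lambda>t. Polynomial.smult (1 / fact d)
    (\<Prod>i<d. [:rat_of_nat d - rat_of_nat i - rat_of_nat t, 1:]))"
  have B: "Polynomial.degree (B t) = d" "Polynomial.coeff (B t) d = 1 / fact d"
    "s \<ge> t \<Longrightarrow> poly (B t) (rat_of_nat s) = rat_of_nat ((s - t + d) choose d)" for t s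
    unfolding B_def by (rule binomial_polynomial; assumption?)+
  let ?H = "\<Sum>t<r. B t"
  have "Polynomial.coeff ?H d = rat_of_nat r / fact d"
    by (simp add: coeff_sum B(2))
  then have "Polynomial.coeff ?H d \<noteq> 0"
    using assms by simp
  moreover have "Polynomial.degree ?H \<le> d"
    by (intro degree_sum_le) (auto simp: B(1))
  ultimately show "Polynomial.degree ?H = d"
    by (meson le_antisym le_degree)
  fix s
  assume "s \<ge> r"
  have "(\<Sum>t<r'. rat_of_nat ((s - t + d) choose d)) =
      rat_of_nat ((s + Suc d) choose Suc d) - rat_of_nat ((s - r' + Suc d) choose Suc d)"
    if "r' \<le> s" for r'
    using that
  proof (induction r')
    case (Suc r')
    obtain m where m: "s - r' = Suc m" "s - Suc r' = m"
      using Suc.prems by (metis Suc_diff_Suc Suc_le_lessD)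
    have "s + d - r' = Suc (m + d)"
      using m Suc.prems by simp
    then show ?case
      using Suc by (simp add: m)
  qed simp
  from this[OF \<open>s \<ge> r\<close>] show "poly ?H (rat_of_nat s) =
      rat_of_nat ((s + Suc d) choose Suc d) - rat_of_nat ((s - r + Suc d) choose Suc d)"
    using \<open>s \<ge> r\<close> by (simp add: poly_sum B(3))
qed

section \<open>Division with respect to a monomial order\<close>

text \<open>The lexicographic order on the images of \<open>expo_key\<close> compares the total degree first.\<close>

definition expo_key :: "'n::finite expo \<Rightarrow> (nat \<Rightarrow>\<^sub>0 nat)" where
  "expo_key e = Poly_Mapping.single 0 (expo_deg e) + Poly_Mapping.single 1 (fst e) +
    Poly_Mapping.single 2 (fst (snd e)) +
    (\<Sum>j\<in>UNIV. Poly_Mapping.single (3 + to_nat j) (lookup (snd (snd e)) j))"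

lemma expo_key_add: "expo_key (e + f) = expo_key e + expo_key f"
  by (simp add: expo_key_def expo_deg_add lookup_add single_add sum.distrib algebra_simps)

lemma lookup_expo_key:
  "lookup (expo_key e) 0 = expo_deg e" "lookup (expo_key e) 1 = fst e"
  "lookup (expo_key e) 2 = fst (snd e)" "lookup (expo_key e) (3 + to_nat j) = lookup (snd (snd e)) j"
proof -
  show "lookup (expo_key e) 0 = expo_deg e" "lookup (expo_key e) 1 = fst e"
    "lookup (expo_key e) 2 = fst (snd e)"
    by (simp_all add: expo_key_def lookup_add lookup_sum lookup_single when_def)
  have "lookup (expo_key e) (3 + to_nat j) =
      (\<Sum>k\<in>UNIV. if k = j then lookup (snd (snd e)) k else 0)"
    by (simp add: expo_key_def lookup_add lookup_sum lookup_single when_def cong: if_cong)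
  then show "lookup (expo_key e) (3 + to_nat j) = lookup (snd (snd e)) j"
    by simp
qed

lemma expo_key_inj: "expo_key e = expo_key f \<longleftrightarrow> e = f"
proof
  assume *: "expo_key e = expo_key f"
  have "lookup (snd (snd e)) j = lookup (snd (snd f)) j" for j
    using lookup_expo_key(4)[of e j] lookup_expo_key(4)[of f j] * by simp
  then have "snd (snd e) = snd (snd f)"
    by (rule poly_mapping_eqI)
  moreover have "fst e = fst f" "fst (snd e) = fst (snd f)"
    using lookup_expo_key(2,3)[of e] lookup_expo_key(2,3)[of f] * by simp_all
  ultimately show "e = f"
    by (simp add: prod_eq_iff)
qed simp

lemma expo_key_less_if_deg_less:
  assumes "expo_deg e < expo_deg f"
  shows "expo_key e < expo_key f"
  unfolding less_poly_mapping.rep_eq less_fun_def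
  using assms by (intro exI[of _ 0]) (simp add: lookup_expo_key)

lemma expo_deg_mono: "expo_key e \<le> expo_key f \<Longrightarrow> expo_deg e \<le> expo_deg f"
  using expo_key_less_if_deg_less[of f e] by (meson leD leI)

lemma max_key_exists:
  fixes w :: "'n::finite expo \<Rightarrow>\<^sub>0 'k::zero"
  assumes "w \<noteq> 0"
  obtains \<delta> where "\<delta> \<in> keys w" "\<And>e. e \<in> keys w \<Longrightarrow> expo_key e \<le> expo_key \<delta>"
proof -
  have fin: "finite (expo_key ` keys w)" "expo_key ` keys w \<noteq> {}"
    using assms by auto
  then have "Max (expo_key ` keys w) \<in> expo_key ` keys w"
    by (rule Max_in)
  then obtain \<delta> where "\<delta> \<in> keys w" "Max (expo_key ` keys w) = expo_key \<delta>"
    by auto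
  moreover have "expo_key e \<le> Max (expo_key ` keys w)" if "e \<in> keys w" for e
    using Max_ge[OF fin(1)] that by simp
  ultimately show thesis
    using that[of \<delta>] by simp
qed

lemma scale_add: "scale a (w + w') = scale a w + scale a w'"
  and scale_add_left: "scale (a + b) w = scale a w + scale b w"
  and scale_scale: "scale a (scale b w) = scale (a * b) w"
  and scale_zero: "scale a 0 = 0"
  and scale_zero_left: "scale 0 w = 0"
  and scale_one: "scale 1 w = w"
  and scale_minus: "scale (- a) w = - scale a w"
  and scale_diff: "scale a (w - w') = scale a w - scale a w'"
  by (intro poly_mapping_eqI; simp add: lookup_add lookup_minus algebra_simps)+

lemma scale_single: "scale a (Poly_Mapping.single e 1) = Poly_Mapping.single e a"
  by (rule poly_mapping_eqI) (simp add: lookup_single when_def)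

lemma scale_sum: "scale a (sum f S) = (\<Sum>x\<in>S. scale a (f x))"
  by (induction S rule: infinite_finite_induct) (simp_all add: scale_add scale_zero)

text \<open>\<open>rm e\<close> stands for the coefficients of the product of the monomial
  \<open>e\<close> with the generator of the left ideal, and \<open>\<delta>\<close> for the leading
  exponent of that generator. Division needs only these leading terms, so the ring multiplication is
  kept out.\<close>

locale leading_family =
  fixes \<delta> :: "'n::finite expo" and rm :: "'n expo \<Rightarrow> ('n expo \<Rightarrow>\<^sub>0 'k::field)"
  assumes lead: "lookup (rm e) (e + \<delta>) \<noteq> 0"
    and key_le: "f \<in> keys (rm e) \<Longrightarrow> expo_key f \<le> expo_key (e + \<delta>)"
begin

definition comb :: "('n expo \<Rightarrow>\<^sub>0 'k) \<Rightarrow> ('n expo \<Rightarrow>\<^sub>0 'k)" where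
  "comb w = (\<Sum>e\<in>keys w. scale (lookup w e) (rm e))"

lemma comb_superset: "finite S \<Longrightarrow> keys w \<subseteq> S \<Longrightarrow> comb w = (\<Sum>e\<in>S. scale (lookup w e) (rm e))"
  unfolding comb_def by (intro sum.mono_neutral_left) (auto simp: in_keys_iff scale_zero_left)

lemma comb_add: "comb (w + w') = comb w + comb w'"
proof -
  let ?S = "keys w \<union> keys w'"
  have "keys (w + w') \<subseteq> ?S"
    by (rule Poly_Mapping.keys_add)
  then show ?thesis
    by (simp add: comb_superset[of ?S] lookup_add scale_add_left sum.distrib)
qed

lemma comb_scale: "comb (scale a w) = scale a (comb w)"
  using comb_superset[of "keys w" "scale a w"] keys_scale_subset[of a w]
  by (simp add: comb_def scale_sum scale_scale)

lemma comb_zero: "comb 0 = 0"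
  by (simp add: comb_def)

lemma comb_single: "comb (Poly_Mapping.single e 1) = rm e"
  by (simp add: comb_def scale_one)

text \<open>For the largest exponent \<open>e\<close> of \<open>w\<close>, all other
  \<open>f\<close> contribute only exponents below \<open>e + \<delta>\<close>, so nothing cancels
  there. This makes the standard monomials independent modulo the left ideal.\<close>

lemma comb_lead:
  assumes "w \<noteq> 0"
  shows "\<exists>e. lookup (comb w) (e + \<delta>) \<noteq> 0"
proof -
  obtain e where e: "e \<in> keys w" "\<And>f. f \<in> keys w \<Longrightarrow> expo_key f \<le> expo_key e"
    using max_key_exists[OF assms] by blast
  have zero: "lookup w f * lookup (rm f) (e + \<delta>) = 0" if "f \<in> keys w - {e}" for f
  proof -
    have "expo_key f < expo_key e"
      using e(2)[of f] that expo_key_inj[of f e] by (auto simp: less_le)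
    then have "expo_key (f + \<delta>) < expo_key (e + \<delta>)"
      by (simp add: expo_key_add)
    then have "e + \<delta> \<notin> keys (rm f)"
      using key_le[of "e + \<delta>" f] by auto
    then show ?thesis
      by (simp add: in_keys_iff)
  qed
  have "lookup (comb w) (e + \<delta>) = (\<Sum>f\<in>keys w. lookup w f * lookup (rm f) (e + \<delta>))"
    by (simp add: comb_def lookup_sum)
  also have "\<dots> = lookup w e * lookup (rm e) (e + \<delta>)"
  proof -
    have "(\<Sum>f\<in>keys w - {e}. lookup w f * lookup (rm f) (e + \<delta>)) = 0"
      using zero by (intro sum.neutral) blast
    then show ?thesis
      by (subst sum.remove[OF _ e(1)]) simp_all
  qed
  finally show ?thesis
    using e(1) lead[of e] by (intro exI[of _ e]) (simp add: in_keys_iff)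
qed

text \<open>Division with remainder \<open>v\<close>. The degree of the quotient is left unbounded,
  since only the class modulo the left ideal counts.\<close>

definition reducible :: "nat \<Rightarrow> ('n expo \<Rightarrow>\<^sub>0 'k) \<Rightarrow> bool" where
  "reducible s w \<longleftrightarrow> (\<exists>v. (\<forall>e\<in>keys v. expo_deg e \<le> s) \<and> (\<forall>e. lookup v (e + \<delta>) = 0) \<and>
    w - v \<in> range comb)"

lemma reducible_zero: "reducible s 0"
  unfolding reducible_def using comb_zero by (intro exI[of _ 0]) (auto intro: image_eqI[of _ _ 0])

lemma reducible_add:
  assumes "reducible s w" "reducible s w'"
  shows "reducible s (w + w')"
proof -
  obtain v v' a a' where v: "\<forall>e\<in>keys v. expo_deg e \<le> s" "\<forall>e. lookup v (e + \<delta>) = 0" "w - v = comb a"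
    "\<forall>e\<in>keys v'. expo_deg e \<le> s" "\<forall>e. lookup v' (e + \<delta>) = 0" "w' - v' = comb a'"
    using assms unfolding reducible_def by auto
  have "w + w' - (v + v') = (w - v) + (w' - v')"
    by (simp add: algebra_simps)
  also have "\<dots> = comb (a + a')"
    by (simp add: v comb_add)
  finally have "w + w' - (v + v') = comb (a + a')" .
  then show ?thesis
    unfolding reducible_def using v Poly_Mapping.keys_add[of v v']
    by (intro exI[of _ "v + v'"]) (auto simp: lookup_add)
qed

lemma reducible_scale:
  assumes "reducible s w"
  shows "reducible s (scale a w)"
proof -
  obtain v b where v: "\<forall>e\<in>keys v. expo_deg e \<le> s" "\<forall>e. lookup v (e + \<delta>) = 0" "w - v = comb b"
    using assms unfolding reducible_def by auto
  have "scale a w - scale a v = comb (scale a b)"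
    by (simp add: comb_scale flip: scale_diff v(3))
  then show ?thesis
    unfolding reducible_def using v keys_scale_subset[of a v] by (intro exI[of _ "scale a v"]) auto
qed

lemma reducible_sum: "(\<And>x. x \<in> S \<Longrightarrow> reducible s (f x)) \<Longrightarrow> reducible s (sum f S)"
  by (induction S rule: infinite_finite_induct) (simp_all add: reducible_zero reducible_add)

text \<open>Induction on the number of smaller exponents of degree at most \<open>s\<close>, a
  finite set. For \<open>e = e' + \<delta>\<close>, a multiple of \<open>rm e'\<close> replaces the
  monomial by smaller ones, whose degree stays at most \<open>s\<close> because the order compares
  degrees first.\<close>

lemma reducible_single: "expo_deg e \<le> s \<Longrightarrow> reducible s (Poly_Mapping.single e 1)"
proof (induction "card {f :: 'n expo. expo_deg f \<le> s \<and> expo_key f < expo_key e}" arbitrary: e rule: less_induct)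
  case less
  show ?case
  proof (cases "\<exists>e'. e = e' + \<delta>")
    case False
    then have "\<forall>f. lookup (Poly_Mapping.single e (1 :: 'k)) (f + \<delta>) = 0"
      by (auto simp: lookup_single when_def)
    then show ?thesis
      unfolding reducible_def using less.prems comb_zero
      by (intro exI[of _ "Poly_Mapping.single e 1"]) (auto intro: image_eqI[of _ _ 0])
  next
    case True
    then obtain e' where e': "e = e' + \<delta>"
      by blast
    define c where "c = lookup (rm e') e"
    have c: "c \<noteq> 0"
      using lead[of e'] by (simp add: c_def e')
    define w where "w = (\<Sum>f\<in>keys (rm e') - {e}. scale (lookup (rm e') f) (Poly_Mapping.single f 1))"
    have "e \<in> keys (rm e')"
      using c by (simp add: c_def in_keys_iff)
    then have "rm e' = scale c (Poly_Mapping.single e 1) + w"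
      by (intro poly_mapping_eqI)
         (auto simp: c_def w_def scale_single lookup_add lookup_sum lookup_single when_def in_keys_iff)
    then have "Poly_Mapping.single e 1 = scale (1 / c) (rm e') + scale (- (1 / c)) w"
      using c by (simp add: scale_add scale_scale scale_minus scale_one)
    moreover have "reducible s (scale (- (1 / c)) w)"
      unfolding w_def
    proof (intro reducible_scale reducible_sum)
      fix f
      assume f: "f \<in> keys (rm e') - {e}"
      then have key: "expo_key f < expo_key e"
        using key_le[of f e'] expo_key_inj[of f e] by (auto simp: e' less_le)
      then have deg: "expo_deg f \<le> s"
        using expo_deg_mono[OF less_imp_le[OF key]] less.prems by simp
      have "{g. expo_deg g \<le> s \<and> expo_key g < expo_key f} \<subset>
          {g :: 'n expo. expo_deg g \<le> s \<and> expo_key g < expo_key e}"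
        using key deg by auto
      then have "card {g :: 'n expo. expo_deg g \<le> s \<and> expo_key g < expo_key f} <
          card {g :: 'n expo. expo_deg g \<le> s \<and> expo_key g < expo_key e}"
        by (rule psubset_card_mono[rotated]) (auto intro: finite_subset[OF _ card_expo_deg_le(1)[of s]])
      then show "reducible s (Poly_Mapping.single f 1)"
        using less.hyps deg by blast
    qed
    moreover have "reducible s (scale (1 / c) (rm e'))"
      unfolding reducible_def
      by (intro exI[of _ 0]) (auto intro!: image_eqI[of _ _ "scale (1 / c) (Poly_Mapping.single e' 1)"]
          simp: comb_scale comb_single)
    ultimately show ?thesis
      by (simp add: reducible_add)
  qed
qed

lemma reducible:
  assumes "\<forall>e\<in>keys w. expo_deg e \<le> s"
  shows "reducible s w"
proof -
  have "w = (\<Sum>e\<in>keys w. scale (lookup w e) (Poly_Mapping.single e 1))"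
    by (rule poly_mapping_eqI) (simp add: scale_single lookup_sum lookup_single when_def in_keys_iff)
  moreover have "reducible s (\<Sum>e\<in>keys w. scale (lookup w e) (Poly_Mapping.single e 1))"
    using assms by (intro reducible_sum reducible_scale reducible_single) simp
  ultimately show ?thesis
    by simp
qed

definition standard :: "nat \<Rightarrow> 'n expo set" where
  "standard s = {e. expo_deg e \<le> s \<and> (\<forall>f. e \<noteq> f + \<delta>)}"

lemma finite_standard: "finite (standard s)"
  unfolding standard_def by (rule finite_subset[OF _ card_expo_deg_le(1)[of s]]) auto

text \<open>Adding \<open>\<delta>\<close> maps the exponents of degree at most
  \<open>s - expo_deg \<delta>\<close> bijectively onto the non-standard ones of degree at most
  \<open>s\<close>.\<close>

lemma card_standard:
  assumes "s \<ge> expo_deg \<delta>"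
  shows "rat_of_nat (card (standard s)) =
    rat_of_nat ((s + CARD('n) + 2) choose (CARD('n) + 2)) -
    rat_of_nat ((s - expo_deg \<delta> + CARD('n) + 2) choose (CARD('n) + 2))"
proof -
  let ?E = "\<lambda>s. {e :: 'n expo. expo_deg e \<le> s}"
  have "(\<lambda>e. e + \<delta>) ` ?E (s - expo_deg \<delta>) = ?E s - standard s"
    using assms by (auto simp: standard_def expo_deg_add)
  moreover have "card ((\<lambda>e. e + \<delta>) ` ?E (s - expo_deg \<delta>)) = card (?E (s - expo_deg \<delta>))"
    by (rule card_image) (simp add: inj_on_def)
  moreover have "card (?E s - standard s) = card (?E s) - card (standard s)"
    by (rule card_Diff_subset[OF finite_standard]) (auto simp: standard_def)
  moreover have "card (standard s) \<le> card (?E s)"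
    by (rule card_mono[OF card_expo_deg_le(1)]) (auto simp: standard_def)
  ultimately have "card (?E (s - expo_deg \<delta>)) = card (?E s) - card (standard s)"
    by simp
  with \<open>card (standard s) \<le> card (?E s)\<close> show ?thesis
    by (simp only: card_expo_deg_le(2) of_nat_diff)
qed

end

section \<open>The filtration of the Carlitz ring\<close>

text \<open>What commutes with the generators commutes with all that they generate. This is used
  first for a generator and then for an arbitrary element of the generated ring.\<close>

lemma (in ring) generate_ring_commute:
  assumes H: "H \<subseteq> carrier R" "\<And>a b. a \<in> H \<Longrightarrow> b \<in> H \<Longrightarrow> a \<otimes> b = b \<otimes> a"
    and "a \<in> generate_ring R H" "b \<in> generate_ring R H"
  shows "a \<otimes> b = b \<otimes> a"
proof -
  have closed: "c \<in> carrier R" if "c \<in> generate_ring R H" for c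
    using generate_ring_in_carrier[OF H(1)] that .
  have step: "c \<otimes> d = d \<otimes> c"
    if d: "d \<in> carrier R" and H': "\<And>h. h \<in> H \<Longrightarrow> h \<otimes> d = d \<otimes> h" and c: "c \<in> generate_ring R H" for c d
    using c
  proof induction
    case (eng_mult h1 h2)
    then have "h1 \<otimes> h2 \<otimes> d = h1 \<otimes> (d \<otimes> h2)"
      using d closed by (simp add: m_assoc)
    also have "\<dots> = d \<otimes> h1 \<otimes> h2"
      using eng_mult d closed by (simp flip: m_assoc)
    finally show ?case
      using eng_mult d closed by (simp add: m_assoc)
  qed (use d H' closed in \<open>simp_all add: l_distr r_distr l_minus r_minus\<close>)
  have "b \<otimes> h = h \<otimes> b" if "h \<in> H" for h
    using step[of h b] that H assms(4) by (metis subsetD)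
  then show ?thesis
    using step[of b a] assms closed by metis
qed

context carlitz_field
begin

lemma germ_lift_A_pow:
  assumes "germ_op T"
  shows "germ_lift q x T [^]\<^bsub>A\<^esub> (n :: nat) = germ_lift q x (T ^^ n)"
proof (induction n)
  case 0
  show ?case
    by (simp add: nat_pow_def A_simps germ_lift_one id_def)
next
  case (Suc n)
  then have "germ_lift q x T [^]\<^bsub>A\<^esub> Suc n = germ_lift q x (T ^^ n) \<otimes>\<^bsub>A\<^esub> germ_lift q x T"
    by (simp add: nat_pow_def)
  also have "\<dots> = germ_lift q x (T ^^ Suc n)"
    by (simp add: A_simps germ_lift_comp germ_op_funpow assms funpow_Suc_right o_def del: funpow.simps)
  finally show ?case .
qed

abbreviation DR :: "('n::finite, 'k) germ_op ring" where
  "DR \<equiv> carlitz_Delta_ring q x"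

lemma DR_simps: "add DR = add A" "mult DR = mult A" "one DR = one A" "zero DR = zero A"
  by (simp_all add: carlitz_Delta_ring_def)

text \<open>Products over index sets, as in \<open>Delta_monom\<close>, can be evaluated only where
  multiplication commutes; commuting generators are enough for that.\<close>

lemma cring_DR: "cring (DR :: ('n::finite, 'k) germ_op ring)"
proof -
  interpret A: ring "A :: ('n, 'k) germ_op ring"
    by (rule ring_A)
  let ?H = "range (carlitz_Delta q x) \<union> range (carlitz_scalar q x) :: ('n, 'k) germ_op set"
  have H: "?H \<subseteq> carrier A"
    unfolding carlitz_generator_eqs using generators_A by auto
  have ring: "ring (DR :: ('n, 'k) germ_op ring)"
    unfolding carlitz_Delta_ring_def by (rule A.generate_ring_is_ring[OF H])
  have comm_gen: "a \<otimes>\<^bsub>A\<^esub> b = b \<otimes>\<^bsub>A\<^esub> a" if ab: "a \<in> ?H" "b \<in> ?H" for a b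
  proof -
    obtain S T :: "('n, 'k) fn_op" where S: "a = germ_lift q x S" "S \<in> range Delta_fn \<union> range scal_fn"
      and T: "b = germ_lift q x T" "T \<in> range Delta_fn \<union> range scal_fn"
      using ab unfolding carlitz_generator_eqs by blast
    have "germ_op S" "germ_op T"
      using S(2) T(2) germ_op_Delta germ_op_scal by auto
    moreover have "S (T u) = T (S u)" for u
      using S(2) T(2) by (auto simp: Delta_scal Delta_commute) (simp_all add: scal_fn_def mult_ac)
    ultimately show ?thesis
      unfolding S(1) T(1) A_simps by (simp add: germ_lift_comp)
  qed
  have "a \<otimes>\<^bsub>DR\<^esub> b = b \<otimes>\<^bsub>DR\<^esub> a" if "a \<in> carrier DR" "b \<in> carrier DR" for a b :: "('n, 'k) germ_op"
    using A.generate_ring_commute[OF H comm_gen] that by (simp add: carlitz_Delta_ring_def)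
  then show ?thesis
    using ring by (intro cring.intro comm_monoid.intro comm_monoid_axioms.intro ring.is_monoid)
qed

lemma DR_carrier:
  "germ_lift q x (Delta_fn j) \<in> carrier DR" "germ_lift q x (scal_fn a) \<in> carrier DR"
  unfolding carlitz_Delta_ring_def carlitz_generator_eqs by (auto intro: generate_ring.incl)

lemma DR_pow: "a [^]\<^bsub>DR\<^esub> (n :: nat) = a [^]\<^bsub>A\<^esub> n"
  by (simp add: nat_pow_def DR_simps)

lemma Delta_monom_eq:
  fixes i :: "'n::finite \<Rightarrow>\<^sub>0 nat"
  shows "Delta_monom q x i = germ_lift q x (Delta_mon i)" and "Delta_monom q x i \<in> carrier DR"
proof -
  interpret D: cring "DR :: ('n, 'k) germ_op ring"
    by (rule cring_DR)
  let ?f = "\<lambda>j. carlitz_Delta q x j [^]\<^bsub>DR\<^esub> lookup i j"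
  have f: "?f j \<in> carrier DR" for j
    unfolding carlitz_Delta_eq using DR_carrier(1) by (rule D.nat_pow_closed)
  have prod: "finprod DR ?f (set js) = germ_lift q x (Delta_list js i)" if "distinct js" for js
    using that
  proof (induction js)
    case Nil
    show ?case
      by (simp add: DR_simps A_simps germ_lift_one id_def)
  next
    case (Cons j js)
    then have "finprod DR ?f (set (j # js)) = ?f j \<otimes>\<^bsub>DR\<^esub> germ_lift q x (Delta_list js i)"
      using f by simp
    also have "\<dots> = germ_lift q x (Delta_list (j # js) i)"
      unfolding carlitz_Delta_eq DR_pow germ_lift_A_pow[OF germ_op_Delta] DR_simps A_simps
      by (simp add: germ_lift_comp germ_op_funpow germ_op_Delta germ_op_Delta_list o_def)
    finally show ?case .
  qed
  obtain js :: "'n list" where js: "set js = UNIV" "distinct js" "Delta_mon = Delta_list js"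
    by (rule Delta_mon_list)
  show "Delta_monom q x i = germ_lift q x (Delta_mon i)"
    unfolding Delta_monom_def using prod[OF js(2)] js(1,3) by simp
  show "Delta_monom q x i \<in> carrier DR"
    unfolding Delta_monom_def using f by (intro D.finprod_closed) auto
qed

lemma mon_in_L:
  "carlitz_tau q x [^]\<^bsub>A\<^esub> l \<otimes>\<^bsub>A\<^esub> carlitz_d q x [^]\<^bsub>A\<^esub> \<mu> \<otimes>\<^bsub>A\<^esub> Delta_monom q x i =
    L (Poly_Mapping.single (l, \<mu>, i) 1)"
proof -
  have "germ_op (Delta_mon i)"
    using Delta_mon_list germ_op_Delta_list by metis
  moreover have "germ_op (\<lambda>u :: ('a, 'k) fn. (tau_fn ^^ l) ((d_fn ^^ \<mu>) u))"
    by (rule germ_op_comp[OF germ_op_funpow[OF germ_op_tau] germ_op_funpow[OF germ_op_d]])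
  ultimately have "carlitz_tau q x [^]\<^bsub>A\<^esub> l \<otimes>\<^bsub>A\<^esub> carlitz_d q x [^]\<^bsub>A\<^esub> \<mu> \<otimes>\<^bsub>A\<^esub> Delta_monom q x i =
      germ_lift q x (mon (l, \<mu>, i))"
    unfolding carlitz_generator_eqs germ_lift_A_pow[OF germ_op_tau] germ_lift_A_pow[OF germ_op_d]
      Delta_monom_eq(1) A_simps
    by (simp add: germ_lift_comp germ_op_funpow germ_op_tau germ_op_d mon_def o_def)
  also have "\<dots> = L (Poly_Mapping.single (l, \<mu>, i) 1)"
    by (rule L_eqI) (simp add: ev_single scal_fn_def)
  finally show ?thesis .
qed

lemma Delta_poly_eq:
  fixes P :: "('n::finite \<Rightarrow>\<^sub>0 nat) \<Rightarrow>\<^sub>0 'k"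
  shows "Delta_poly q x P = L (\<Sum>i\<in>keys P. Poly_Mapping.single (0, 0, i) (lookup P i))"
proof -
  interpret D: cring "DR :: ('n, 'k) germ_op ring"
    by (rule cring_DR)
  let ?f = "\<lambda>i. carlitz_scalar q x (lookup P i) \<otimes>\<^bsub>DR\<^esub> Delta_monom q x i"
  have "Delta_monom q x i = L (Poly_Mapping.single (0, 0, i) 1)" for i :: "'n \<Rightarrow>\<^sub>0 nat"
    unfolding Delta_monom_eq(1) by (rule L_eqI) (simp add: ev_single scal_fn_def mon_def)
  then have "?f i = L (scale (lookup P i) (Poly_Mapping.single (0, 0, i) 1))" for i
    by (simp add: DR_simps L_scale)
  then have f: "?f i = L (Poly_Mapping.single (0, 0, i) (lookup P i))" for i
    by (simp add: scale_single)
  have closed: "?f i \<in> carrier DR" for i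
    unfolding carlitz_scalar_eq by (intro D.m_closed DR_carrier Delta_monom_eq)
  have "finsum DR ?f S = L (\<Sum>i\<in>S. Poly_Mapping.single (0, 0, i) (lookup P i))" if "finite S" for S
    using that
  proof (induction S rule: finite_induct)
    case empty
    show ?case
      by (simp add: DR_simps L_zero)
  next
    case (insert i S)
    then have "finsum DR ?f (insert i S) = ?f i \<oplus>\<^bsub>DR\<^esub> finsum DR ?f S"
      using closed by (intro D.finsum_insert) auto
    then show ?case
      using insert by (simp add: f DR_simps(1) L_add)
  qed
  then show ?thesis
    by (simp add: Delta_poly_def)
qed

lemma left_module_regular: "left_module A (regular_module (A :: ('n::finite, 'k) germ_op ring))"
proof -
  interpret A: ring "A :: ('n, 'k) germ_op ring"
    by (rule ring_A)
  have "abelian_group (regular_module A :: (('n, 'k) germ_op, ('n, 'k) germ_op) module)"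
    by (rule abelian_groupI) (use A.add.l_inv_ex in \<open>auto simp: regular_module_def A.a_ac\<close>)
  then show ?thesis
    by (intro left_module.intro left_module_axioms.intro A.ring_axioms)
       (auto simp: regular_module_simps A.l_distr A.r_distr A.m_assoc)
qed

lemma scalar_hom:
  "carlitz_scalar q x a \<in> carrier (A :: ('n::finite, 'k) germ_op ring)"
  "(carlitz_scalar q x (a + b) :: ('n, 'k) germ_op) = carlitz_scalar q x a \<oplus>\<^bsub>A\<^esub> carlitz_scalar q x b"
  "(carlitz_scalar q x (a * b) :: ('n, 'k) germ_op) = carlitz_scalar q x a \<otimes>\<^bsub>A\<^esub> carlitz_scalar q x b"
  "(carlitz_scalar q x 1 :: ('n, 'k) germ_op) = \<one>\<^bsub>A\<^esub>"
proof -
  show "carlitz_scalar q x a \<in> carrier (A :: ('n, 'k) germ_op ring)"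
    by (simp add: scalar_in_L L_A)
  show "(carlitz_scalar q x (a + b) :: ('n, 'k) germ_op) = carlitz_scalar q x a \<oplus>\<^bsub>A\<^esub> carlitz_scalar q x b"
    by (simp add: scalar_in_L L_add single_add)
  have "scale a (Poly_Mapping.single (0 :: 'n expo) b) = Poly_Mapping.single 0 (a * b)"
    by (rule poly_mapping_eqI) (simp add: lookup_single when_def)
  then show "(carlitz_scalar q x (a * b) :: ('n, 'k) germ_op) = carlitz_scalar q x a \<otimes>\<^bsub>A\<^esub> carlitz_scalar q x b"
    using L_scale[of a "Poly_Mapping.single (0 :: 'n expo) b"]
    by (simp add: scalar_in_L[of b] scalar_in_L[of "a * b"])
  show "(carlitz_scalar q x 1 :: ('n, 'k) germ_op) = \<one>\<^bsub>A\<^esub>"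
    by (simp add: scalar_in_L L_one)
qed

lemma deg_le_add: "w \<in> deg_le n \<Longrightarrow> w' \<in> deg_le n \<Longrightarrow> w + w' \<in> deg_le n"
  using Poly_Mapping.keys_add[of w w'] by (auto simp: deg_le_def)

lemma deg_le_scale: "w \<in> deg_le n \<Longrightarrow> scale a w \<in> deg_le n"
  using keys_scale_subset[of a w] by (auto simp: deg_le_def)

lemma deg_le_zero: "0 \<in> deg_le n"
  by (simp add: deg_le_def)

lemma carlitz_filtration_eq: "carlitz_filtration q x \<nu> = L ` (deg_le \<nu> :: ('n::finite expo \<Rightarrow>\<^sub>0 'k) set)"
proof -
  let ?V = "restrict_scalars (carlitz_scalar q x) (regular_module (A :: ('n, 'k) germ_op ring))"
  let ?S = "{L (Poly_Mapping.single e 1) | e :: 'n expo. expo_deg e \<le> \<nu>}"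
  interpret V: vectorspace class_ring ?V
    using left_module.restrict_scalars_vectorspace[OF left_module_regular scalar_hom] .
  have V: "carrier ?V = carrier A" "add ?V = add A" "zero ?V = zero A"
    "module.smult ?V = (\<lambda>a m. carlitz_scalar q x a \<otimes>\<^bsub>A\<^esub> m)"
    by (simp_all add: restrict_scalars_def regular_module_def)
  have S: "{carlitz_tau q x [^]\<^bsub>A\<^esub> l \<otimes>\<^bsub>A\<^esub> carlitz_d q x [^]\<^bsub>A\<^esub> \<mu> \<otimes>\<^bsub>A\<^esub> Delta_monom q x i
       | (l :: nat) (\<mu> :: nat) (i :: 'n \<Rightarrow>\<^sub>0 nat). l + \<mu> + (\<Sum>j\<in>UNIV. lookup i j) \<le> \<nu>} = ?S"
    unfolding mon_in_L expo_deg_simp[symmetric] by force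
  have S_sub: "?S \<subseteq> carrier ?V"
    by (auto simp: V L_A)
  have "V.span ?S \<subseteq> L ` deg_le \<nu>"
  proof (rule V.span_is_subset)
    show "?S \<subseteq> L ` deg_le \<nu>"
      by (auto simp: deg_le_def)
    show "LinearCombinations.submodule class_ring (L ` deg_le \<nu>) ?V"
    proof (intro LinearCombinations.submodule.intro)
      show "Module.module class_ring ?V"
        by (rule V.module_axioms)
    qed (auto simp: V L_A L_add L_zero L_scale deg_le_add deg_le_zero deg_le_scale)
  qed
  moreover have "L ` deg_le \<nu> \<subseteq> V.span ?S"
  proof
    fix a :: "('n, 'k) germ_op"
    assume "a \<in> L ` deg_le \<nu>"
    then obtain w :: "'n expo \<Rightarrow>\<^sub>0 'k" where w: "a = L w" "w \<in> deg_le \<nu>"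
      by blast
    have sub: "LinearCombinations.submodule class_ring (V.span ?S) ?V"
      by (rule V.span_is_submodule[OF S_sub])
    have "L (\<Sum>e\<in>T. Poly_Mapping.single e (lookup w e)) \<in> V.span ?S" if "finite T" "T \<subseteq> keys w" for T
      using that
    proof (induction T rule: finite_induct)
      case empty
      show ?case
        using LinearCombinations.submodule.zero_closed[OF sub] by (simp add: V L_zero)
    next
      case (insert e T)
      have "expo_deg e \<le> \<nu>"
        using insert.prems w(2) by (auto simp: deg_le_def)
      then have "L (Poly_Mapping.single e 1) \<in> ?S"
        by blast
      then have "L (Poly_Mapping.single e 1) \<in> V.span ?S"
        by (rule subsetD[OF V.in_own_span[OF S_sub]])
      from LinearCombinations.submodule.smult_closed[OF sub _ this, of "lookup w e"]
      have "L (Poly_Mapping.single e (lookup w e)) \<in> V.span ?S"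
        by (simp add: V L_scale scale_single)
      from LinearCombinations.submodule.m_closed[OF sub this insert.IH] show ?case
        using insert by (simp add: V L_add)
    qed
    from this[of "keys w"] show "a \<in> V.span ?S"
      by (simp add: w(1) flip: poly_mapping_eq_sum_single)
  qed
  ultimately show ?thesis
    unfolding carlitz_filtration_def S by blast
qed

lemma carlitz_filtration_subgroup: "subgroup (carlitz_filtration q x \<nu>) (add_monoid A)"
proof -
  interpret A: ring A
    by (rule ring_A)
  show ?thesis
    unfolding carlitz_filtration_eq
    by (rule A.add.subgroupI)
       (auto simp: L_A L_uminus L_add deg_le_scale deg_le_add intro: deg_le_zero)
qed

lemma carlitz_filtration_mono: "carlitz_filtration q x \<nu> \<subseteq> carlitz_filtration q x (Suc \<nu>)"
  unfolding carlitz_filtration_eq by (auto simp: deg_le_def le_Suc_eq intro!: imageI)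

section \<open>The quotient by a principal left ideal\<close>

text \<open>The coefficient at \<open>e + \<delta>\<close> is the twisted leading coefficient of
  \<open>\<rho>\<close>: among the leading monomials \<open>e + f\<close> only
  \<open>f = \<delta>\<close> contributes, and the errors have degree below
  \<open>expo_deg e + expo_deg \<delta>\<close>.\<close>

lemma ev_mult_family:
  fixes \<rho> :: "'n::finite expo \<Rightarrow>\<^sub>0 'k"
  assumes \<delta>: "\<delta> \<in> keys \<rho>" "\<And>f. f \<in> keys \<rho> \<Longrightarrow> expo_key f \<le> expo_key \<delta>"
  obtains rm where "leading_family \<delta> rm" "\<And>e u. mon e (ev \<rho> u) = ev (rm e) u"
proof -
  have "\<exists>w. lookup w (e + \<delta>) \<noteq> 0 \<and> (\<forall>f\<in>keys w. expo_key f \<le> expo_key (e + \<delta>)) \<and>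
      (\<forall>u. mon e (ev \<rho> u) = ev w u)" for e
  proof -
    have "\<exists>w. (\<forall>g\<in>keys w. expo_deg g < expo_deg e + expo_deg f) \<and>
        (\<forall>u. mon e (scal_fn (lookup \<rho> f) (mon f u)) =
          (\<lambda>p. scal_fn (twist e (lookup \<rho> f)) (mon (e + f) u) p + ev w u p))" for f
    proof -
      obtain T where T: "below (expo_deg e + expo_deg f) T"
        "\<And>u. mon e (scal_fn (lookup \<rho> f) (mon f u)) =
          (\<lambda>p. scal_fn (twist e (lookup \<rho> f)) (mon (e + f) u) p + T u p)"
        using leads[of e] unfolding leads_def by blast
      then show ?thesis
        unfolding below_def by blast
    qed
    then have "\<exists>v. \<forall>f. (\<forall>g\<in>keys (v f). expo_deg g < expo_deg e + expo_deg f) \<and>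
        (\<forall>u. mon e (scal_fn (lookup \<rho> f) (mon f u)) =
          (\<lambda>p. scal_fn (twist e (lookup \<rho> f)) (mon (e + f) u) p + ev (v f) u p))"
      by (intro choice allI)
    then obtain v where v: "\<And>f g. g \<in> keys (v f) \<Longrightarrow> expo_deg g < expo_deg e + expo_deg f"
      "\<And>f u. mon e (scal_fn (lookup \<rho> f) (mon f u)) =
          (\<lambda>p. scal_fn (twist e (lookup \<rho> f)) (mon (e + f) u) p + ev (v f) u p)"
      by blast
    define w where "w = (\<Sum>f\<in>keys \<rho>. Poly_Mapping.single (e + f) (twist e (lookup \<rho> f)) + v f)"
    have deg: "expo_deg f \<le> expo_deg \<delta>" if "f \<in> keys \<rho>" for f
      using expo_deg_mono[OF \<delta>(2)[OF that]] .
    have "e + \<delta> \<notin> keys (v f)" if "f \<in> keys \<rho>" for f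
      using v(1)[of "e + \<delta>" f] deg[OF that] by (auto simp: expo_deg_add)
    then have "lookup w (e + \<delta>) = (\<Sum>f\<in>keys \<rho>. if f = \<delta> then twist e (lookup \<rho> f) else 0)"
      unfolding w_def lookup_sum
      by (intro sum.cong) (auto simp: lookup_add lookup_single when_def in_keys_iff)
    then have "lookup w (e + \<delta>) \<noteq> 0"
      using \<delta>(1) by (simp add: in_keys_iff)
    moreover have "expo_key g \<le> expo_key (e + \<delta>)" if g: "g \<in> keys w" for g
    proof -
      obtain f where f: "f \<in> keys \<rho>" "g \<in> keys (Poly_Mapping.single (e + f) (twist e (lookup \<rho> f)) + v f)"
        using g Poly_Mapping.keys_sum[of "\<lambda>f. Poly_Mapping.single (e + f) (twist e (lookup \<rho> f)) + v f" "keys \<rho>"]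
        unfolding w_def by blast
      then consider "g = e + f" | "g \<in> keys (v f)"
        using Poly_Mapping.keys_add[of "Poly_Mapping.single (e + f) (twist e (lookup \<rho> f))" "v f"]
        by (auto split: if_splits)
      then show ?thesis
      proof cases
        case 1
        then show ?thesis
          using \<delta>(2)[OF f(1)] by (simp add: expo_key_add)
      next
        case 2
        then have "expo_deg g < expo_deg (e + \<delta>)"
          using v(1)[of g f] deg[OF f(1)] by (simp add: expo_deg_add)
        then show ?thesis
          using expo_key_less_if_deg_less less_imp_le by blast
      qed
    qed
    moreover have "mon e (ev \<rho> u) = ev w u" for u
      unfolding ev_comp_eq_sum[OF additive_mon] v(2) w_def by (simp add: fun_eq_iff ev_sum ev_add ev_single)
    ultimately show ?thesis
      by blast
  qed
  then have "\<exists>rm. \<forall>e. lookup (rm e) (e + \<delta>) \<noteq> 0 \<and>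
      (\<forall>f\<in>keys (rm e). expo_key f \<le> expo_key (e + \<delta>)) \<and> (\<forall>u. mon e (ev \<rho> u) = ev (rm e) u)"
    by (intro choice allI)
  then obtain rm where "\<And>e. lookup (rm e) (e + \<delta>) \<noteq> 0"
    "\<And>e f. f \<in> keys (rm e) \<Longrightarrow> expo_key f \<le> expo_key (e + \<delta>)" "\<And>e u. mon e (ev \<rho> u) = ev (rm e) u"
    by blast
  then show thesis
    using that[of rm] by (simp add: leading_family_def)
qed

lemma quotient_quasi_holonomic:
  fixes \<rho> :: "'n::finite expo \<Rightarrow>\<^sub>0 'k"
  assumes e0: "e0 \<in> keys \<rho>" "expo_deg e0 > 0"
  shows "quasi_holonomic q x (quotient_module A (PIdl\<^bsub>A\<^esub> (L \<rho>)))"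
proof -
  have "\<rho> \<noteq> 0"
    using e0 by auto
  then obtain \<delta> where \<delta>: "\<delta> \<in> keys \<rho>" "\<And>f. f \<in> keys \<rho> \<Longrightarrow> expo_key f \<le> expo_key \<delta>"
    using max_key_exists by blast
  have deg_\<delta>: "expo_deg \<delta> > 0"
    using expo_deg_mono[OF \<delta>(2)[OF e0(1)]] e0(2) by simp
  obtain rm where lf: "leading_family \<delta> rm" and rm: "\<And>e u. mon e (ev \<rho> u) = ev (rm e) u"
    using ev_mult_family[OF \<delta>] by blast
  interpret leading_family \<delta> rm
    by (rule lf)
  interpret A: ring "A :: ('n, 'k) germ_op ring"
    by (rule ring_A)
  define I where "I = PIdl\<^bsub>A\<^esub> (L \<rho>)"
  interpret I: left_ideal "A :: ('n, 'k) germ_op ring" I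
    unfolding I_def by (rule A.principal_left_ideal[OF L_A])
  let ?M = "quotient_module A I"
  let ?h = "carlitz_scalar q x :: 'k \<Rightarrow> ('n, 'k) germ_op"
  let ?\<Gamma> = "carlitz_filtration q x :: nat \<Rightarrow> ('n, 'k) germ_op set"
  define \<pi> where "\<pi> w = I +>\<^bsub>A\<^esub> L w" for w
  define F where "F s = \<pi> ` deg_le s" for s
  \<comment> \<open>In coordinates, left multiples of the generator are the values of
    \<open>comb\<close>; this identifies the left ideal with \<open>range comb\<close>.\<close>
  have mult: "L w \<otimes>\<^bsub>A\<^esub> L \<rho> = L (comb w)" for w
  proof -
    have "ev w (ev \<rho> u) = ev (comb w) u" for u
      by (simp add: ev_def[of w "ev \<rho> u"] rm comb_def fun_eq_iff ev_sum ev_scale scal_fn_apply)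
    then show ?thesis
      unfolding A_simps L_def germ_lift_comp[OF germ_op_ev germ_op_ev]
      by (intro arg_cong[of _ _ "germ_lift q x"]) auto
  qed
  have I_eq: "I = L ` range comb"
  proof -
    have "I = (\<lambda>a. a \<otimes>\<^bsub>A\<^esub> L \<rho>) ` range L"
      by (auto simp: I_def cgenideal_def carrier_A)
    then show ?thesis
      by (simp add: image_image mult)
  qed
  have in_I: "L w \<in> I \<longleftrightarrow> w \<in> range comb" for w
    unfolding I_eq by (auto simp: L_inj)
  have diff: "L w \<ominus>\<^bsub>A\<^esub> L w' = L (w - w')" for w w'
    by (simp add: a_minus_def L_uminus L_add scale_minus scale_one)
  have \<pi>_eq: "\<pi> w = \<pi> w' \<longleftrightarrow> w - w' \<in> range comb" for w w'
    unfolding \<pi>_def I.quot_eq_iff[OF L_A L_A] diff in_I ..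
  have M_add: "\<pi> w \<oplus>\<^bsub>?M\<^esub> \<pi> w' = \<pi> (w + w')" for w w'
    by (simp add: \<pi>_def I.quot_add L_A L_add)
  have M_zero: "\<zero>\<^bsub>?M\<^esub> = \<pi> 0"
    by (simp add: \<pi>_def I.quot_zero L_zero)
  have M_smult: "?h a \<odot>\<^bsub>?M\<^esub> \<pi> w = \<pi> (scale a w)" for a w
    using I.quot_smult[OF scalar_hom(1) L_A] by (simp add: \<pi>_def L_scale)
  have M_carrier: "carrier ?M = range \<pi>"
    by (auto simp: I.quot_carrier carrier_A \<pi>_def)
  have M: "left_module A ?M"
    by (rule I.quot_left_module)
  interpret V: vectorspace class_ring "restrict_scalars ?h ?M"
    using left_module.restrict_scalars_vectorspace[OF M scalar_hom] .
  have V: "carrier (restrict_scalars ?h ?M) = range \<pi>" "add (restrict_scalars ?h ?M) = add ?M"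
    "zero (restrict_scalars ?h ?M) = \<pi> 0" "module.smult (restrict_scalars ?h ?M) = (\<lambda>a m. ?h a \<odot>\<^bsub>?M\<^esub> m)"
    by (simp_all add: restrict_scalars_def M_carrier M_zero)
  have sub: "VectorSpace.subspace class_ring (F s) (restrict_scalars ?h ?M)" for s
  proof (intro VectorSpace.subspace.intro LinearCombinations.submodule.intro)
    show "vectorspace class_ring (restrict_scalars ?h ?M)"
      by (rule V.vectorspace_axioms)
    show "Module.module class_ring (restrict_scalars ?h ?M)"
      by (rule V.module_axioms)
  qed (auto simp: V F_def M_add M_smult deg_le_zero deg_le_add deg_le_scale)
  have dim: "vectorspace.fin_dim class_ring (filt_vs ?h ?M F s) \<and>
      vectorspace.dim class_ring (filt_vs ?h ?M F s) = card (standard s)" for s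
  proof -
    let ?W = "filt_vs ?h ?M F s"
    interpret W: vectorspace class_ring "?W"
      using V.subspace_is_vs[OF sub] by (simp add: filt_vs_def)
    have W: "carrier (?W) = F s" "add (?W) = add ?M"
      "zero (?W) = \<pi> 0" "module.smult (?W) = (\<lambda>a m. ?h a \<odot>\<^bsub>?M\<^esub> m)"
      using V by (simp_all add: filt_vs_def)
    let ?b = "\<lambda>e. \<pi> (Poly_Mapping.single e 1)"
    have b: "?b e \<in> F s" if "e \<in> standard s" for e
      using that by (auto simp: F_def standard_def deg_le_def)
    have sum: "(\<Oplus>\<^bsub>?W\<^esub>e\<in>T. c e \<odot>\<^bsub>?W\<^esub> ?b e) =
        \<pi> (\<Sum>e\<in>T. Poly_Mapping.single e (c e))" if "finite T" "T \<subseteq> standard s" for T c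
      using that
    proof (induction T rule: finite_induct)
      case empty
      show ?case
        by (simp add: W)
    next
      case (insert e T)
      have cb: "c e \<odot>\<^bsub>?W\<^esub> ?b e \<in> carrier (?W)" if "e \<in> standard s" for e
        using W.smult_closed[of "c e" "?b e"] b[OF that] by (simp add: W)
      have "(\<Oplus>\<^bsub>?W\<^esub>e\<in>insert e T. c e \<odot>\<^bsub>?W\<^esub> ?b e) =
          (c e \<odot>\<^bsub>?W\<^esub> ?b e) \<oplus>\<^bsub>?W\<^esub>
          (\<Oplus>\<^bsub>?W\<^esub>e\<in>T. c e \<odot>\<^bsub>?W\<^esub> ?b e)"
        using insert cb by (intro W.M.finsum_insert) auto
      also have "\<dots> = \<pi> (scale (c e) (Poly_Mapping.single e 1)) \<oplus>\<^bsub>?M\<^esub> \<pi> (\<Sum>e\<in>T. Poly_Mapping.single e (c e))"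
        using insert by (simp add: W M_smult)
      also have "\<dots> = \<pi> (\<Sum>e\<in>insert e T. Poly_Mapping.single e (c e))"
        using insert by (simp add: M_add scale_single)
      finally show ?case .
    qed
    have gen: "\<exists>c. (\<forall>e. c e \<in> carrier class_ring) \<and>
        v = (\<Oplus>\<^bsub>?W\<^esub>e\<in>standard s. c e \<odot>\<^bsub>?W\<^esub> ?b e)"
      if v: "v \<in> carrier (?W)" for v
    proof -
      obtain w where w: "v = \<pi> w" "w \<in> deg_le s"
        using v by (auto simp: W F_def)
      obtain w' where w': "\<forall>e\<in>keys w'. expo_deg e \<le> s" "\<forall>e. lookup w' (e + \<delta>) = 0" "w - w' \<in> range comb"
        using reducible[of w s] w(2) by (auto simp: deg_le_def reducible_def)
      have "keys w' \<subseteq> standard s"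
        using w'(1,2) by (auto simp: standard_def in_keys_iff)
      then have "w' = (\<Sum>e\<in>standard s. Poly_Mapping.single e (lookup w' e))"
        using poly_mapping_eq_sum_single[of w'] finite_standard
        by (subst sum.mono_neutral_right[of _ "keys w'"]) (auto simp: in_keys_iff)
      then have "v = (\<Oplus>\<^bsub>?W\<^esub>e\<in>standard s. lookup w' e \<odot>\<^bsub>?W\<^esub> ?b e)"
        using sum[OF finite_standard subset_refl, of "lookup w'"] w(1) w'(3) \<pi>_eq by simp
      then show ?thesis
        by auto
    qed
    have indep: "c e = \<zero>\<^bsub>class_ring\<^esub>"
      if "\<And>e. c e \<in> carrier class_ring"
        and zero: "(\<Oplus>\<^bsub>?W\<^esub>e\<in>standard s. c e \<odot>\<^bsub>?W\<^esub> ?b e) = \<zero>\<^bsub>?W\<^esub>"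
        and e: "e \<in> standard s" for c e
    proof -
      define w where "w = (\<Sum>e\<in>standard s. Poly_Mapping.single e (c e))"
      have look: "lookup w f = (if f \<in> standard s then c f else 0)" for f
        using finite_standard by (simp add: w_def lookup_sum lookup_single when_def)
      have "\<pi> w = \<pi> 0"
        using zero sum[OF finite_standard subset_refl, of c] by (simp add: W w_def)
      then obtain a where a: "w = comb a"
        unfolding \<pi>_eq by auto
      have "a = 0"
      proof (rule ccontr)
        assume "a \<noteq> 0"
        then obtain f where "lookup w (f + \<delta>) \<noteq> 0"
          using comb_lead a by blast
        moreover have "f + \<delta> \<notin> standard s"
          unfolding standard_def by blast
        ultimately show False
          by (simp add: look)
      qed
      then have "w = 0"
        by (simp add: a comb_zero)
      then show ?thesis
        using look[of e] e by simp
    qed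
    have b': "?b e \<in> carrier (?W)" if "e \<in> standard s" for e
      using b[OF that] by (simp add: W)
    show ?thesis
      by (intro conjI W.dim_eq_card_if_basis_family[where b = ?b]; fact finite_standard b' gen indep)
  qed
  have act: "L w \<odot>\<^bsub>?M\<^esub> \<pi> w' \<in> F (m + n)" if deg: "w \<in> deg_le m" "w' \<in> deg_le n" for w w' m n
  proof -
    obtain w'' where "w'' \<in> deg_le (m + n)" "L w \<otimes>\<^bsub>A\<^esub> L w' = L w''"
      using L_mult[OF deg] by blast
    then show ?thesis
      using I.quot_smult[OF L_A L_A, of w w'] by (auto simp: \<pi>_def F_def)
  qed
  have filt: "module_filtration ?h ?\<Gamma> ?M F"
    unfolding module_filtration_def
  proof (intro conjI allI ballI)
    show "F s \<subseteq> F (Suc s)" for s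
      by (auto simp: F_def deg_le_def le_Suc_eq intro!: imageI)
    show "(\<Union>s. F s) = carrier ?M"
      unfolding F_def M_carrier using deg_le_ex by blast
    show "a \<odot>\<^bsub>?M\<^esub> m \<in> F (\<nu> + j)" if "a \<in> ?\<Gamma> \<nu>" "m \<in> F j" for \<nu> j a m
      using that act by (auto simp: carlitz_filtration_eq F_def)
  qed (use sub dim in auto)
  interpret FM: filtered_left_module A ?M ?\<Gamma> F
    by (rule module_filtration_imp_filtered[OF M carlitz_filtration_subgroup carlitz_filtration_mono filt])
  \<comment> \<open>The quotient is generated by the class of 1, and \<open>F\<close> is the image
    of the filtration of the ring, so the graded module is cyclic too.\<close>
  have "fg_module (gr_ring A ?\<Gamma>) (gr_module ?M F)"
  proof (rule FM.gr_fg_if_cyclic)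
    show "\<pi> (Poly_Mapping.single 0 1) \<in> F 0"
      unfolding F_def by (rule imageI) (auto simp: deg_le_def expo_deg_def)
    show "F k = (\<lambda>r. r \<odot>\<^bsub>?M\<^esub> \<pi> (Poly_Mapping.single 0 1)) ` ?\<Gamma> k" for k
    proof -
      have "L w \<odot>\<^bsub>?M\<^esub> \<pi> (Poly_Mapping.single 0 1) = \<pi> w" for w
        using I.quot_smult[OF L_A A.one_closed, of w] by (simp add: \<pi>_def L_A del: single_one flip: L_one)
      then show ?thesis
        by (simp add: carlitz_filtration_eq F_def image_image)
    qed
  qed
  then have good: "good_filtration ?h A ?\<Gamma> ?M F"
    using filt by (simp add: good_filtration_def)
  \<comment> \<open>Here \<open>d\<close> is \<open>CARD('n) + 1\<close>, so that
    \<open>Suc d\<close> is the number of exponents \<open>n + 2\<close> in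
    \<open>card_standard\<close>.\<close>
  obtain H :: "rat poly" where H: "Polynomial.degree H = CARD('n) + 1"
    "\<And>s. s \<ge> expo_deg \<delta> \<Longrightarrow> poly H (rat_of_nat s) =
      rat_of_nat ((s + Suc (CARD('n) + 1)) choose Suc (CARD('n) + 1)) -
      rat_of_nat ((s - expo_deg \<delta> + Suc (CARD('n) + 1)) choose Suc (CARD('n) + 1))"
    using binomial_difference_polynomial[OF deg_\<delta>] by blast
  have "\<forall>\<^sub>F s in sequentially.
      rat_of_nat (vectorspace.dim class_ring (filt_vs ?h ?M F s)) = poly H (rat_of_nat s)"
    using eventually_ge_at_top[of "expo_deg \<delta>"]
    by eventually_elim (simp add: dim card_standard H(2))
  from module_dim_eqI[OF M carlitz_filtration_subgroup carlitz_filtration_mono good this]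
  show ?thesis
    unfolding quasi_holonomic_def I_def[symmetric] using M H(1) by simp
qed

text \<open>In \<open>R\<close> the operator \<open>d\<close> stands to the right of the
  \<open>\<Delta>_j\<close>. Reordering turns \<open>\<Delta>^i d\<close> into
  \<open>d \<Delta>^i\<close> plus terms of degree at most \<open>|i|\<close>. For \<open>i0\<close>
  of maximal degree in \<open>Q\<close>, the coefficient at \<open>d \<Delta>^i0\<close> is
  therefore that of \<open>Q\<close>, while the monomials from \<open>P\<close> contain no
  \<open>d\<close>.\<close>

lemma Delta_poly_d_key:
  fixes P Q :: "('n::finite \<Rightarrow>\<^sub>0 nat) \<Rightarrow>\<^sub>0 'k"
  assumes "Q \<noteq> 0"
  obtains \<rho> e where "Delta_poly q x P \<oplus>\<^bsub>A\<^esub> Delta_poly q x Q \<otimes>\<^bsub>A\<^esub> carlitz_d q x = L \<rho>"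
    "e \<in> keys \<rho>" "expo_deg e > 0"
proof -
  let ?deg = "\<lambda>i :: 'n \<Rightarrow>\<^sub>0 nat. \<Sum>j\<in>UNIV. lookup i j"
  have "Max (?deg ` keys Q) \<in> ?deg ` keys Q"
    using assms by (intro Max_in) auto
  then obtain i0 where i0: "i0 \<in> keys Q" "\<And>i. i \<in> keys Q \<Longrightarrow> ?deg i \<le> ?deg i0"
    using Max_ge[of "?deg ` keys Q"] by (metis (no_types, lifting) finite_imageI finite_keys imageE imageI)
  have "\<exists>w. (\<forall>g\<in>keys w. expo_deg g < ?deg i + 1) \<and>
      (\<forall>u. mon (0, 0, i) (mon (0, 1, 0) u) = (\<lambda>p. mon (0, 1, i) u p + ev w u p))" for i :: "'n \<Rightarrow>\<^sub>0 nat"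
  proof -
    obtain T where T: "below (expo_deg (0, 0, i) + expo_deg (0, 1, 0 :: 'n \<Rightarrow>\<^sub>0 nat)) T"
      "\<And>u. mon (0, 0, i) (scal_fn 1 (mon (0, 1, 0) u)) =
        (\<lambda>p. scal_fn (twist (0, 0, i) 1) (mon ((0, 0, i) + (0, 1, 0)) u) p + T u p)"
      using leads[of "(0, 0, i)"] unfolding leads_def by blast
    moreover have "scal_fn 1 u = u" for u :: "('n, 'k) fn"
      by (simp add: scal_fn_def)
    ultimately show ?thesis
      unfolding below_def by (auto simp: twist_one expo_deg_simp)
  qed
  then have "\<exists>v. \<forall>i. (\<forall>g\<in>keys (v i). expo_deg g < ?deg i + 1) \<and>
      (\<forall>u. mon (0, 0, i) (mon (0, 1, 0) u) = (\<lambda>p. mon (0, 1, i) u p + ev (v i) u p))"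
    by (intro choice allI)
  then obtain v where v: "\<And>i g. g \<in> keys (v i) \<Longrightarrow> expo_deg g < ?deg i + 1"
    "\<And>i u. mon (0, 0, i) (mon (0, 1, 0) u) = (\<lambda>p. mon (0, 1, i) u p + ev (v i) u p)"
    by blast
  define wP where "wP = (\<Sum>i\<in>keys P. Poly_Mapping.single (0 :: nat, 0 :: nat, i) (lookup P i))"
  define wQ where "wQ = (\<Sum>i\<in>keys Q. Poly_Mapping.single (0 :: nat, 0 :: nat, i) (lookup Q i))"
  define wd where "wd = (\<Sum>i\<in>keys Q. scale (lookup Q i) (Poly_Mapping.single (0, 1, i) 1 + v i))"
  have "ev wQ (mon (0, 1, 0) u) = ev wd u" for u
    by (simp add: fun_eq_iff wQ_def wd_def ev_sum ev_single ev_scale scal_fn_apply ev_add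
        v(2)[unfolded One_nat_def])
  then have "L wQ \<otimes>\<^bsub>A\<^esub> carlitz_d q x = L wd"
    unfolding d_in_L A_simps L_def germ_lift_comp[OF germ_op_ev germ_op_ev]
    by (intro arg_cong[of _ _ "germ_lift q x"]) (simp add: fun_eq_iff ev_single scal_fn_def)
  then have R: "Delta_poly q x P \<oplus>\<^bsub>A\<^esub> Delta_poly q x Q \<otimes>\<^bsub>A\<^esub> carlitz_d q x = L (wP + wd)"
    by (simp add: Delta_poly_eq L_add flip: wP_def wQ_def)
  have "lookup wP (0, 1, i0) = 0"
    by (simp add: wP_def lookup_sum lookup_single when_def)
  moreover have "lookup (v i) (0, 1, i0) = 0" if "i \<in> keys Q" for i
    using v(1)[of "(0, 1, i0)" i] i0(2)[OF that] by (auto simp: in_keys_iff expo_deg_simp)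
  then have "lookup wd (0, 1, i0) = (\<Sum>i\<in>keys Q. if i = i0 then lookup Q i else 0)"
    unfolding wd_def lookup_sum by (intro sum.cong) (auto simp: lookup_add lookup_single when_def)
  ultimately have "(0, 1, i0) \<in> keys (wP + wd)"
    using i0(1) by (simp add: in_keys_iff lookup_add)
  moreover have "expo_deg (0, 1, i0) > 0"
    by (simp add: expo_deg_simp)
  ultimately show thesis
    using that[OF R] by blast
qed

end

theorem theorem2:
  fixes \<iota> :: "'f::{field,finite} fls alg_closure \<Rightarrow> 'k::{nonarchimedean_field,complete_space}"
    and P Q :: "('n::finite \<Rightarrow>\<^sub>0 nat) \<Rightarrow>\<^sub>0 'k"
    and q :: nat and x :: 'k
    and A :: "('n, 'k) germ_op ring" and R :: "('n, 'k) germ_op"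
  assumes "completed_algebraic_closure \<iota>"
    and "q = CARD('f)"
    and "x = \<iota> (to_ac fls_X)"
    and "A = carlitz_ring q x"
    and "P \<noteq> 0" and "Q \<noteq> 0"
    and "R = Delta_poly q x P \<oplus>\<^bsub>A\<^esub> Delta_poly q x Q \<otimes>\<^bsub>A\<^esub> carlitz_d q x"
  shows "quasi_holonomic q x (quotient_module A (PIdl\<^bsub>A\<^esub> R))"
proof -
  interpret carlitz_field q x
    unfolding assms(2,3) using assms(1) by (rule completed_algebraic_closure.carlitz_field)
  show ?thesis
    using Delta_poly_d_key[OF assms(6), of P] quotient_quasi_holonomic unfolding assms(4,7) by metis
qed

end
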